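(* The graph $C_{10}(2)$ has no quantum symmetry, that is, the canonical surjection $A(C_{10}(2))\to\mathbb C(G(C_{10}(2)))$ is an isomorphism (equivalently, the algebra $A(C_{10}(2))$ is commutative).
   Context: $C_{10}(2)$ is the graph obtained from the $10$-cycle by additionally connecting all pairs of vertices at distance $2$ in the cycle. A magic unitary is a square matrix over a unital $\mathbb C^*$-algebra whose entries are projections and each of whose rows and columns consists of pairwise orthogonal projections with sum $1$. For a finite (simple, undirected) graph $X$ with vertex set $\{1,\dots,n\}$ and adjacency matrix $d$, $A(X)$ is the universal unital $\mathbb C^*$-algebra generated by elements $u_{ij}$ ($1\le i,j\le n$) subject to the relations making $u=(u_{ij})$ a magic unitary and $du=ud$; it is a Hopf $\mathbb C^*$-algebra with $\Delta(u_{ij})=\sum_k u_{ik}\otimes u_{kj}$, $\varepsilon(u_{ij})=\delta_{ij}$, $S(u_{ij})=u_{ji}$. $G(X)$ is the usual automorphism group of $X$ and $\mathbb C(G(X))$ its algebra of complex functions. The canonical surjection $A(X)\to\mathbb C(G(X))$ sends $u_{ij}$ to the characteristic function of $\{\sigma\in G(X)\mid\sigma(j)=i\}$; its kernel is the commutator ideal. *)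

theory Defs
  imports
    Complex_Main
    "HOL-Library.Poly_Mapping"
    "HOL-Library.Numeral_Type"
    "HOL-Library.FuncSet"
    "HOL-Algebra.Module"
    "HOL-Algebra.RingHom"
begin

section \<open>Unital C*-algebras\<close>

record 'a cstar = "(complex, 'a) module" +
  star :: "'a \<Rightarrow> 'a"
  cnorm :: "'a \<Rightarrow> real"

locale cstar_algebra = ring A for A :: "('a, 'm) cstar_scheme" (structure) +
  assumes smult_closed: "x \<in> carrier A \<Longrightarrow> c \<odot> x \<in> carrier A"
    and smult_l_distr: "x \<in> carrier A \<Longrightarrow> (c + d) \<odot> x = c \<odot> x \<oplus> d \<odot> x"
    and smult_r_distr: "x \<in> carrier A \<Longrightarrow> y \<in> carrier A \<Longrightarrow> c \<odot> (x \<oplus> y) = c \<odot> x \<oplus> c \<odot> y"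
    and smult_assoc: "x \<in> carrier A \<Longrightarrow> (c * d) \<odot> x = c \<odot> (d \<odot> x)"
    and smult_one: "x \<in> carrier A \<Longrightarrow> 1 \<odot> x = x"
    and smult_mult_left: "x \<in> carrier A \<Longrightarrow> y \<in> carrier A \<Longrightarrow> (c \<odot> x) \<otimes> y = c \<odot> (x \<otimes> y)"
    and smult_mult_right: "x \<in> carrier A \<Longrightarrow> y \<in> carrier A \<Longrightarrow> x \<otimes> (c \<odot> y) = c \<odot> (x \<otimes> y)"
    and star_closed: "x \<in> carrier A \<Longrightarrow> star A x \<in> carrier A"
    and star_star: "x \<in> carrier A \<Longrightarrow> star A (star A x) = x"
    and star_add: "x \<in> carrier A \<Longrightarrow> y \<in> carrier A \<Longrightarrow> star A (x \<oplus> y) = star A x \<oplus> star A y"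
    and star_smult: "x \<in> carrier A \<Longrightarrow> star A (c \<odot> x) = cnj c \<odot> star A x"
    and star_mult: "x \<in> carrier A \<Longrightarrow> y \<in> carrier A \<Longrightarrow> star A (x \<otimes> y) = star A y \<otimes> star A x"
    and norm_nonneg: "x \<in> carrier A \<Longrightarrow> 0 \<le> cnorm A x"
    and norm_eq_zero: "x \<in> carrier A \<Longrightarrow> cnorm A x = 0 \<Longrightarrow> x = \<zero>"
    and norm_triangle: "x \<in> carrier A \<Longrightarrow> y \<in> carrier A \<Longrightarrow> cnorm A (x \<oplus> y) \<le> cnorm A x + cnorm A y"
    and norm_smult: "x \<in> carrier A \<Longrightarrow> cnorm A (c \<odot> x) = cmod c * cnorm A x"
    and norm_mult: "x \<in> carrier A \<Longrightarrow> y \<in> carrier A \<Longrightarrow> cnorm A (x \<otimes> y) \<le> cnorm A x * cnorm A y"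
    and norm_cstar: "x \<in> carrier A \<Longrightarrow> cnorm A (star A x \<otimes> x) = (cnorm A x)\<^sup>2"
    and complete: "\<lbrakk>\<And>n. f n \<in> carrier A;
        \<forall>e>0. \<exists>M. \<forall>m\<ge>M. \<forall>n\<ge>M. cnorm A (f m \<ominus> f n) < e\<rbrakk>
      \<Longrightarrow> \<exists>x\<in>carrier A. (\<lambda>n. cnorm A (f n \<ominus> x)) \<longlonglongrightarrow> 0"

definition cstar_hom :: "('a, 'm) cstar_scheme \<Rightarrow> ('b, 'k) cstar_scheme \<Rightarrow> ('a \<Rightarrow> 'b) set" where
  "cstar_hom A B = {\<phi> \<in> ring_hom A B.
     (\<forall>c. \<forall>x\<in>carrier A. \<phi> (c \<odot>\<^bsub>A\<^esub> x) = c \<odot>\<^bsub>B\<^esub> \<phi> x) \<and>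
     (\<forall>x\<in>carrier A. \<phi> (star A x) = star B (\<phi> x))}"

definition cstar_iso :: "('a, 'm) cstar_scheme \<Rightarrow> ('b, 'k) cstar_scheme \<Rightarrow> ('a \<Rightarrow> 'b) set" where
  "cstar_iso A B = {\<phi> \<in> cstar_hom A B. bij_betw \<phi> (carrier A) (carrier B)}"

definition commutative_algebra :: "('a, 'm) cstar_scheme \<Rightarrow> bool" where
  "commutative_algebra A \<longleftrightarrow> (\<forall>x\<in>carrier A. \<forall>y\<in>carrier A. x \<otimes>\<^bsub>A\<^esub> y = y \<otimes>\<^bsub>A\<^esub> x)"

definition fun_cstar :: "'s set \<Rightarrow> ('s \<Rightarrow> complex) cstar" where
  "fun_cstar G = \<lparr>carrier = extensional G,
     monoid.mult = (\<lambda>f g. \<lambda>s\<in>G. f s * g s), one = (\<lambda>s\<in>G. 1),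
     zero = (\<lambda>s\<in>G. 0), add = (\<lambda>f g. \<lambda>s\<in>G. f s + g s),
     smult = (\<lambda>c f. \<lambda>s\<in>G. c * f s),
     star = (\<lambda>f. \<lambda>s\<in>G. cnj (f s)), cnorm = (\<lambda>f. SUP s\<in>G. cmod (f s))\<rparr>"


section \<open>Universal C*-algebras\<close>

text \<open>
  The free unital complex *-algebra on a set of self-adjoint generators: the monoid algebra
  (with the convolution product of \<^theory>\<open>HOL-Library.Poly_Mapping\<close>) of the free monoid,
  written additively as that theory requires. Self-adjointness of the generators is the relation
  \<open>u\<^sub>i\<^sub>j\<^sup>* = u\<^sub>i\<^sub>j\<close> of a magic unitary; the remaining ones are \<open>qaut_relators\<close> below.
\<close>

datatype 'g free_word = Word (letters: "'g list")

instantiation free_word :: (type) monoid_add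
begin
definition "0 = Word []"
definition "v + w = Word (letters v @ letters w)"
instance by standard (simp_all add: zero_free_word_def plus_free_word_def)
end

type_synonym 'g free_star_algebra = "'g free_word \<Rightarrow>\<^sub>0 complex"

definition gen :: "'g \<Rightarrow> 'g free_star_algebra" where
  "gen g = Poly_Mapping.single (Word [g]) 1"

definition scale :: "complex \<Rightarrow> 'g free_star_algebra \<Rightarrow> 'g free_star_algebra" where
  "scale c a = Poly_Mapping.single 0 c * a"

definition rev_word :: "'g free_word \<Rightarrow> 'g free_word" where
  "rev_word w = Word (rev (letters w))"

definition adj :: "'g free_star_algebra \<Rightarrow> 'g free_star_algebra" where
  "adj a = Poly_Mapping.map cnj (Poly_Mapping.map_key rev_word a)"

definition cstar_seminorm :: "('g free_star_algebra \<Rightarrow> real) \<Rightarrow> bool" where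
  "cstar_seminorm p \<longleftrightarrow>
     (\<forall>a. 0 \<le> p a) \<and>
     (\<forall>a b. p (a + b) \<le> p a + p b) \<and>
     (\<forall>c a. p (scale c a) = cmod c * p a) \<and>
     (\<forall>a b. p (a * b) \<le> p a * p b) \<and>
     (\<forall>a. p (adj a * a) = (p a)\<^sup>2)"

definition rel_seminorms :: "'g free_star_algebra set \<Rightarrow> ('g free_star_algebra \<Rightarrow> real) set" where
  "rel_seminorms R = {p. cstar_seminorm p \<and> (\<forall>r\<in>R. p r = 0)}"

text \<open>
  The null space of a C*-seminorm is a two-sided *-ideal, so the members of
  \<^term>\<open>rel_seminorms R\<close> are exactly the C*-seminorms of the *-algebra presented by \<open>R\<close>.
  The supremum is meaningful only if these are pointwise bounded; for the relations used below
  this is lemma \<open>bounded_relators_qaut\<close>.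
\<close>

definition univ_norm :: "'g free_star_algebra set \<Rightarrow> 'g free_star_algebra \<Rightarrow> real" where
  "univ_norm R a = (SUP p\<in>rel_seminorms R. p a)"

definition cauchy_seq :: "('g free_star_algebra \<Rightarrow> real) \<Rightarrow> (nat \<Rightarrow> 'g free_star_algebra) \<Rightarrow> bool" where
  "cauchy_seq p f \<longleftrightarrow> (\<forall>e>0. \<exists>M. \<forall>m\<ge>M. \<forall>n\<ge>M. p (f m - f n) < e)"

definition seq_class ::
  "('g free_star_algebra \<Rightarrow> real) \<Rightarrow> (nat \<Rightarrow> 'g free_star_algebra) \<Rightarrow> (nat \<Rightarrow> 'g free_star_algebra) set" where
  "seq_class p f = {g. cauchy_seq p g \<and> (\<lambda>n. p (g n - f n)) \<longlonglongrightarrow> 0}"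

text \<open>Separated completion with respect to a C*-seminorm: Cauchy sequences modulo null sequences.\<close>

definition completion ::
  "('g free_star_algebra \<Rightarrow> real) \<Rightarrow> (nat \<Rightarrow> 'g free_star_algebra) set cstar" where
  "completion p = \<lparr>carrier = seq_class p ` {f. cauchy_seq p f},
     monoid.mult = (\<lambda>P Q. \<Union>f\<in>P. \<Union>g\<in>Q. seq_class p (\<lambda>n. f n * g n)),
     one = seq_class p (\<lambda>n. 1),
     zero = seq_class p (\<lambda>n. 0),
     add = (\<lambda>P Q. \<Union>f\<in>P. \<Union>g\<in>Q. seq_class p (\<lambda>n. f n + g n)),
     smult = (\<lambda>c P. \<Union>f\<in>P. seq_class p (\<lambda>n. scale c (f n))),
     star = (\<lambda>P. \<Union>f\<in>P. seq_class p (\<lambda>n. adj (f n))),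
     cnorm = (\<lambda>P. lim (\<lambda>n. p ((SOME f. f \<in> P) n)))\<rparr>"

definition univ_cstar ::
  "'g free_star_algebra set \<Rightarrow> (nat \<Rightarrow> 'g free_star_algebra) set cstar" where
  "univ_cstar R = completion (univ_norm R)"

definition univ_gen ::
  "'g free_star_algebra set \<Rightarrow> 'g \<Rightarrow> (nat \<Rightarrow> 'g free_star_algebra) set" where
  "univ_gen R g = seq_class (univ_norm R) (\<lambda>n. gen g)"


section \<open>Quantum automorphisms of a finite graph\<close>

text \<open>A graph on the vertex set \<^typ>\<open>'v::finite\<close> is given by its adjacency relation.\<close>

definition simple_graph :: "('v::finite \<Rightarrow> 'v \<Rightarrow> bool) \<Rightarrow> bool" where
  "simple_graph E \<longleftrightarrow> symp E \<and> irreflp E"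

definition magic_unitary :: "('b, 'k) cstar_scheme \<Rightarrow> ('v::finite \<Rightarrow> 'v \<Rightarrow> 'b) \<Rightarrow> bool" where
  "magic_unitary B u \<longleftrightarrow>
     (\<forall>i j. u i j \<in> carrier B \<and> star B (u i j) = u i j \<and> u i j \<otimes>\<^bsub>B\<^esub> u i j = u i j) \<and>
     (\<forall>i j k. j \<noteq> k \<longrightarrow> u i j \<otimes>\<^bsub>B\<^esub> u i k = \<zero>\<^bsub>B\<^esub>) \<and>
     (\<forall>i j k. i \<noteq> j \<longrightarrow> u i k \<otimes>\<^bsub>B\<^esub> u j k = \<zero>\<^bsub>B\<^esub>) \<and>
     (\<forall>i. (\<Oplus>\<^bsub>B\<^esub>j\<in>UNIV. u i j) = \<one>\<^bsub>B\<^esub>) \<and>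
     (\<forall>j. (\<Oplus>\<^bsub>B\<^esub>i\<in>UNIV. u i j) = \<one>\<^bsub>B\<^esub>)"

definition commutes_with_adjacency ::
  "('v::finite \<Rightarrow> 'v \<Rightarrow> bool) \<Rightarrow> ('b, 'k) cstar_scheme \<Rightarrow> ('v \<Rightarrow> 'v \<Rightarrow> 'b) \<Rightarrow> bool" where
  "commutes_with_adjacency E B u \<longleftrightarrow> (\<forall>i j.
     (\<Oplus>\<^bsub>B\<^esub>k\<in>UNIV. of_bool (E i k) \<odot>\<^bsub>B\<^esub> u k j) = (\<Oplus>\<^bsub>B\<^esub>k\<in>UNIV. of_bool (E k j) \<odot>\<^bsub>B\<^esub> u i k))"

definition qaut_relators :: "('v::finite \<Rightarrow> 'v \<Rightarrow> bool) \<Rightarrow> ('v \<times> 'v) free_star_algebra set" where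
  "qaut_relators E =
     {gen (i, j) * gen (i, j) - gen (i, j) |i j. True} \<union>
     {gen (i, j) * gen (i, k) |i j k. j \<noteq> k} \<union>
     {gen (i, k) * gen (j, k) |i j k. i \<noteq> j} \<union>
     {(\<Sum>j\<in>UNIV. gen (i, j)) - 1 |i. True} \<union>
     {(\<Sum>i\<in>UNIV. gen (i, j)) - 1 |j. True} \<union>
     {(\<Sum>k\<in>UNIV. scale (of_bool (E i k)) (gen (k, j))) -
      (\<Sum>k\<in>UNIV. scale (of_bool (E k j)) (gen (i, k))) |i j. True}"

definition qaut_algebra ::
  "('v::finite \<Rightarrow> 'v \<Rightarrow> bool) \<Rightarrow> (nat \<Rightarrow> ('v \<times> 'v) free_star_algebra) set cstar" where
  "qaut_algebra E = univ_cstar (qaut_relators E)"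

definition qaut_gen ::
  "('v::finite \<Rightarrow> 'v \<Rightarrow> bool) \<Rightarrow> 'v \<Rightarrow> 'v \<Rightarrow> (nat \<Rightarrow> ('v \<times> 'v) free_star_algebra) set" where
  "qaut_gen E i j = univ_gen (qaut_relators E) (i, j)"

definition graph_aut :: "('v::finite \<Rightarrow> 'v \<Rightarrow> bool) \<Rightarrow> ('v \<Rightarrow> 'v) set" where
  "graph_aut E = {\<sigma>. bij \<sigma> \<and> (\<forall>i j. E (\<sigma> i) (\<sigma> j) \<longleftrightarrow> E i j)}"

definition aut_indicator :: "('v::finite \<Rightarrow> 'v \<Rightarrow> bool) \<Rightarrow> 'v \<Rightarrow> 'v \<Rightarrow> ('v \<Rightarrow> 'v) \<Rightarrow> complex" where
  "aut_indicator E i j = (\<lambda>\<sigma>\<in>graph_aut E. of_bool (\<sigma> j = i))"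

text \<open>Existence and uniqueness: lemma \<open>canonical_surjection_unique_existence\<close>.\<close>

definition canonical_surjection ::
  "('v::finite \<Rightarrow> 'v \<Rightarrow> bool) \<Rightarrow> (nat \<Rightarrow> ('v \<times> 'v) free_star_algebra) set \<Rightarrow> ('v \<Rightarrow> 'v) \<Rightarrow> complex" where
  "canonical_surjection E =
     (THE \<phi>. \<phi> \<in> cstar_hom (qaut_algebra E) (fun_cstar (graph_aut E)) \<and>
            \<phi> \<in> extensional (carrier (qaut_algebra E)) \<and>
            (\<forall>i j. \<phi> (qaut_gen E i j) = aut_indicator E i j))"

definition no_quantum_symmetry :: "('v::finite \<Rightarrow> 'v \<Rightarrow> bool) \<Rightarrow> bool" where
  "no_quantum_symmetry E \<longleftrightarrow>
     canonical_surjection E \<in> cstar_iso (qaut_algebra E) (fun_cstar (graph_aut E))"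


section \<open>The graph $C_{10}(2)$\<close>

text \<open>Vertices are the elements of the numeral type \<^typ>\<open>10\<close>, whose arithmetic is modulo 10.\<close>

definition graph_dist :: "('v \<Rightarrow> 'v \<Rightarrow> bool) \<Rightarrow> 'v \<Rightarrow> 'v \<Rightarrow> nat" where
  "graph_dist E i j = (LEAST n. (E ^^ n) i j)"

definition cycle10 :: "10 \<Rightarrow> 10 \<Rightarrow> bool" where
  "cycle10 i j \<longleftrightarrow> j = i + 1 \<or> i = j + 1"

definition C10_2 :: "10 \<Rightarrow> 10 \<Rightarrow> bool" where
  "C10_2 i j \<longleftrightarrow> cycle10 i j \<or> graph_dist cycle10 i j = 2"


section \<open>Verification: the completion is a C*-algebra\<close>

lemma single_decomp: "a = (\<Sum>w\<in>Poly_Mapping.keys a. Poly_Mapping.single w (Poly_Mapping.lookup a w))"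
proof (rule poly_mapping_eqI)
  fix k
  show "Poly_Mapping.lookup a k =
    Poly_Mapping.lookup (\<Sum>w\<in>Poly_Mapping.keys a. Poly_Mapping.single w (Poly_Mapping.lookup a w)) k"
    by (simp add: lookup_sum lookup_single when_def in_keys_iff)
qed

lemma fsa_induct [case_names single add]:
  assumes "\<And>w c. P (Poly_Mapping.single w c)" and "\<And>a b. P a \<Longrightarrow> P b \<Longrightarrow> P (a + b)"
  shows "P (a :: 'g free_star_algebra)"
proof -
  have "P (\<Sum>w\<in>S. Poly_Mapping.single w (Poly_Mapping.lookup a w))" if "finite S" for S
    using that
  proof induction
    case empty
    show ?case using assms(1)[of 0 0] by simp
  qed (simp add: assms)
  then show ?thesis using single_decomp[of a] by (metis finite_keys)
qed

lemma scale_simps: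
  "scale (c + d) a = scale c a + scale d a" "scale c (a + b) = scale c a + scale c b"
  "scale (c * d) a = scale c (scale d a)" "scale 1 a = a" "scale c a * b = scale c (a * b)"
  "scale 0 a = 0" "scale c 0 = 0" "scale (-1) a = - a"
  unfolding scale_def
  by (simp_all add: single_add distrib_right distrib_left mult_single mult.assoc[symmetric] single_uminus)

lemma scale_mult_right: "a * scale c b = scale c (a * b)"
proof -
  have "a * Poly_Mapping.single 0 c = Poly_Mapping.single 0 c * a"
    by (induction a rule: fsa_induct) (simp_all add: mult_single distrib_left distrib_right mult.commute)
  then show ?thesis unfolding scale_def by (metis mult.assoc)
qed

lemma scale_single: "scale c (Poly_Mapping.single w d) = Poly_Mapping.single w (c * d)"
  by (simp add: scale_def mult_single)

lemma scale_diff: "scale c (a - b) = scale c a - scale c b"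
  by (metis scale_simps(2) add_diff_cancel diff_add_cancel)

lemma rev_word_simps [simp]: "rev_word (rev_word w) = w" "rev_word (v + w) = rev_word w + rev_word v"
  "rev_word 0 = 0"
  by (simp_all add: rev_word_def plus_free_word_def zero_free_word_def)

lemma inj_rev_word: "inj rev_word" by (metis injI rev_word_simps(1))

lemma lookup_adj: "Poly_Mapping.lookup (adj a) w = cnj (Poly_Mapping.lookup a (rev_word w))"
  by (simp add: adj_def Poly_Mapping.map.rep_eq map_key.rep_eq inj_rev_word when_def)

lemma adj_add: "adj (a + b) = adj a + adj b"
  by (rule poly_mapping_eqI) (simp add: lookup_adj lookup_add)

lemma adj_adj: "adj (adj a) = a"
  by (rule poly_mapping_eqI) (simp add: lookup_adj)

lemma adj_single: "adj (Poly_Mapping.single w c) = Poly_Mapping.single (rev_word w) (cnj c)"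
  by (rule poly_mapping_eqI) (auto simp add: lookup_adj lookup_single when_def)

lemma adj_mult: "adj (a * b) = adj b * adj a"
proof (induction a rule: fsa_induct)
  case (single w c)
  show ?case
    by (induction b rule: fsa_induct) (simp_all add: mult_single adj_single distrib_left distrib_right adj_add mult.commute)
qed (simp add: distrib_left distrib_right adj_add)

lemma adj_scale: "adj (scale c a) = scale (cnj c) (adj a)"
  unfolding scale_def by (subst adj_mult) (metis adj_single rev_word_simps(3) scale_def scale_mult_right mult_1_right)

lemma adj_one [simp]: "adj 1 = 1"
  by (metis adj_single rev_word_simps(3) complex_cnj_one single_one)

lemma adj_zero [simp]: "adj 0 = 0"
  by (rule poly_mapping_eqI) (simp add: lookup_adj)

lemma adj_diff: "adj (a - b) = adj a - adj b"
  by (metis adj_add add_diff_cancel diff_add_cancel)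

lemma adj_gen [simp]: "adj (gen g) = gen g"
  by (simp add: gen_def adj_single rev_word_def)

locale cstar_semi =
  fixes p :: "'g free_star_algebra \<Rightarrow> real"
  assumes p: "cstar_seminorm p"
begin

lemma nn [simp]: "0 \<le> p a" and tri: "p (a + b) \<le> p a + p b"
  and sc: "p (scale c a) = cmod c * p a" and sub: "p (a * b) \<le> p a * p b"
  and cs: "p (adj a * a) = (p a)\<^sup>2"
  using p by (simp_all add: cstar_seminorm_def)

lemma z [simp]: "p 0 = 0" using sc[of 0 0] by (simp add: scale_simps)
lemma mi: "p (- a) = p a" using sc[of "-1" a] by (simp add: scale_simps)
lemma mi2: "p (a - b) = p (b - a)" using mi[of "a-b"] by simp
lemma tri2: "p (a - b) \<le> p a + p b" using tri[of a "-b"] mi by simp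
lemma tri3: "p (a - c) \<le> p (a - b) + p (b - c)" using tri[of "a-b" "b-c"] by simp
lemma dif: "\<bar>p a - p b\<bar> \<le> p (a - b)"
  using tri[of "a-b" b] tri[of "b-a" a] mi2[of a b] by simp

lemma adj_le: "p a \<le> p (adj a)"
proof (cases "p a = 0")
  case False
  then have "0 < p a" by (metis nn order_le_less)
  have "(p a)\<^sup>2 \<le> p (adj a) * p a" using cs sub by metis
  then show ?thesis using \<open>0 < p a\<close> by (simp add: power2_eq_square)
qed simp

lemma adj [simp]: "p (adj a) = p a"
  using adj_le[of a] adj_le[of "adj a"] by (simp add: adj_adj)

lemma sm: "p (sum f S) \<le> (\<Sum>x\<in>S. p (f x))"
proof (induction S rule: infinite_finite_induct)
  case (insert x F)
  then show ?case using tri[of "f x" "sum f F"] by simp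
qed simp_all

end

lemma univ_norm_seminorm:
  fixes R :: "'g free_star_algebra set"
  assumes bdd: "\<And>a. bdd_above ((\<lambda>p. p a) ` rel_seminorms R)"
  shows "univ_norm R \<in> rel_seminorms R"
    and "p \<in> rel_seminorms R \<Longrightarrow> p a \<le> univ_norm R a"
proof -
  let ?S = "rel_seminorms R" and ?N = "univ_norm R"
  have z: "(\<lambda>_. 0) \<in> ?S" by (simp add: rel_seminorms_def cstar_seminorm_def)
  have up: "p a \<le> ?N a" if "p \<in> ?S" for p a
    unfolding univ_norm_def using bdd that by (intro cSUP_upper) auto
  have le: "?N a \<le> m" if "\<And>p. p \<in> ?S \<Longrightarrow> p a \<le> m" for m a
    unfolding univ_norm_def using z that by (intro cSUP_least) auto
  show "p a \<le> ?N a" if "p \<in> ?S" for p a by (rule up[OF that])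
  have S: "cstar_semi p" if "p \<in> ?S" for p
    using that by (simp add: rel_seminorms_def cstar_semi_def)
  have nn: "0 \<le> ?N a" for a using up[OF z] .
  have tri: "?N (a + b) \<le> ?N a + ?N b" for a b
    by (intro le) (meson S up cstar_semi.tri add_mono order_trans)
  have sub: "?N (a * b) \<le> ?N a * ?N b" for a b
  proof (intro le)
    fix p assume P: "p \<in> ?S"
    interpret q: cstar_semi p by (rule S[OF P])
    have "p (a * b) \<le> p a * p b" by (rule q.sub)
    also have "\<dots> \<le> ?N a * ?N b" by (rule mult_mono[OF up[OF P] up[OF P] nn]) simp
    finally show "p (a * b) \<le> ?N a * ?N b" .
  qed
  have sc1: "?N (scale c a) \<le> cmod c * ?N a" for c a
  proof (intro le)
    fix p assume P: "p \<in> ?S"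
    interpret q: cstar_semi p by (rule S[OF P])
    show "p (scale c a) \<le> cmod c * ?N a"
      unfolding q.sc by (intro mult_left_mono up P) simp
  qed
  have sc: "?N (scale c a) = cmod c * ?N a" for c a
  proof (cases "c = 0")
    case True
    then have "?N (scale c a) \<le> 0" using sc1[of c a] by simp
    then show ?thesis using True nn[of "scale c a"] by simp
  next
    case False
    have "?N a \<le> cmod (1/c) * ?N (scale c a)"
      using sc1[of "1/c" "scale c a"] False by (simp add: scale_simps(3)[symmetric] scale_simps)
    then have "cmod c * ?N a \<le> ?N (scale c a)" using False by (simp add: norm_divide field_simps)
    then show ?thesis using sc1 by (simp add: antisym)
  qed
  have cs: "?N (adj a * a) = (?N a)\<^sup>2" for a
  proof (rule antisym)
    show "?N (adj a * a) \<le> (?N a)\<^sup>2"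
    proof (intro le)
      fix p assume P: "p \<in> ?S"
      interpret q: cstar_semi p by (rule S[OF P])
      show "p (adj a * a) \<le> (?N a)\<^sup>2" unfolding q.cs by (rule power_mono[OF up[OF P]]) simp
    qed
    have "?N a \<le> sqrt (?N (adj a * a))"
    proof (intro le)
      fix p assume P: "p \<in> ?S"
      interpret q: cstar_semi p by (rule S[OF P])
      have "(p a)\<^sup>2 \<le> ?N (adj a * a)" using up[OF P, of "adj a * a"] unfolding q.cs .
      then show "p a \<le> sqrt (?N (adj a * a))" by (simp add: real_le_rsqrt)
    qed
    then show "(?N a)\<^sup>2 \<le> ?N (adj a * a)"
      using nn by (metis real_sqrt_pow2 power_mono)
  qed
  have "?N r = 0" if "r \<in> R" for r
    using that nn[of r] le[of r 0] by (force simp: rel_seminorms_def)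
  then show "?N \<in> ?S"
    by (simp add: rel_seminorms_def cstar_seminorm_def nn tri sc sub cs)
qed

context cstar_semi
begin

lemma cauchyD: "cauchy_seq p f \<Longrightarrow> 0 < e \<Longrightarrow> \<exists>M. \<forall>m\<ge>M. \<forall>n\<ge>M. p (f m - f n) < e"
  by (simp add: cauchy_seq_def)

lemma cauchy_bounded:
  assumes "cauchy_seq p f" shows "\<exists>K>0. \<forall>n. p (f n) \<le> K"
proof -
  obtain M where M: "\<And>m n. m \<ge> M \<Longrightarrow> n \<ge> M \<Longrightarrow> p (f m - f n) < 1"
    using cauchyD[OF assms, of 1] by auto
  let ?K = "1 + p (f M) + (\<Sum>i\<le>M. p (f i))"
  have "p (f n) \<le> ?K" for n
  proof (cases "n \<le> M")
    case True
    then have "p (f n) \<le> (\<Sum>i\<le>M. p (f i))" by (intro member_le_sum) auto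
    then show ?thesis using nn[of "f M"] by linarith
  next
    case False
    then have "p (f n - f M) < 1" using M by simp
    moreover have "p (f n) \<le> p (f n - f M) + p (f M)" using tri[of "f n - f M" "f M"] by simp
    moreover have "0 \<le> (\<Sum>i\<le>M. p (f i))" by (intro sum_nonneg) simp
    ultimately show ?thesis by linarith
  qed
  moreover have "0 < ?K" by (intro add_pos_nonneg sum_nonneg) auto
  ultimately show ?thesis by blast
qed

lemma cauchy_const [simp]: "cauchy_seq p (\<lambda>n. a)"
  by (simp add: cauchy_seq_def)

lemma cauchy_add:
  assumes "cauchy_seq p f" "cauchy_seq p g" shows "cauchy_seq p (\<lambda>n. f n + g n)"
  unfolding cauchy_seq_def
proof (intro allI impI)
  fix e :: real assume "0 < e"
  then obtain M N where M: "\<And>m n. m \<ge> M \<Longrightarrow> n \<ge> M \<Longrightarrow> p (f m - f n) < e/2"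
    and N: "\<And>m n. m \<ge> N \<Longrightarrow> n \<ge> N \<Longrightarrow> p (g m - g n) < e/2"
    using cauchyD[OF assms(1), of "e/2"] cauchyD[OF assms(2), of "e/2"] by (meson half_gt_zero)
  have "p (f m + g m - (f n + g n)) < e" if "m \<ge> max M N" "n \<ge> max M N" for m n
    using M[of m n] N[of m n] tri[of "f m - f n" "g m - g n"] that by (simp add: algebra_simps)
  then show "\<exists>M. \<forall>m\<ge>M. \<forall>n\<ge>M. p (f m + g m - (f n + g n)) < e" by blast
qed

lemma cauchy_scale:
  assumes "cauchy_seq p f" shows "cauchy_seq p (\<lambda>n. scale c (f n))"
  unfolding cauchy_seq_def
proof (intro allI impI)
  fix e :: real assume "0 < e"
  have "e / (1 + cmod c) > 0" using \<open>0 < e\<close> by (intro divide_pos_pos add_pos_nonneg) auto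
  then obtain M where M: "\<And>m n. m \<ge> M \<Longrightarrow> n \<ge> M \<Longrightarrow> p (f m - f n) < e / (1 + cmod c)"
    using cauchyD[OF assms] by meson
  have "p (scale c (f m) - scale c (f n)) < e" if "m \<ge> M" "n \<ge> M" for m n
  proof -
    have "p (scale c (f m) - scale c (f n)) = cmod c * p (f m - f n)" by (simp add: sc scale_diff[symmetric])
    also have "\<dots> \<le> (1 + cmod c) * p (f m - f n)" by (intro mult_right_mono) auto
    also have "\<dots> < e" using M[OF that]
      by (metis norm_ge_zero add_pos_nonneg zero_less_one mult.commute pos_less_divide_eq)
    finally show ?thesis .
  qed
  then show "\<exists>M. \<forall>m\<ge>M. \<forall>n\<ge>M. p (scale c (f m) - scale c (f n)) < e" by blast
qed

lemma cauchy_adj: "cauchy_seq p f \<Longrightarrow> cauchy_seq p (\<lambda>n. adj (f n))"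
  unfolding cauchy_seq_def by (metis adj_diff adj)

lemma cauchy_uminus: "cauchy_seq p f \<Longrightarrow> cauchy_seq p (\<lambda>n. - f n)"
  using cauchy_scale[of f "-1"] by (simp add: scale_simps)

lemma cauchy_diff:
  "cauchy_seq p f \<Longrightarrow> cauchy_seq p g \<Longrightarrow> cauchy_seq p (\<lambda>n. f n - g n)"
  using cauchy_add[OF _ cauchy_uminus, of f g] by simp

lemma mult_diff_le: "p (a * b - a' * b') \<le> p a * p (b - b') + p (a - a') * p b'"
proof -
  have "a * b - a' * b' = a * (b - b') + (a - a') * b'" by (simp add: algebra_simps)
  then have "p (a * b - a' * b') \<le> p (a * (b - b')) + p ((a - a') * b')" by (metis tri)
  then show ?thesis using sub[of a "b-b'"] sub[of "a-a'" b'] by linarith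
qed

lemma cauchy_mult:
  assumes f: "cauchy_seq p f" and g: "cauchy_seq p g" shows "cauchy_seq p (\<lambda>n. f n * g n)"
  unfolding cauchy_seq_def
proof (intro allI impI)
  fix e :: real assume e: "0 < e"
  obtain K L where K: "K > 0" "\<And>n. p (f n) \<le> K" and L: "L > 0" "\<And>n. p (g n) \<le> L"
    using cauchy_bounded f g by meson
  obtain M where M: "\<And>m n. m \<ge> M \<Longrightarrow> n \<ge> M \<Longrightarrow> p (f m - f n) < e/(2*L)"
    using cauchyD[OF f, of "e/(2*L)"] e L by auto
  obtain N where N: "\<And>m n. m \<ge> N \<Longrightarrow> n \<ge> N \<Longrightarrow> p (g m - g n) < e/(2*K)"
    using cauchyD[OF g, of "e/(2*K)"] e K by auto
  have "p (f m * g m - f n * g n) < e" if "m \<ge> max M N" "n \<ge> max M N" for m n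
  proof -
    have 1: "p (f m - f n) * L < e/2" using M[of m n] that L by (simp add: field_simps)
    have 2: "K * p (g m - g n) < e/2" using N[of m n] that K by (simp add: field_simps)
    have "p (f m) * p (g m - g n) \<le> K * p (g m - g n)" by (intro mult_right_mono K) simp
    moreover have "p (f m - f n) * p (g n) \<le> p (f m - f n) * L" by (intro mult_left_mono L) simp
    ultimately show ?thesis using 1 2 mult_diff_le[of "f m" "g m" "f n" "g n"] by linarith
  qed
  then show "\<exists>M. \<forall>m\<ge>M. \<forall>n\<ge>M. p (f m * g m - f n * g n) < e" by blast
qed

lemma null_le:
  assumes "g \<longlonglongrightarrow> 0" "\<And>n. p (f n) \<le> g n" shows "(\<lambda>n. p (f n)) \<longlonglongrightarrow> 0"
  by (rule tendsto_sandwich[OF _ _ tendsto_const assms(1)]) (simp_all add: assms(2))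

lemma class_eq:
  assumes f: "cauchy_seq p f" and g: "cauchy_seq p g"
  shows "seq_class p f = seq_class p g \<longleftrightarrow> (\<lambda>n. p (f n - g n)) \<longlonglongrightarrow> 0"
proof
  assume "seq_class p f = seq_class p g"
  moreover have "f \<in> seq_class p f" using f by (simp add: seq_class_def)
  ultimately show "(\<lambda>n. p (f n - g n)) \<longlonglongrightarrow> 0" by (simp add: seq_class_def)
next
  assume 0: "(\<lambda>n. p (f n - g n)) \<longlonglongrightarrow> 0"
  then have 1: "(\<lambda>n. p (g n - f n)) \<longlonglongrightarrow> 0" by (simp add: mi2)
  have "(\<lambda>n. p (h n - g n)) \<longlonglongrightarrow> 0" if "(\<lambda>n. p (h n - f n)) \<longlonglongrightarrow> 0" for h
    by (rule null_le[OF tendsto_add_zero[OF that 0]]) (rule tri3)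
  moreover have "(\<lambda>n. p (h n - f n)) \<longlonglongrightarrow> 0" if "(\<lambda>n. p (h n - g n)) \<longlonglongrightarrow> 0" for h
    by (rule null_le[OF tendsto_add_zero[OF that 1]]) (rule tri3)
  ultimately show "seq_class p f = seq_class p g" by (auto simp: seq_class_def)
qed

lemma class_mem:
  assumes "cauchy_seq p f" shows "g \<in> seq_class p f \<longleftrightarrow> cauchy_seq p g \<and> seq_class p g = seq_class p f"
  using class_eq[OF _ assms] by (auto simp: seq_class_def)

lemma class_self: "cauchy_seq p f \<Longrightarrow> f \<in> seq_class p f"
  by (simp add: class_mem)

lemma carrier_iff: "P \<in> carrier (completion p) \<longleftrightarrow> (\<exists>f. cauchy_seq p f \<and> P = seq_class p f)"
  by (auto simp: completion_def)

lemma carrierE: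
  assumes "P \<in> carrier (completion p)" obtains f where "cauchy_seq p f" "P = seq_class p f"
  using assms carrier_iff by auto

lemma carrier_class [simp]: "cauchy_seq p f \<Longrightarrow> seq_class p f \<in> carrier (completion p)"
  by (auto simp: carrier_iff)

lemma add_class:
  assumes f: "cauchy_seq p f" and g: "cauchy_seq p g"
  shows "seq_class p f \<oplus>\<^bsub>completion p\<^esub> seq_class p g = seq_class p (\<lambda>n. f n + g n)"
proof -
  have "seq_class p (\<lambda>n. f' n + g' n) = seq_class p (\<lambda>n. f n + g n)"
    if "f' \<in> seq_class p f" "g' \<in> seq_class p g" for f' g'
  proof -
    have c: "cauchy_seq p f'" "cauchy_seq p g'" and 0: "(\<lambda>n. p (f' n - f n)) \<longlonglongrightarrow> 0" "(\<lambda>n. p (g' n - g n)) \<longlonglongrightarrow> 0"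
      using that by (auto simp: seq_class_def)
    have "p (f' n + g' n - (f n + g n)) \<le> p (f' n - f n) + p (g' n - g n)" for n
      using tri[of "f' n - f n" "g' n - g n"] by (simp add: algebra_simps)
    then show ?thesis
      by (subst class_eq) (intro cauchy_add c f g null_le[OF tendsto_add_zero[OF 0]])+
  qed
  then have "(\<Union>f\<in>seq_class p f. \<Union>g\<in>seq_class p g. seq_class p (\<lambda>n. f n + g n)) = seq_class p (\<lambda>n. f n + g n)"
    using class_self[OF f] class_self[OF g] by blast
  then show ?thesis by (simp add: completion_def)
qed

lemma mult_class:
  assumes f: "cauchy_seq p f" and g: "cauchy_seq p g"
  shows "seq_class p f \<otimes>\<^bsub>completion p\<^esub> seq_class p g = seq_class p (\<lambda>n. f n * g n)"
proof -
  have "seq_class p (\<lambda>n. f' n * g' n) = seq_class p (\<lambda>n. f n * g n)"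
    if "f' \<in> seq_class p f" "g' \<in> seq_class p g" for f' g'
  proof -
    have c: "cauchy_seq p f'" "cauchy_seq p g'" and 0: "(\<lambda>n. p (f' n - f n)) \<longlonglongrightarrow> 0" "(\<lambda>n. p (g' n - g n)) \<longlonglongrightarrow> 0"
      using that by (auto simp: seq_class_def)
    obtain K where K: "\<And>n. p (f' n) \<le> K" using cauchy_bounded c by meson
    obtain L where L: "\<And>n. p (g n) \<le> L" using cauchy_bounded g by meson
    have "p (f' n * g' n - f n * g n) \<le> K * p (g' n - g n) + p (f' n - f n) * L" for n
    proof -
      have "p (f' n) * p (g' n - g n) \<le> K * p (g' n - g n)" by (intro mult_right_mono K) simp
      moreover have "p (f' n - f n) * p (g n) \<le> p (f' n - f n) * L" by (intro mult_left_mono L) simp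
      ultimately show ?thesis using mult_diff_le[of "f' n" "g' n" "f n" "g n"] by linarith
    qed
    then show ?thesis
      by (subst class_eq)
        (intro cauchy_mult c f g null_le[OF tendsto_add_zero[OF tendsto_mult_right_zero[OF 0(2)] tendsto_mult_left_zero[OF 0(1)]]])+
  qed
  then have "(\<Union>f\<in>seq_class p f. \<Union>g\<in>seq_class p g. seq_class p (\<lambda>n. f n * g n)) = seq_class p (\<lambda>n. f n * g n)"
    using class_self[OF f] class_self[OF g] by blast
  then show ?thesis by (simp add: completion_def)
qed

lemma smult_class:
  assumes f: "cauchy_seq p f"
  shows "c \<odot>\<^bsub>completion p\<^esub> seq_class p f = seq_class p (\<lambda>n. scale c (f n))"
proof -
  have "seq_class p (\<lambda>n. scale c (f' n)) = seq_class p (\<lambda>n. scale c (f n))" if "f' \<in> seq_class p f" for f'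
  proof -
    have c: "cauchy_seq p f'" and 0: "(\<lambda>n. p (f' n - f n)) \<longlonglongrightarrow> 0"
      using that by (auto simp: seq_class_def)
    show ?thesis
      by (subst class_eq) (simp_all add: cauchy_scale c f scale_diff[symmetric] sc tendsto_mult_right_zero[OF 0])
  qed
  then have "(\<Union>f\<in>seq_class p f. seq_class p (\<lambda>n. scale c (f n))) = seq_class p (\<lambda>n. scale c (f n))"
    using class_self[OF f] by blast
  then show ?thesis by (simp add: completion_def)
qed

lemma star_class:
  assumes f: "cauchy_seq p f"
  shows "star (completion p) (seq_class p f) = seq_class p (\<lambda>n. adj (f n))"
proof -
  have "seq_class p (\<lambda>n. adj (f' n)) = seq_class p (\<lambda>n. adj (f n))" if "f' \<in> seq_class p f" for f'
  proof -
    have c: "cauchy_seq p f'" and 0: "(\<lambda>n. p (f' n - f n)) \<longlonglongrightarrow> 0"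
      using that by (auto simp: seq_class_def)
    show ?thesis
      by (subst class_eq) (simp_all add: cauchy_adj c f adj_diff[symmetric] 0)
  qed
  then have "(\<Union>f\<in>seq_class p f. seq_class p (\<lambda>n. adj (f n))) = seq_class p (\<lambda>n. adj (f n))"
    using class_self[OF f] by blast
  then show ?thesis by (simp add: completion_def)
qed

lemma zero_class: "\<zero>\<^bsub>completion p\<^esub> = seq_class p (\<lambda>n. 0)"
  and one_class: "\<one>\<^bsub>completion p\<^esub> = seq_class p (\<lambda>n. 1)"
  by (simp_all add: completion_def)

lemma norm_class:
  assumes f: "cauchy_seq p f"
  shows "(\<lambda>n. p (f n)) \<longlonglongrightarrow> cnorm (completion p) (seq_class p f)"
proof -
  have conv: "convergent (\<lambda>n. p (g n))" if "cauchy_seq p g" for g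
  proof -
    have "Cauchy (\<lambda>n. p (g n))"
      unfolding Cauchy_def dist_real_def using cauchyD[OF that] dif by (meson le_less_trans)
    then show ?thesis by (simp add: Cauchy_convergent_iff)
  qed
  let ?g = "SOME g. g \<in> seq_class p f"
  have "?g \<in> seq_class p f" by (rule someI[of _ f]) (rule class_self[OF f])
  then have g: "cauchy_seq p ?g" "(\<lambda>n. p (?g n - f n)) \<longlonglongrightarrow> 0" by (auto simp: seq_class_def)
  have "(\<lambda>n. p (?g n)) \<longlonglongrightarrow> cnorm (completion p) (seq_class p f)"
    using conv[OF g(1)] by (simp add: completion_def convergent_LIMSEQ_iff)
  moreover have "(\<lambda>n. p (f n) - p (?g n)) \<longlonglongrightarrow> 0"
    by (rule tendsto_rabs_zero_cancel, rule tendsto_sandwich[OF _ _ tendsto_const g(2)])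
      (simp_all add: abs_minus_commute[of "p (f _)"] dif)
  ultimately show ?thesis using tendsto_add by fastforce
qed

lemma norm_const [simp]: "cnorm (completion p) (seq_class p (\<lambda>n. a)) = p a"
  using norm_class[OF cauchy_const, of a] by (simp add: LIMSEQ_const_iff)

lemma ring_completion: "ring (completion p)"
proof (rule ringI)
  show "abelian_group (completion p)"
  proof (rule abelian_groupI)
    fix x assume "x \<in> carrier (completion p)"
    then obtain f where f: "cauchy_seq p f" "x = seq_class p f" by (rule carrierE)
    have "seq_class p (\<lambda>n. - f n) \<oplus>\<^bsub>completion p\<^esub> x = \<zero>\<^bsub>completion p\<^esub>"
      unfolding f(2) by (subst add_class) (simp_all add: f(1) cauchy_uminus zero_class)
    then show "\<exists>y\<in>carrier (completion p). y \<oplus>\<^bsub>completion p\<^esub> x = \<zero>\<^bsub>completion p\<^esub>"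
      by (rule bexI) (simp add: f(1) cauchy_uminus)
  qed (auto elim!: carrierE simp: add_class cauchy_add zero_class algebra_simps)
  show "monoid (completion p)"
    by (rule monoidI) (auto elim!: carrierE simp: mult_class cauchy_mult one_class algebra_simps)
qed (auto elim!: carrierE simp: mult_class add_class cauchy_mult cauchy_add algebra_simps)

lemma minus_class:
  assumes f: "cauchy_seq p f" and g: "cauchy_seq p g"
  shows "seq_class p f \<ominus>\<^bsub>completion p\<^esub> seq_class p g = seq_class p (\<lambda>n. f n - g n)"
proof -
  interpret C: ring "completion p" by (rule ring_completion)
  have "\<ominus>\<^bsub>completion p\<^esub> seq_class p g = seq_class p (\<lambda>n. - g n)"
    by (rule C.minus_equality) (simp_all add: add_class g cauchy_uminus zero_class)
  then show ?thesis by (simp add: a_minus_def add_class f g cauchy_uminus)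
qed

lemma norm_leI:
  assumes "cauchy_seq p f" "X \<longlonglongrightarrow> K" "\<And>n. p (f n) \<le> X n"
  shows "cnorm (completion p) (seq_class p f) \<le> K"
  using LIMSEQ_le[OF norm_class[OF assms(1)] assms(2)] assms(3) by auto

lemma norm_eqI:
  assumes "cauchy_seq p f" "(\<lambda>n. p (f n)) \<longlonglongrightarrow> K"
  shows "cnorm (completion p) (seq_class p f) = K"
  using LIMSEQ_unique[OF norm_class[OF assms(1)] assms(2)] .

lemma dense:
  assumes f: "cauchy_seq p f" and e: "0 < e"
  shows "\<exists>M. \<forall>m\<ge>M. cnorm (completion p) (seq_class p f \<ominus>\<^bsub>completion p\<^esub> seq_class p (\<lambda>n. f m)) < e"
proof -
  obtain M where M: "\<And>m n. m \<ge> M \<Longrightarrow> n \<ge> M \<Longrightarrow> p (f m - f n) < e/2"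
    using cauchyD[OF f, of "e/2"] e by auto
  have "cnorm (completion p) (seq_class p f \<ominus>\<^bsub>completion p\<^esub> seq_class p (\<lambda>n. f m)) \<le> e/2" if "m \<ge> M" for m
  proof -
    have "\<exists>N. \<forall>n\<ge>N. p (f n - f m) \<le> e/2" using M that less_imp_le by blast
    then show ?thesis
      unfolding minus_class[OF f cauchy_const]
      by (rule LIMSEQ_le_const2[OF norm_class[OF cauchy_diff[OF f cauchy_const]]])
  qed
  moreover have "e/2 < e" using e by simp
  ultimately show ?thesis by (meson order_le_less_trans)
qed

lemma cstar_completion: "cstar_algebra (completion p)"
proof -
  interpret C: ring "completion p" by (rule ring_completion)
  let ?n = "cnorm (completion p)"
  have tri': "?n (x \<oplus>\<^bsub>completion p\<^esub> y) \<le> ?n x + ?n y"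
    if xy: "x \<in> carrier (completion p)" "y \<in> carrier (completion p)" for x y
  proof -
    obtain f where f: "cauchy_seq p f" "x = seq_class p f" using xy(1) by (rule carrierE)
    obtain g where g: "cauchy_seq p g" "y = seq_class p g" using xy(2) by (rule carrierE)
    show ?thesis unfolding f(2) g(2) add_class[OF f(1) g(1)]
      by (rule norm_leI[OF cauchy_add[OF f(1) g(1)] tendsto_add[OF norm_class[OF f(1)] norm_class[OF g(1)]] tri])
  qed
  have nn': "0 \<le> ?n x" if x: "x \<in> carrier (completion p)" for x
  proof -
    obtain f where f: "cauchy_seq p f" and xf: "x = seq_class p f" using x by (rule carrierE)
    show ?thesis unfolding xf using norm_class[OF f] by (rule LIMSEQ_le_const) simp
  qed
  show ?thesis
  proof
    fix x y c d
    assume x: "x \<in> carrier (completion p)"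
    obtain f where f: "cauchy_seq p f" and xf: "x = seq_class p f" using x by (rule carrierE)
    show "c \<odot>\<^bsub>completion p\<^esub> x \<in> carrier (completion p)"
      by (simp add: xf f smult_class cauchy_scale)
    show "(c + d) \<odot>\<^bsub>completion p\<^esub> x = c \<odot>\<^bsub>completion p\<^esub> x \<oplus>\<^bsub>completion p\<^esub> d \<odot>\<^bsub>completion p\<^esub> x"
      by (simp add: xf f smult_class cauchy_scale add_class scale_simps)
    show "(c * d) \<odot>\<^bsub>completion p\<^esub> x = c \<odot>\<^bsub>completion p\<^esub> (d \<odot>\<^bsub>completion p\<^esub> x)"
      by (simp add: xf f smult_class cauchy_scale scale_simps)
    show "1 \<odot>\<^bsub>completion p\<^esub> x = x" by (simp add: xf f smult_class scale_simps)
    show "star (completion p) x \<in> carrier (completion p)" by (simp add: xf f star_class cauchy_adj)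
    show "star (completion p) (star (completion p) x) = x" by (simp add: xf f star_class cauchy_adj adj_adj)
    show "star (completion p) (c \<odot>\<^bsub>completion p\<^esub> x) = cnj c \<odot>\<^bsub>completion p\<^esub> star (completion p) x"
      by (simp add: xf f star_class smult_class cauchy_adj cauchy_scale adj_scale)
    show "0 \<le> ?n x" by (rule nn'[OF x])
    show "?n (c \<odot>\<^bsub>completion p\<^esub> x) = cmod c * ?n x"
      unfolding xf smult_class[OF f]
      by (rule norm_eqI) (simp_all add: f cauchy_scale sc tendsto_mult_left norm_class)
    have "?n (seq_class p (\<lambda>n. adj (f n) * f n)) = (?n x)\<^sup>2"
      unfolding xf by (rule norm_eqI) (simp_all add: f cauchy_mult cauchy_adj cs tendsto_power norm_class)
    then show "?n (star (completion p) x \<otimes>\<^bsub>completion p\<^esub> x) = (?n x)\<^sup>2"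
      by (simp add: xf f star_class mult_class cauchy_adj)
    show "x = \<zero>\<^bsub>completion p\<^esub>" if "?n x = 0"
    proof -
      have "(\<lambda>n. p (f n)) \<longlonglongrightarrow> 0" using norm_class[OF f] that by (simp add: xf)
      then show ?thesis unfolding xf zero_class by (subst class_eq) (simp_all add: f)
    qed
    assume y: "y \<in> carrier (completion p)"
    obtain g where g: "cauchy_seq p g" and yg: "y = seq_class p g" using y by (rule carrierE)
    show "c \<odot>\<^bsub>completion p\<^esub> (x \<oplus>\<^bsub>completion p\<^esub> y) = c \<odot>\<^bsub>completion p\<^esub> x \<oplus>\<^bsub>completion p\<^esub> c \<odot>\<^bsub>completion p\<^esub> y"
      by (simp add: xf f yg g smult_class cauchy_scale add_class cauchy_add scale_simps)
    show "(c \<odot>\<^bsub>completion p\<^esub> x) \<otimes>\<^bsub>completion p\<^esub> y = c \<odot>\<^bsub>completion p\<^esub> (x \<otimes>\<^bsub>completion p\<^esub> y)"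
      by (simp add: xf f yg g smult_class cauchy_scale mult_class cauchy_mult scale_simps)
    show "x \<otimes>\<^bsub>completion p\<^esub> (c \<odot>\<^bsub>completion p\<^esub> y) = c \<odot>\<^bsub>completion p\<^esub> (x \<otimes>\<^bsub>completion p\<^esub> y)"
      by (simp add: xf f yg g smult_class cauchy_scale mult_class cauchy_mult scale_mult_right)
    show "star (completion p) (x \<oplus>\<^bsub>completion p\<^esub> y) = star (completion p) x \<oplus>\<^bsub>completion p\<^esub> star (completion p) y"
      by (simp add: xf f yg g star_class cauchy_adj add_class cauchy_add adj_add)
    show "star (completion p) (x \<otimes>\<^bsub>completion p\<^esub> y) = star (completion p) y \<otimes>\<^bsub>completion p\<^esub> star (completion p) x"
      by (simp add: xf f yg g star_class cauchy_adj mult_class cauchy_mult adj_mult)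
    show "?n (x \<oplus>\<^bsub>completion p\<^esub> y) \<le> ?n x + ?n y" by (rule tri'[OF x y])
    show "?n (x \<otimes>\<^bsub>completion p\<^esub> y) \<le> ?n x * ?n y"
      unfolding xf yg mult_class[OF f g]
      by (rule norm_leI[OF cauchy_mult[OF f g] tendsto_mult[OF norm_class[OF f] norm_class[OF g]] sub])
  next
    fix F :: "nat \<Rightarrow> (nat \<Rightarrow> 'g free_star_algebra) set"
    assume F: "\<And>n. F n \<in> carrier (completion p)"
      and Fc: "\<forall>e>0. \<exists>M. \<forall>m\<ge>M. \<forall>n\<ge>M. ?n (F m \<ominus>\<^bsub>completion p\<^esub> F n) < e"
    let ?c = "\<lambda>a. seq_class p (\<lambda>n. a)"
    have tri3': "?n (x \<ominus>\<^bsub>completion p\<^esub> z) \<le> ?n (x \<ominus>\<^bsub>completion p\<^esub> y) + ?n (y \<ominus>\<^bsub>completion p\<^esub> z)"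
      if "x \<in> carrier (completion p)" "y \<in> carrier (completion p)" "z \<in> carrier (completion p)" for x y z
    proof -
      have "x \<ominus>\<^bsub>completion p\<^esub> z = (x \<ominus>\<^bsub>completion p\<^esub> y) \<oplus>\<^bsub>completion p\<^esub> (y \<ominus>\<^bsub>completion p\<^esub> z)"
        using that by (auto elim!: carrierE simp: minus_class cauchy_diff add_class)
      then show ?thesis using tri'[of "x \<ominus>\<^bsub>completion p\<^esub> y" "y \<ominus>\<^bsub>completion p\<^esub> z"] that by simp
    qed
    have mi': "?n (x \<ominus>\<^bsub>completion p\<^esub> y) = ?n (y \<ominus>\<^bsub>completion p\<^esub> x)"
      if xy: "x \<in> carrier (completion p)" "y \<in> carrier (completion p)" for x y
    proof -
      obtain f where f: "cauchy_seq p f" "x = seq_class p f" using xy(1) by (rule carrierE)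
      obtain g where g: "cauchy_seq p g" "y = seq_class p g" using xy(2) by (rule carrierE)
      have "(\<lambda>n. p (f n - g n)) \<longlonglongrightarrow> ?n (seq_class p (\<lambda>n. g n - f n))"
        using norm_class[OF cauchy_diff[OF g(1) f(1)]] by (simp add: mi2)
      then show ?thesis using f g by (simp add: minus_class cauchy_diff norm_eqI)
    qed
    have "\<exists>a. ?n (F k \<ominus>\<^bsub>completion p\<^esub> ?c a) < 1 / real (Suc k)" for k
    proof -
      obtain f where "cauchy_seq p f" "F k = seq_class p f" using F by (rule carrierE)
      then show ?thesis using dense[of f "1 / real (Suc k)"] by (auto simp del: of_nat_Suc)
    qed
    then obtain a where a: "\<And>k. ?n (F k \<ominus>\<^bsub>completion p\<^esub> ?c (a k)) < 1 / real (Suc k)" by metis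
    have small: "\<exists>M. \<forall>k\<ge>M. 1 / real (Suc k) < e" if "0 < e" for e :: real
      using order_tendstoD(2)[OF LIMSEQ_inverse_real_of_nat that]
      by (simp add: eventually_sequentially inverse_eq_divide)
    have ac: "cauchy_seq p a"
      unfolding cauchy_seq_def
    proof (intro allI impI)
      fix e :: real assume e: "0 < e"
      obtain M where M: "\<And>m n. m \<ge> M \<Longrightarrow> n \<ge> M \<Longrightarrow> ?n (F m \<ominus>\<^bsub>completion p\<^esub> F n) < e/3"
        using Fc e by (meson divide_pos_pos zero_less_numeral)
      obtain N where N: "\<And>k. k \<ge> N \<Longrightarrow> 1 / real (Suc k) < e/3"
        using small[of "e/3"] e by auto
      have "p (a m - a n) < e" if "m \<ge> max M N" "n \<ge> max M N" for m n
      proof -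
        have "p (a m - a n) = ?n (?c (a m) \<ominus>\<^bsub>completion p\<^esub> ?c (a n))" by (simp add: minus_class)
        also have "\<dots> \<le> ?n (?c (a m) \<ominus>\<^bsub>completion p\<^esub> F m) + (?n (F m \<ominus>\<^bsub>completion p\<^esub> F n) + ?n (F n \<ominus>\<^bsub>completion p\<^esub> ?c (a n)))"
          using tri3'[of "?c (a m)" "F m" "?c (a n)"] tri3'[of "F m" "F n" "?c (a n)"] F by simp
        also have "\<dots> < e"
          using a[of m] a[of n] mi'[of "?c (a m)" "F m"] N[of m] N[of n] M[of m n] that F by simp
        finally show ?thesis .
      qed
      then show "\<exists>M. \<forall>m\<ge>M. \<forall>n\<ge>M. p (a m - a n) < e" by blast
    qed
    have "(\<lambda>n. ?n (F n \<ominus>\<^bsub>completion p\<^esub> seq_class p a)) \<longlonglongrightarrow> 0"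
    proof (rule LIMSEQ_I)
      fix e :: real assume e: "0 < e"
      obtain M where M: "\<And>m. m \<ge> M \<Longrightarrow> ?n (seq_class p a \<ominus>\<^bsub>completion p\<^esub> ?c (a m)) < e/2"
        using dense[OF ac, of "e/2"] e by auto
      obtain N where N: "\<And>k. k \<ge> N \<Longrightarrow> 1 / real (Suc k) < e/2"
        using small[of "e/2"] e by auto
      have "\<bar>?n (F n \<ominus>\<^bsub>completion p\<^esub> seq_class p a)\<bar> < e" if "n \<ge> max M N" for n
      proof -
        have "0 \<le> ?n (F n \<ominus>\<^bsub>completion p\<^esub> seq_class p a)"
          by (rule nn') (rule C.minus_closed[OF F carrier_class[OF ac]])
        then show ?thesis
          using tri3'[of "F n" "?c (a n)" "seq_class p a"] F ac a[of n] M[of n] N[of n] that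
            mi'[of "?c (a n)" "seq_class p a"] by simp
      qed
      then show "\<exists>no. \<forall>n\<ge>no. norm (?n (F n \<ominus>\<^bsub>completion p\<^esub> seq_class p a) - 0) < e"
        by (metis diff_zero real_norm_def)
    qed
    then show "\<exists>x\<in>carrier (completion p). (\<lambda>n. ?n (F n \<ominus>\<^bsub>completion p\<^esub> x)) \<longlonglongrightarrow> 0"
      using ac by (meson carrier_class)
  qed
qed

end


section \<open>Verification: convergence in C*-algebras, and algebras of functions\<close>

context cstar_algebra
begin

lemma smult_zero_left: "x \<in> carrier A \<Longrightarrow> 0 \<odot> x = \<zero>"
  using smult_l_distr[of x 0 0] smult_closed[of x 0] by (metis add_0 add.r_cancel_one')

lemma smult_zero_right: "c \<odot> \<zero> = \<zero>"
  using smult_assoc[of \<zero> c 0] smult_zero_left[OF zero_closed] smult_zero_left[OF zero_closed] by simp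

lemma smult_minus: "x \<in> carrier A \<Longrightarrow> (-1) \<odot> x = \<ominus> x"
proof -
  assume x: "x \<in> carrier A"
  have "(-1) \<odot> x \<oplus> x = (-1 + 1) \<odot> x" using x by (simp only: smult_l_distr smult_one)
  then have "(-1) \<odot> x \<oplus> x = \<zero>" using x by (simp add: smult_zero_left)
  then show ?thesis using x by (simp add: minus_equality smult_closed)
qed

lemma norm_minus: "x \<in> carrier A \<Longrightarrow> cnorm A (\<ominus> x) = cnorm A x"
  by (simp add: smult_minus[symmetric] norm_smult)

lemma norm_zero: "cnorm A \<zero> = 0"
  using norm_smult[of \<zero> 0] by (simp add: smult_zero_left)

lemma star_zero: "star A \<zero> = \<zero>"
  using star_smult[of \<zero> 0] by (simp add: smult_zero_left star_closed)

lemma star_minus: "x \<in> carrier A \<Longrightarrow> star A (\<ominus> x) = \<ominus> star A x"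
  using star_smult[of x "-1"] by (simp add: smult_minus star_closed)

lemma star_one: "star A \<one> = \<one>"
  using star_mult[of "star A \<one>" \<one>] by (simp add: star_closed star_star)

lemma norm_minus_commute: "x \<in> carrier A \<Longrightarrow> y \<in> carrier A \<Longrightarrow> cnorm A (x \<ominus> y) = cnorm A (y \<ominus> x)"
proof -
  assume xy: "x \<in> carrier A" "y \<in> carrier A"
  have "y \<ominus> x = \<ominus> (x \<ominus> y)" using xy by (simp add: a_minus_def minus_add add.m_comm)
  then show ?thesis using xy by (simp add: norm_minus)
qed

lemma diff_add_cancel': "x \<in> carrier A \<Longrightarrow> y \<in> carrier A \<Longrightarrow> (x \<ominus> y) \<oplus> y = x"
  by (simp add: a_minus_def add.m_assoc l_neg)

lemma diff_eq_zero: "x \<in> carrier A \<Longrightarrow> y \<in> carrier A \<Longrightarrow> x \<ominus> y = \<zero> \<Longrightarrow> x = y"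
  by (metis diff_add_cancel' l_zero)

lemma norm_triangle3:
  assumes "x \<in> carrier A" "y \<in> carrier A" "z \<in> carrier A"
  shows "cnorm A (x \<ominus> z) \<le> cnorm A (x \<ominus> y) + cnorm A (y \<ominus> z)"
proof -
  have "x \<ominus> z = (x \<ominus> y) \<oplus> (y \<ominus> z)"
    using assms by (metis a_minus_def add.inv_closed add.m_assoc diff_add_cancel' minus_closed)
  then show ?thesis using assms norm_triangle[of "x \<ominus> y" "y \<ominus> z"] by simp
qed

definition conv :: "(nat \<Rightarrow> 'a) \<Rightarrow> 'a \<Rightarrow> bool" where
  "conv f y \<longleftrightarrow> (\<forall>n. f n \<in> carrier A) \<and> y \<in> carrier A \<and> (\<lambda>n. cnorm A (f n \<ominus> y)) \<longlonglongrightarrow> 0"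

lemma null_le:
  assumes "g \<longlonglongrightarrow> 0" "\<And>n. f n \<in> carrier A" "\<And>n. cnorm A (f n) \<le> g n"
  shows "(\<lambda>n. cnorm A (f n)) \<longlonglongrightarrow> 0"
  by (rule tendsto_sandwich[OF _ _ tendsto_const assms(1)]) (simp_all add: assms norm_nonneg)

lemma conv_const: "y \<in> carrier A \<Longrightarrow> conv (\<lambda>n. y) y"
  by (simp add: conv_def norm_zero r_neg a_minus_def)

lemma conv_unique: "conv f x \<Longrightarrow> conv f y \<Longrightarrow> x = y"
proof -
  assume x: "conv f x" and y: "conv f y"
  then have c: "x \<in> carrier A" "y \<in> carrier A" "\<And>n. f n \<in> carrier A" by (auto simp: conv_def)
  have "(\<lambda>n. cnorm A (x \<ominus> y)) \<longlonglongrightarrow> 0"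
  proof (rule null_le)
    show "(\<lambda>n. cnorm A (f n \<ominus> x) + cnorm A (f n \<ominus> y)) \<longlonglongrightarrow> 0"
      using x y by (intro tendsto_add_zero) (auto simp: conv_def)
    show "cnorm A (x \<ominus> y) \<le> cnorm A (f n \<ominus> x) + cnorm A (f n \<ominus> y)" for n
      using norm_triangle3[of x "f n" y] norm_minus_commute[of x "f n"] c by simp
  qed (use c in simp)
  then show ?thesis using c by (auto simp: LIMSEQ_const_iff intro!: diff_eq_zero norm_eq_zero)
qed

lemma conv_norm: "conv f y \<Longrightarrow> (\<lambda>n. cnorm A (f n)) \<longlonglongrightarrow> cnorm A y"
proof -
  assume f: "conv f y"
  then have c: "y \<in> carrier A" "\<And>n. f n \<in> carrier A" by (auto simp: conv_def)
  have "\<bar>cnorm A (f n) - cnorm A y\<bar> \<le> cnorm A (f n \<ominus> y)" for n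
    using norm_triangle[of "f n \<ominus> y" y] norm_triangle[of "y \<ominus> f n" "f n"] norm_minus_commute[of y "f n"] c
    by (simp add: diff_add_cancel')
  then have le: "\<forall>\<^sub>F n in sequentially. \<bar>cnorm A (f n) - cnorm A y\<bar> \<le> cnorm A (f n \<ominus> y)" by simp
  have lim: "(\<lambda>n. cnorm A (f n \<ominus> y)) \<longlonglongrightarrow> 0" using f by (simp add: conv_def)
  have "(\<lambda>n. \<bar>cnorm A (f n) - cnorm A y\<bar>) \<longlonglongrightarrow> 0"
    by (rule tendsto_sandwich[OF _ le tendsto_const lim]) simp
  then have "(\<lambda>n. cnorm A (f n) - cnorm A y) \<longlonglongrightarrow> 0" by (rule tendsto_rabs_zero_cancel)
  then show ?thesis by (simp add: LIM_zero_iff)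
qed

lemma conv_add: "conv f x \<Longrightarrow> conv g y \<Longrightarrow> conv (\<lambda>n. f n \<oplus> g n) (x \<oplus> y)"
proof -
  assume f: "conv f x" and g: "conv g y"
  then have c: "x \<in> carrier A" "y \<in> carrier A" "\<And>n. f n \<in> carrier A" "\<And>n. g n \<in> carrier A" by (auto simp: conv_def)
  have eq: "f n \<oplus> g n \<ominus> (x \<oplus> y) = (f n \<ominus> x) \<oplus> (g n \<ominus> y)" for n
    using c by (simp add: a_minus_def minus_add add.m_ac)
  have "(\<lambda>n. cnorm A (f n \<oplus> g n \<ominus> (x \<oplus> y))) \<longlonglongrightarrow> 0"
  proof (rule null_le)
    show "(\<lambda>n. cnorm A (f n \<ominus> x) + cnorm A (g n \<ominus> y)) \<longlonglongrightarrow> 0"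
      using f g by (intro tendsto_add_zero) (auto simp: conv_def)
  qed (use c in \<open>auto simp: eq norm_triangle\<close>)
  then show ?thesis using c by (simp add: conv_def)
qed

lemma conv_smult: "conv f x \<Longrightarrow> conv (\<lambda>n. c \<odot> f n) (c \<odot> x)"
proof -
  assume f: "conv f x"
  then have c: "x \<in> carrier A" "\<And>n. f n \<in> carrier A" by (auto simp: conv_def)
  have "c \<odot> f n \<ominus> c \<odot> x = c \<odot> (f n \<ominus> x)" for n
    using c by (simp add: a_minus_def smult_r_distr smult_minus[symmetric] smult_closed smult_assoc[symmetric] mult.commute)
  then show ?thesis using f c by (simp add: conv_def norm_smult tendsto_mult_right_zero smult_closed)
qed

lemma norm_star: "x \<in> carrier A \<Longrightarrow> cnorm A (star A x) = cnorm A x"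
proof -
  have le: "cnorm A x \<le> cnorm A (star A x)" if x: "x \<in> carrier A" for x
  proof (cases "cnorm A x = 0")
    case False
    then have "0 < cnorm A x" using norm_nonneg[OF x] by simp
    moreover have "(cnorm A x)\<^sup>2 \<le> cnorm A (star A x) * cnorm A x"
      using norm_cstar[OF x] norm_mult[of "star A x" x] x by (simp add: star_closed)
    ultimately show ?thesis by (simp add: power2_eq_square)
  qed (use norm_nonneg star_closed x in auto)
  assume x: "x \<in> carrier A"
  show ?thesis using le[OF x] le[OF star_closed[OF x]] by (simp add: star_star x)
qed

lemma conv_star: "conv f x \<Longrightarrow> conv (\<lambda>n. star A (f n)) (star A x)"
proof -
  assume f: "conv f x"
  then have c: "x \<in> carrier A" "\<And>n. f n \<in> carrier A" by (auto simp: conv_def)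
  have "star A (f n) \<ominus> star A x = star A (f n \<ominus> x)" for n
    using c by (simp add: a_minus_def star_add star_minus)
  then show ?thesis using f c by (simp add: conv_def norm_star star_closed)
qed

lemma conv_mult: "conv f x \<Longrightarrow> conv g y \<Longrightarrow> conv (\<lambda>n. f n \<otimes> g n) (x \<otimes> y)"
proof -
  assume f: "conv f x" and g: "conv g y"
  then have c: "x \<in> carrier A" "y \<in> carrier A" "\<And>n. f n \<in> carrier A" "\<And>n. g n \<in> carrier A" by (auto simp: conv_def)
  have eq: "f n \<otimes> g n \<ominus> x \<otimes> y = (f n \<ominus> x) \<otimes> g n \<oplus> x \<otimes> (g n \<ominus> y)" for n
  proof -
    have "(f n \<ominus> x) \<otimes> g n \<oplus> x \<otimes> (g n \<ominus> y) = f n \<otimes> g n \<oplus> (\<ominus> (x \<otimes> g n) \<oplus> x \<otimes> g n) \<oplus> \<ominus> (x \<otimes> y)"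
      using c by (simp add: a_minus_def l_distr r_distr l_minus r_minus add.m_assoc)
    then show ?thesis using c by (simp add: l_neg a_minus_def)
  qed
  have "(\<lambda>n. cnorm A (f n \<otimes> g n \<ominus> x \<otimes> y)) \<longlonglongrightarrow> 0"
  proof (rule null_le)
    have "(\<lambda>n. cnorm A (f n \<ominus> x) * cnorm A (g n) + cnorm A x * cnorm A (g n \<ominus> y)) \<longlonglongrightarrow> 0 * cnorm A y + cnorm A x * 0"
      using f g conv_norm[OF g] by (intro tendsto_intros) (auto simp: conv_def)
    then show "(\<lambda>n. cnorm A (f n \<ominus> x) * cnorm A (g n) + cnorm A x * cnorm A (g n \<ominus> y)) \<longlonglongrightarrow> 0" by simp
    show "cnorm A (f n \<otimes> g n \<ominus> x \<otimes> y) \<le> cnorm A (f n \<ominus> x) * cnorm A (g n) + cnorm A x * cnorm A (g n \<ominus> y)" for n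
      unfolding eq using c norm_triangle[of "(f n \<ominus> x) \<otimes> g n" "x \<otimes> (g n \<ominus> y)"]
        norm_mult[of "f n \<ominus> x" "g n"] norm_mult[of x "g n \<ominus> y"] by simp
  qed (use c in simp)
  then show ?thesis using c by (simp add: conv_def)
qed

end

context cstar_algebra
begin

text \<open>A Neumann series: \<open>1 - z\<close> is invertible for \<open>z\<close> of norm less than 1.\<close>

lemma neumann:
  assumes z: "z \<in> carrier A" "cnorm A z < 1"
  shows "\<exists>y\<in>carrier A. y = \<one> \<oplus> z \<otimes> y"
proof -
  define s where "s = rec_nat \<zero> (\<lambda>_ t. \<one> \<oplus> z \<otimes> t)"
  have s0: "s 0 = \<zero>" and sS: "\<And>n. s (Suc n) = \<one> \<oplus> z \<otimes> s n" by (simp_all add: s_def)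
  have sc: "s n \<in> carrier A" for n by (induction n) (simp_all add: s0 sS z)
  define K where "K = cnorm A \<one>"
  define q where "q = cnorm A z"
  have q: "0 \<le> q" "q < 1" using z by (simp_all add: q_def norm_nonneg)
  have K: "0 \<le> K" by (simp add: K_def norm_nonneg)
  have step: "cnorm A (s (Suc n) \<ominus> s n) \<le> K * q ^ n" for n
  proof (induction n)
    case 0
    show ?case using z by (simp add: s0 sS K_def a_minus_def)
  next
    case (Suc n)
    have "s (Suc (Suc n)) \<ominus> s (Suc n) = z \<otimes> (s (Suc n) \<ominus> s n)"
    proof -
      have "s (Suc (Suc n)) \<ominus> s (Suc n) = (\<one> \<oplus> z \<otimes> s (Suc n)) \<ominus> (\<one> \<oplus> z \<otimes> s n)"
        by (simp add: sS)
      also have "\<dots> = z \<otimes> s (Suc n) \<oplus> (\<one> \<oplus> \<ominus> \<one>) \<oplus> \<ominus> (z \<otimes> s n)"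
        using z sc by (simp add: a_minus_def minus_add add.m_ac)
      also have "\<dots> = z \<otimes> (s (Suc n) \<ominus> s n)"
        using z sc by (simp add: r_neg a_minus_def r_distr r_minus)
      finally show ?thesis .
    qed
    then have "cnorm A (s (Suc (Suc n)) \<ominus> s (Suc n)) \<le> q * cnorm A (s (Suc n) \<ominus> s n)"
      unfolding q_def using norm_mult[of z "s (Suc n) \<ominus> s n"] z sc by simp
    also have "\<dots> \<le> q * (K * q ^ n)" by (intro mult_left_mono Suc q)
    finally show ?case by (simp add: mult_ac)
  qed
  have dist: "cnorm A (s (n + k) \<ominus> s n) \<le> (\<Sum>i=n..<n+k. K * q ^ i)" for n k
  proof (induction k)
    case 0
    show ?case using sc[of n] by (simp add: a_minus_def r_neg norm_zero)
  next
    case (Suc k)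
    then show ?case using norm_triangle3[of "s (Suc (n+k))" "s (n+k)" "s n"] step[of "n+k"] sc by simp
  qed
  have summ: "summable (\<lambda>i. K * q ^ i)" using q by (intro summable_mult summable_geometric) simp
  have "\<forall>e>0. \<exists>M. \<forall>m\<ge>M. \<forall>n\<ge>M. cnorm A (s m \<ominus> s n) < e"
  proof (intro allI impI)
    fix e :: real assume "0 < e"
    then obtain M where M: "\<And>m n. m \<ge> M \<Longrightarrow> norm (\<Sum>i=m..<n. K * q ^ i) < e"
      using summ unfolding summable_Cauchy by meson
    have *: "cnorm A (s m \<ominus> s n) < e" if "n \<ge> M" "n \<le> m" for m n
      using dist[of n "m - n"] M[of n m] that by simp
    have "cnorm A (s m \<ominus> s n) < e" if "n \<ge> M" "m \<ge> M" for m n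
      using *[of n m] *[of m n] that norm_minus_commute[of "s m" "s n"] sc by (cases "n \<le> m") auto
    then show "\<exists>M. \<forall>m\<ge>M. \<forall>n\<ge>M. cnorm A (s m \<ominus> s n) < e" by blast
  qed
  then obtain y where y: "y \<in> carrier A" "(\<lambda>n. cnorm A (s n \<ominus> y)) \<longlonglongrightarrow> 0"
    using complete[of s] sc by blast
  have c: "conv s y" using y sc by (simp add: conv_def)
  have "conv (\<lambda>n. s (Suc n)) y" using c LIMSEQ_Suc[OF y(2)] by (simp add: conv_def)
  moreover have "conv (\<lambda>n. \<one> \<oplus> z \<otimes> s n) (\<one> \<oplus> z \<otimes> y)"
    by (intro conv_add conv_mult conv_const c z one_closed)
  ultimately have "y = \<one> \<oplus> z \<otimes> y" by (simp add: sS conv_unique)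
  then show ?thesis using y by blast
qed

end

lemma (in cstar_algebra) hom_fun_bound:
  assumes \<phi>: "\<phi> \<in> cstar_hom A (fun_cstar G)" and x: "x \<in> carrier A" and s: "s \<in> G"
  shows "cmod (\<phi> x s) \<le> cnorm A x"
proof (rule ccontr)
  assume "\<not> ?thesis"
  then have lt: "cnorm A x < cmod (\<phi> x s)" by simp
  define c where "c = \<phi> x s"
  have c: "c \<noteq> 0" using lt norm_nonneg[OF x] by (auto simp: c_def)
  define z where "z = (1 / c) \<odot> x"
  have z: "z \<in> carrier A" by (simp add: z_def x smult_closed)
  have "cnorm A z < 1" using lt c norm_nonneg[OF x] by (simp add: z_def norm_smult x norm_divide c_def)
  then obtain y where y: "y \<in> carrier A" "y = \<one> \<oplus> z \<otimes> y" using neumann z by blast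
  have h: "\<phi> \<one> = \<one>\<^bsub>fun_cstar G\<^esub>" "\<And>u v. u \<in> carrier A \<Longrightarrow> v \<in> carrier A \<Longrightarrow> \<phi> (u \<oplus> v) = \<phi> u \<oplus>\<^bsub>fun_cstar G\<^esub> \<phi> v"
    "\<And>u v. u \<in> carrier A \<Longrightarrow> v \<in> carrier A \<Longrightarrow> \<phi> (u \<otimes> v) = \<phi> u \<otimes>\<^bsub>fun_cstar G\<^esub> \<phi> v"
    "\<phi> z = (1/c) \<odot>\<^bsub>fun_cstar G\<^esub> \<phi> x"
    using \<phi> x by (simp_all add: cstar_hom_def ring_hom_def z_def)
  have "\<phi> y s = \<phi> (\<one> \<oplus> z \<otimes> y) s" by (rule arg_cong[OF y(2), of "\<lambda>t. \<phi> t s"])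
  also have "\<dots> = 1 + \<phi> z s * \<phi> y s" using s z y(1) by (simp add: h(1-3)) (simp add: fun_cstar_def)
  also have "\<phi> z s = 1" using s c by (simp add: h(4)) (simp add: fun_cstar_def c_def)
  finally show False by simp
qed

lemma cstar_fun:
  fixes G :: "'s set"
  assumes G: "finite G" "G \<noteq> {}" shows "cstar_algebra (fun_cstar G)"
proof -
  let ?B = "fun_cstar G"
  have bdd: "bdd_above ((\<lambda>s. cmod (f s)) ` G)" for f :: "_ \<Rightarrow> complex" using G by simp
  have up: "cmod (f s) \<le> (SUP s\<in>G. cmod (f s))" if "s \<in> G" for s and f :: "_ \<Rightarrow> complex"
    by (rule cSUP_upper[OF that bdd])
  have le: "(SUP s\<in>G. cmod (f s)) \<le> m" if "\<And>s. s \<in> G \<Longrightarrow> cmod (f s) \<le> m" for m and f :: "_ \<Rightarrow> complex"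
    by (rule cSUP_least[OF G(2) that])
  have sup_cong: "(SUP s\<in>G. cmod (f s)) = (SUP s\<in>G. cmod (g s))" if "\<And>s. s \<in> G \<Longrightarrow> f s = g s" for f g :: "_ \<Rightarrow> complex"
    by (rule SUP_cong) (auto simp: that)
  have nn: "0 \<le> (SUP s\<in>G. cmod (f s))" for f :: "_ \<Rightarrow> complex"
    using G(2) up[of _ f] norm_ge_zero order_trans by fast
  have at: "\<exists>s\<in>G. (SUP s\<in>G. cmod (f s)) = cmod (f s)" for f :: "_ \<Rightarrow> complex"
  proof -
    have "(SUP s\<in>G. cmod (f s)) = (MAX s\<in>G. cmod (f s))" using G by (simp add: cSup_eq_Max)
    moreover have "(MAX s\<in>G. cmod (f s)) \<in> (\<lambda>s. cmod (f s)) ` G" by (rule Max_in) (use G in auto)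
    ultimately show ?thesis by (metis imageE)
  qed
  have ring: "ring ?B"
  proof (rule ringI)
    show "abelian_group ?B"
    proof (rule abelian_groupI)
      fix x assume "x \<in> carrier ?B"
      then have "(\<lambda>s\<in>G. - x s) \<oplus>\<^bsub>?B\<^esub> x = \<zero>\<^bsub>?B\<^esub>" by (auto simp: fun_cstar_def restrict_def)
      then show "\<exists>y\<in>carrier ?B. y \<oplus>\<^bsub>?B\<^esub> x = \<zero>\<^bsub>?B\<^esub>"
        by (intro bexI[of _ "\<lambda>s\<in>G. - x s"]) (auto simp: fun_cstar_def)
    qed (auto simp: fun_cstar_def restrict_def extensional_def fun_eq_iff)
    show "monoid ?B"
      by (rule monoidI) (auto simp: fun_cstar_def restrict_def extensional_def fun_eq_iff)
  qed (auto simp: fun_cstar_def restrict_def extensional_def fun_eq_iff algebra_simps)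
  interpret B: ring ?B by (rule ring)
  have minus: "x \<ominus>\<^bsub>?B\<^esub> y = (\<lambda>s\<in>G. x s - y s)" if "x \<in> carrier ?B" "y \<in> carrier ?B" for x y
  proof -
    have "\<ominus>\<^bsub>?B\<^esub> y = (\<lambda>s\<in>G. - y s)"
      by (rule B.minus_equality) (use that in \<open>auto simp: fun_cstar_def restrict_def extensional_def\<close>)
    then show ?thesis by (auto simp: a_minus_def fun_cstar_def restrict_def)
  qed
  have n: "cnorm ?B f = (SUP s\<in>G. cmod (f s))" for f by (simp add: fun_cstar_def)
  show ?thesis
  proof
    fix x y c
    show "cnorm ?B (c \<odot>\<^bsub>?B\<^esub> x) = cmod c * cnorm ?B x"
    proof -
      have eq: "cnorm ?B (c \<odot>\<^bsub>?B\<^esub> x) = (SUP s\<in>G. cmod (c * x s))"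
        unfolding n by (rule sup_cong) (simp add: fun_cstar_def)
      obtain s where s: "s \<in> G" "cnorm ?B x = cmod (x s)" using at[of x] by (auto simp: n)
      have "cmod c * cnorm ?B x \<le> (SUP s\<in>G. cmod (c * x s))"
        using up[OF s(1), of "\<lambda>s. c * x s"] by (simp add: s(2) norm_mult)
      moreover have "(SUP s\<in>G. cmod (c * x s)) \<le> cmod c * cnorm ?B x"
        by (rule le) (simp add: n norm_mult mult_left_mono up)
      ultimately show ?thesis using eq by simp
    qed
    show "cnorm ?B (x \<oplus>\<^bsub>?B\<^esub> y) \<le> cnorm ?B x + cnorm ?B y"
    proof -
      have eq: "cnorm ?B (x \<oplus>\<^bsub>?B\<^esub> y) = (SUP s\<in>G. cmod (x s + y s))"
        unfolding n by (rule sup_cong) (simp add: fun_cstar_def)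
      show ?thesis unfolding eq
        unfolding n by (rule le) (intro order_trans[OF norm_triangle_ineq] add_mono up)
    qed
    show "cnorm ?B (x \<otimes>\<^bsub>?B\<^esub> y) \<le> cnorm ?B x * cnorm ?B y"
    proof -
      have eq: "cnorm ?B (x \<otimes>\<^bsub>?B\<^esub> y) = (SUP s\<in>G. cmod (x s * y s))"
        unfolding n by (rule sup_cong) (simp add: fun_cstar_def)
      show ?thesis unfolding eq
        by (rule le) (simp add: n norm_mult mult_mono up nn)
    qed
    show "cnorm ?B (star ?B x \<otimes>\<^bsub>?B\<^esub> x) = (cnorm ?B x)\<^sup>2"
    proof -
      have eq: "cnorm ?B (star ?B x \<otimes>\<^bsub>?B\<^esub> x) = (SUP s\<in>G. cmod (cnj (x s) * x s))"
        unfolding n by (rule sup_cong) (simp add: fun_cstar_def)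
      obtain s where s: "s \<in> G" "cnorm ?B x = cmod (x s)" using at[of x] by (auto simp: n)
      have "(cnorm ?B x)\<^sup>2 \<le> (SUP s\<in>G. cmod (cnj (x s) * x s))"
        using up[OF s(1), of "\<lambda>s. cnj (x s) * x s"] by (simp add: s(2) norm_mult power2_eq_square)
      moreover have "(SUP s\<in>G. cmod (cnj (x s) * x s)) \<le> (cnorm ?B x)\<^sup>2"
        by (rule le) (simp add: n norm_mult power2_eq_square mult_mono up nn)
      ultimately show ?thesis using eq by simp
    qed
    show "0 \<le> cnorm ?B x" by (simp add: n nn)
    assume x: "x \<in> carrier ?B"
    show "x = \<zero>\<^bsub>?B\<^esub>" if "cnorm ?B x = 0"
    proof -
      have "x s = 0" if "s \<in> G" for s using up[OF that, of x] \<open>cnorm ?B x = 0\<close> by (simp add: n)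
      then show ?thesis using x by (auto simp: fun_cstar_def restrict_def extensional_def fun_eq_iff)
    qed
  next
    fix f :: "nat \<Rightarrow> 's \<Rightarrow> complex" assume f: "\<And>n. f n \<in> carrier ?B"
      and c: "\<forall>e>0. \<exists>M. \<forall>m\<ge>M. \<forall>n\<ge>M. cnorm ?B (f m \<ominus>\<^bsub>?B\<^esub> f n) < e"
    have d: "cnorm ?B (g \<ominus>\<^bsub>?B\<^esub> h) = (SUP s\<in>G. cmod (g s - h s))" if "g \<in> carrier ?B" "h \<in> carrier ?B" for g h
      unfolding n by (rule sup_cong) (simp add: minus that)
    have "\<exists>l. (\<lambda>n. f n s) \<longlonglongrightarrow> l" if s: "s \<in> G" for s
    proof -
      have "Cauchy (\<lambda>n. f n s)"
      proof (rule metric_CauchyI)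
        fix e :: real assume "0 < e"
        then obtain M where M: "\<forall>m\<ge>M. \<forall>n\<ge>M. cnorm ?B (f m \<ominus>\<^bsub>?B\<^esub> f n) < e" using c by blast
        have "dist (f m s) (f n s) < e" if "m \<ge> M" "n \<ge> M" for m n
          using up[OF s, of "\<lambda>s. f m s - f n s"] M that by (fastforce simp: d f dist_norm)
        then show "\<exists>M. \<forall>m\<ge>M. \<forall>n\<ge>M. dist (f m s) (f n s) < e" by blast
      qed
      then show ?thesis by (auto simp: Cauchy_convergent_iff convergent_def)
    qed
    then obtain l where l: "\<And>s. s \<in> G \<Longrightarrow> (\<lambda>n. f n s) \<longlonglongrightarrow> l s" by metis
    define y where "y = restrict l G"
    have y: "y \<in> carrier ?B" by (simp add: y_def fun_cstar_def)
    have "(\<lambda>n. \<Sum>s\<in>G. cmod (f n s - y s)) \<longlonglongrightarrow> (\<Sum>s\<in>G. 0)"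
      using l by (intro tendsto_sum tendsto_norm_zero) (simp add: y_def LIM_zero)
    then have lim: "(\<lambda>n. \<Sum>s\<in>G. cmod (f n s - y s)) \<longlonglongrightarrow> 0" by simp
    have "cnorm ?B (f n \<ominus>\<^bsub>?B\<^esub> y) \<le> (\<Sum>s\<in>G. cmod (f n s - y s))" for n
      unfolding d[OF f y]
    proof (rule le)
      fix s assume "s \<in> G"
      then show "cmod (f n s - y s) \<le> (\<Sum>s\<in>G. cmod (f n s - y s))"
        by (rule member_le_sum[where f = "\<lambda>s. cmod (f n s - y s)"]) (simp_all add: G)
    qed
    then have up': "\<forall>\<^sub>F n in sequentially. cnorm ?B (f n \<ominus>\<^bsub>?B\<^esub> y) \<le> (\<Sum>s\<in>G. cmod (f n s - y s))" by simp
    have "(\<lambda>n. cnorm ?B (f n \<ominus>\<^bsub>?B\<^esub> y)) \<longlonglongrightarrow> 0"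
      by (rule tendsto_sandwich[OF _ up' tendsto_const lim]) (simp add: d f y nn)
    then show "\<exists>x\<in>carrier ?B. (\<lambda>n. cnorm ?B (f n \<ominus>\<^bsub>?B\<^esub> x)) \<longlonglongrightarrow> 0" using y by blast
  qed (auto simp: fun_cstar_def restrict_def extensional_def fun_eq_iff algebra_simps)
qed


section \<open>Verification: universal property\<close>

context cstar_algebra
begin

definition word_eval :: "('g \<Rightarrow> 'a) \<Rightarrow> 'g free_word \<Rightarrow> 'a" where
  "word_eval v w = foldr (\<lambda>g y. v g \<otimes> y) (letters w) \<one>"

definition poly_eval :: "('g \<Rightarrow> 'a) \<Rightarrow> 'g free_star_algebra \<Rightarrow> 'a" where
  "poly_eval v a = (\<Oplus>w\<in>Poly_Mapping.keys a. Poly_Mapping.lookup a w \<odot> word_eval v w)"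

context
  fixes v :: "'g \<Rightarrow> 'a"
  assumes v: "\<And>g. v g \<in> carrier A"
begin

lemma word_eval_closed: "word_eval v w \<in> carrier A"
proof -
  have "foldr (\<lambda>g y. v g \<otimes> y) gs \<one> \<in> carrier A" for gs by (induction gs) (simp_all add: v)
  then show ?thesis by (simp add: word_eval_def)
qed

lemma word_eval_add: "word_eval v (x + y) = word_eval v x \<otimes> word_eval v y"
proof -
  have c: "foldr (\<lambda>g y. v g \<otimes> y) gs \<one> \<in> carrier A" for gs by (induction gs) (simp_all add: v)
  have "foldr (\<lambda>g y. v g \<otimes> y) (gs @ hs) \<one> = foldr (\<lambda>g y. v g \<otimes> y) gs \<one> \<otimes> foldr (\<lambda>g y. v g \<otimes> y) hs \<one>" for gs hs
    by (induction gs) (simp_all add: v c m_assoc del: foldr_append)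
  then show ?thesis by (simp add: word_eval_def plus_free_word_def del: foldr_append)
qed

lemma poly_eval_closed: "poly_eval v a \<in> carrier A"
  unfolding poly_eval_def by (intro finsum_closed) (simp add: word_eval_closed smult_closed)

lemma poly_eval_superset:
  assumes "finite S" "Poly_Mapping.keys a \<subseteq> S"
  shows "poly_eval v a = (\<Oplus>w\<in>S. Poly_Mapping.lookup a w \<odot> word_eval v w)"
  unfolding poly_eval_def
  by (rule add.finprod_mono_neutral_cong_left)
    (use assms in \<open>auto simp: in_keys_iff smult_zero_left word_eval_closed smult_closed\<close>)

lemma poly_eval_add: "poly_eval v (a + b) = poly_eval v a \<oplus> poly_eval v b"
proof -
  let ?S = "Poly_Mapping.keys a \<union> Poly_Mapping.keys b"
  have "poly_eval v (a + b) = (\<Oplus>w\<in>?S. Poly_Mapping.lookup (a + b) w \<odot> word_eval v w)"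
    by (rule poly_eval_superset) (simp_all add: Poly_Mapping.keys_add)
  also have "\<dots> = (\<Oplus>w\<in>?S. Poly_Mapping.lookup a w \<odot> word_eval v w \<oplus> Poly_Mapping.lookup b w \<odot> word_eval v w)"
    by (rule finsum_cong') (auto simp: lookup_add smult_l_distr word_eval_closed smult_closed)
  also have "\<dots> = (\<Oplus>w\<in>?S. Poly_Mapping.lookup a w \<odot> word_eval v w) \<oplus> (\<Oplus>w\<in>?S. Poly_Mapping.lookup b w \<odot> word_eval v w)"
    by (rule finsum_addf) (auto simp: word_eval_closed smult_closed)
  also have "\<dots> = poly_eval v a \<oplus> poly_eval v b"
    by (subst (1 2) poly_eval_superset[of ?S, symmetric]) auto
  finally show ?thesis .
qed

lemma poly_eval_single: "poly_eval v (Poly_Mapping.single w c) = c \<odot> word_eval v w"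
  by (subst poly_eval_superset[of "{w}"])
    (simp_all add: finsum_singleton word_eval_closed smult_closed)

lemma poly_eval_zero: "poly_eval v 0 = \<zero>"
  by (simp add: poly_eval_def)

lemma poly_eval_one: "poly_eval v 1 = \<one>"
proof -
  have "poly_eval v (Poly_Mapping.single 0 1) = \<one>"
    by (subst poly_eval_single) (simp add: word_eval_def zero_free_word_def smult_one)
  then show ?thesis by simp
qed

lemma poly_eval_mult: "poly_eval v (a * b) = poly_eval v a \<otimes> poly_eval v b"
proof (induction a rule: fsa_induct)
  case (single w c)
  show ?case
  proof (induction b rule: fsa_induct)
    case (single x d)
    show ?case
      by (simp add: mult_single poly_eval_single word_eval_add word_eval_closed smult_closed
          smult_mult_left smult_mult_right smult_assoc[symmetric] mult.commute)
  next
    case (add a b)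
    then show ?case by (simp add: distrib_left poly_eval_add r_distr poly_eval_closed)
  qed
next
  case (add a b)
  then show ?case by (simp add: distrib_right poly_eval_add l_distr poly_eval_closed)
qed

lemma poly_eval_scale: "poly_eval v (scale c a) = c \<odot> poly_eval v a"
proof -
  have "poly_eval v (Poly_Mapping.single 0 c) = c \<odot> \<one>"
    by (subst poly_eval_single) (simp add: word_eval_def zero_free_word_def)
  then show ?thesis by (simp add: scale_def poly_eval_mult smult_mult_left poly_eval_closed)
qed

lemma poly_eval_diff: "poly_eval v (a - b) = poly_eval v a \<ominus> poly_eval v b"
proof -
  have "poly_eval v (a + scale (-1) b) = poly_eval v a \<ominus> poly_eval v b"
    by (simp only: poly_eval_add poly_eval_scale smult_minus poly_eval_closed a_minus_def)
  then show ?thesis by (simp add: scale_simps)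
qed

lemma poly_eval_gen: "poly_eval v (gen g) = v g"
  by (simp add: gen_def poly_eval_single word_eval_def v smult_one)

lemma poly_eval_sum: "poly_eval v (sum f S) = (\<Oplus>x\<in>S. poly_eval v (f x))"
  by (induction S rule: infinite_finite_induct)
    (simp_all add: poly_eval_zero poly_eval_add poly_eval_closed)

lemma poly_eval_adj:
  assumes vs: "\<And>g. star A (v g) = v g"
  shows "poly_eval v (adj a) = star A (poly_eval v a)"
proof (induction a rule: fsa_induct)
  case (single w c)
  have "word_eval v (Word (rev gs)) = star A (word_eval v (Word gs))" for gs
  proof (induction gs)
    case Nil
    show ?case by (simp add: word_eval_def star_one)
  next
    case (Cons g gs)
    have "word_eval v (Word (rev (g # gs))) = word_eval v (Word (rev gs)) \<otimes> word_eval v (Word [g])"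
      using word_eval_add[of "Word (rev gs)" "Word [g]"] by (simp add: plus_free_word_def)
    moreover have "word_eval v (Word (g # gs)) = word_eval v (Word [g]) \<otimes> word_eval v (Word gs)"
      using word_eval_add[of "Word [g]" "Word gs"] by (simp add: plus_free_word_def)
    moreover have "star A (word_eval v (Word [g])) = word_eval v (Word [g])"
      by (simp add: word_eval_def v vs)
    ultimately show ?case using Cons by (simp add: star_mult word_eval_closed)
  qed
  from this[of "letters w"] have "word_eval v (rev_word w) = star A (word_eval v w)" by (simp add: rev_word_def)
  then show ?case by (simp add: adj_single poly_eval_single star_smult word_eval_closed)
next
  case (add a b)
  then show ?case by (simp add: adj_add poly_eval_add star_add poly_eval_closed)
qed

lemma poly_eval_seminorm:
  assumes vs: "\<And>g. star A (v g) = v g"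
  shows "cstar_seminorm (\<lambda>a. cnorm A (poly_eval v a))"
  by (simp add: cstar_seminorm_def norm_nonneg poly_eval_closed poly_eval_add poly_eval_mult
      poly_eval_scale poly_eval_adj[OF vs] norm_triangle norm_mult norm_smult norm_cstar)

end

end

definition bounded_relators :: "'g free_star_algebra set \<Rightarrow> bool" where
  "bounded_relators R \<longleftrightarrow> (\<forall>a. bdd_above ((\<lambda>p. p a) ` rel_seminorms R))"

lemma univ_norm_cstar_semi: "bounded_relators R \<Longrightarrow> cstar_semi (univ_norm R)"
  using univ_norm_seminorm(1)[of R] by (simp add: bounded_relators_def rel_seminorms_def cstar_semi_def)

lemma cstar_univ: "bounded_relators R \<Longrightarrow> cstar_algebra (univ_cstar R)"
  unfolding univ_cstar_def by (rule cstar_semi.cstar_completion[OF univ_norm_cstar_semi])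

theorem univ_cstar_universal:
  assumes R: "bounded_relators R" and B: "cstar_algebra B"
    and v: "\<And>g. v g \<in> carrier B" "\<And>g. star B (v g) = v g"
    and rel: "\<And>r. r \<in> R \<Longrightarrow> cstar_algebra.poly_eval B v r = \<zero>\<^bsub>B\<^esub>"
  shows "\<exists>\<phi>\<in>cstar_hom (univ_cstar R) B. \<forall>g. \<phi> (univ_gen R g) = v g"
proof -
  interpret B: cstar_algebra B by (rule B)
  let ?N = "univ_norm R" and ?A = "univ_cstar R"
  let ?e = "B.poly_eval v"
  interpret N: cstar_semi ?N by (rule univ_norm_cstar_semi[OF R])
  note [simp] = B.poly_eval_closed[OF v(1)]
  have "(\<lambda>a. cnorm B (?e a)) \<in> rel_seminorms R"
    using B.poly_eval_seminorm[OF v] rel by (simp add: rel_seminorms_def B.norm_zero)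
  then have le: "cnorm B (?e a) \<le> ?N a" for a
    using univ_norm_seminorm(2)[of R] R by (simp add: bounded_relators_def)
  have led: "cnorm B (?e a \<ominus>\<^bsub>B\<^esub> ?e b) \<le> ?N (a - b)" for a b
    using le[of "a - b"] by (simp add: B.poly_eval_diff[OF v(1)])
  have lim: "\<exists>y. B.conv (\<lambda>n. ?e (f n)) y" if f: "cauchy_seq ?N f" for f
  proof -
    have "\<forall>e>0. \<exists>M. \<forall>m\<ge>M. \<forall>n\<ge>M. cnorm B (?e (f m) \<ominus>\<^bsub>B\<^esub> ?e (f n)) < e"
      using N.cauchyD[OF f] led by (meson le_less_trans)
    then obtain y where "y \<in> carrier B" "(\<lambda>n. cnorm B (?e (f n) \<ominus>\<^bsub>B\<^esub> y)) \<longlonglongrightarrow> 0"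
      using B.complete[of "\<lambda>n. ?e (f n)"] by auto
    then show ?thesis by (auto simp: B.conv_def)
  qed
  have same: "B.conv (\<lambda>n. ?e (g n)) y" if "B.conv (\<lambda>n. ?e (f n)) y" "g \<in> seq_class ?N f" for f g y
  proof -
    have y: "y \<in> carrier B" "(\<lambda>n. cnorm B (?e (f n) \<ominus>\<^bsub>B\<^esub> y)) \<longlonglongrightarrow> 0" using that(1) by (auto simp: B.conv_def)
    have g: "(\<lambda>n. ?N (g n - f n)) \<longlonglongrightarrow> 0" using that(2) by (simp add: seq_class_def)
    have "(\<lambda>n. cnorm B (?e (g n) \<ominus>\<^bsub>B\<^esub> y)) \<longlonglongrightarrow> 0"
    proof (rule B.null_le[OF tendsto_add_zero[OF g y(2)]])
      show "cnorm B (?e (g n) \<ominus>\<^bsub>B\<^esub> y) \<le> ?N (g n - f n) + cnorm B (?e (f n) \<ominus>\<^bsub>B\<^esub> y)" for n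
        using B.norm_triangle3[of "?e (g n)" "?e (f n)" y] led[of "g n" "f n"] y by simp
    qed (simp add: y)
    then show ?thesis using y by (simp add: B.conv_def)
  qed
  define \<phi> where "\<phi> P = (SOME y. \<exists>f\<in>P. B.conv (\<lambda>n. ?e (f n)) y)" for P
  have \<phi>: "B.conv (\<lambda>n. ?e (f n)) (\<phi> (seq_class ?N f))" if f: "cauchy_seq ?N f" for f
  proof -
    obtain y where y: "B.conv (\<lambda>n. ?e (f n)) y" using lim[OF f] by blast
    have ex: "\<exists>z. \<exists>g\<in>seq_class ?N f. B.conv (\<lambda>n. ?e (g n)) z" using y N.class_self[OF f] by blast
    obtain g where g: "g \<in> seq_class ?N f" "B.conv (\<lambda>n. ?e (g n)) (\<phi> (seq_class ?N f))"
      unfolding \<phi>_def using someI_ex[OF ex] by blast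
    have "B.conv (\<lambda>n. ?e (g n)) y" by (rule same[OF y g(1)])
    then have "\<phi> (seq_class ?N f) = y" by (rule B.conv_unique[OF g(2)])
    then show ?thesis using y by simp
  qed
  have \<phi>_eq: "\<phi> (seq_class ?N f) = y" if "cauchy_seq ?N f" "B.conv (\<lambda>n. ?e (f n)) y" for f y
    by (rule B.conv_unique[OF \<phi>[OF that(1)] that(2)])
  have closed: "\<phi> (seq_class ?N f) \<in> carrier B" if "cauchy_seq ?N f" for f
    using \<phi>[OF that] by (simp add: B.conv_def)
  have "\<phi> \<in> cstar_hom ?A B"
    unfolding cstar_hom_def mem_Collect_eq
  proof (intro conjI allI ballI)
    show "\<phi> \<in> ring_hom ?A B"
    proof (rule ring_hom_memI)
      fix x assume "x \<in> carrier ?A"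
      then obtain f where f: "cauchy_seq ?N f" "x = seq_class ?N f"
        unfolding univ_cstar_def by (rule N.carrierE)
      show "\<phi> x \<in> carrier B" using closed f by simp
      fix y assume "y \<in> carrier ?A"
      then obtain g where g: "cauchy_seq ?N g" "y = seq_class ?N g"
        unfolding univ_cstar_def by (rule N.carrierE)
      have "B.conv (\<lambda>n. ?e (f n + g n)) (\<phi> x \<oplus>\<^bsub>B\<^esub> \<phi> y)"
        using B.conv_add[OF \<phi> \<phi>] f g by (simp add: B.poly_eval_add[OF v(1)])
      then show "\<phi> (x \<oplus>\<^bsub>?A\<^esub> y) = \<phi> x \<oplus>\<^bsub>B\<^esub> \<phi> y"
        using f g by (simp add: univ_cstar_def N.add_class N.cauchy_add \<phi>_eq)
      have "B.conv (\<lambda>n. ?e (f n * g n)) (\<phi> x \<otimes>\<^bsub>B\<^esub> \<phi> y)"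
        using B.conv_mult[OF \<phi> \<phi>] f g by (simp add: B.poly_eval_mult[OF v(1)])
      then show "\<phi> (x \<otimes>\<^bsub>?A\<^esub> y) = \<phi> x \<otimes>\<^bsub>B\<^esub> \<phi> y"
        using f g by (simp add: univ_cstar_def N.mult_class N.cauchy_mult \<phi>_eq)
    next
      show "\<phi> \<one>\<^bsub>?A\<^esub> = \<one>\<^bsub>B\<^esub>"
        by (simp add: univ_cstar_def N.one_class) (rule \<phi>_eq, simp_all add: B.poly_eval_one[OF v(1)] B.conv_const)
    qed
  next
    fix c x assume "x \<in> carrier ?A"
    then obtain f where f: "cauchy_seq ?N f" "x = seq_class ?N f"
      unfolding univ_cstar_def by (rule N.carrierE)
    have "B.conv (\<lambda>n. ?e (scale c (f n))) (c \<odot>\<^bsub>B\<^esub> \<phi> x)"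
      using B.conv_smult[OF \<phi>] f by (simp add: B.poly_eval_scale[OF v(1)])
    then show "\<phi> (c \<odot>\<^bsub>?A\<^esub> x) = c \<odot>\<^bsub>B\<^esub> \<phi> x"
      using f by (simp add: univ_cstar_def N.smult_class N.cauchy_scale \<phi>_eq)
  next
    fix x assume "x \<in> carrier ?A"
    then obtain f where f: "cauchy_seq ?N f" "x = seq_class ?N f"
      unfolding univ_cstar_def by (rule N.carrierE)
    have "B.conv (\<lambda>n. ?e (adj (f n))) (star B (\<phi> x))"
      using B.conv_star[OF \<phi>] f by (simp add: B.poly_eval_adj[OF v])
    then show "\<phi> (star ?A x) = star B (\<phi> x)"
      using f by (simp add: univ_cstar_def N.star_class N.cauchy_adj \<phi>_eq)
  qed
  moreover have "\<phi> (univ_gen R g) = v g" for g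
    unfolding univ_gen_def by (rule \<phi>_eq) (simp_all add: B.poly_eval_gen[OF v(1)] B.conv_const v)
  ultimately show ?thesis by blast
qed

text \<open>Uniqueness is only needed, and only shown, for finite-dimensional commutative targets.\<close>

lemma univ_hom_unique:
  assumes R: "bounded_relators R"
    and \<phi>: "\<phi> \<in> cstar_hom (univ_cstar R) (fun_cstar G)" and \<psi>: "\<psi> \<in> cstar_hom (univ_cstar R) (fun_cstar G)"
    and eq: "\<And>g. \<phi> (univ_gen R g) = \<psi> (univ_gen R g)" and x: "x \<in> carrier (univ_cstar R)"
  shows "\<phi> x = \<psi> x"
proof -
  let ?N = "univ_norm R" and ?A = "univ_cstar R" and ?B = "fun_cstar G"
  let ?c = "\<lambda>a. seq_class ?N (\<lambda>n. a)"
  interpret N: cstar_semi ?N by (rule univ_norm_cstar_semi[OF R])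
  interpret A: cstar_algebra ?A by (rule cstar_univ[OF R])
  have h: "\<theta> \<one>\<^bsub>?A\<^esub> = \<one>\<^bsub>?B\<^esub>"
    "\<And>a b. \<theta> (?c (a + b)) = \<theta> (?c a) \<oplus>\<^bsub>?B\<^esub> \<theta> (?c b)"
    "\<And>a b. \<theta> (?c (a * b)) = \<theta> (?c a) \<otimes>\<^bsub>?B\<^esub> \<theta> (?c b)"
    "\<And>z a. \<theta> (?c (scale z a)) = z \<odot>\<^bsub>?B\<^esub> \<theta> (?c a)"
    "\<And>x y. x \<in> carrier ?A \<Longrightarrow> y \<in> carrier ?A \<Longrightarrow> \<theta> (x \<oplus>\<^bsub>?A\<^esub> y) = \<theta> x \<oplus>\<^bsub>?B\<^esub> \<theta> y"
    if \<theta>: "\<theta> \<in> cstar_hom ?A ?B" for \<theta>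
  proof -
    have t: "\<theta> \<one>\<^bsub>?A\<^esub> = \<one>\<^bsub>?B\<^esub>"
      "\<And>x y. x \<in> carrier ?A \<Longrightarrow> y \<in> carrier ?A \<Longrightarrow> \<theta> (x \<oplus>\<^bsub>?A\<^esub> y) = \<theta> x \<oplus>\<^bsub>?B\<^esub> \<theta> y"
      "\<And>x y. x \<in> carrier ?A \<Longrightarrow> y \<in> carrier ?A \<Longrightarrow> \<theta> (x \<otimes>\<^bsub>?A\<^esub> y) = \<theta> x \<otimes>\<^bsub>?B\<^esub> \<theta> y"
      "\<And>z x. x \<in> carrier ?A \<Longrightarrow> \<theta> (z \<odot>\<^bsub>?A\<^esub> x) = z \<odot>\<^bsub>?B\<^esub> \<theta> x"
      using \<theta> by (simp_all add: cstar_hom_def ring_hom_def)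
    have k: "?c a \<in> carrier ?A" for a by (simp add: univ_cstar_def)
    show "\<theta> \<one>\<^bsub>?A\<^esub> = \<one>\<^bsub>?B\<^esub>" by (rule t(1))
    show "\<theta> (?c (a + b)) = \<theta> (?c a) \<oplus>\<^bsub>?B\<^esub> \<theta> (?c b)" for a b
      using t(2)[OF k k, of a b] by (simp add: univ_cstar_def N.add_class)
    show "\<theta> (?c (a * b)) = \<theta> (?c a) \<otimes>\<^bsub>?B\<^esub> \<theta> (?c b)" for a b
      using t(3)[OF k k, of a b] by (simp add: univ_cstar_def N.mult_class)
    show "\<theta> (?c (scale z a)) = z \<odot>\<^bsub>?B\<^esub> \<theta> (?c a)" for z a
      using t(4)[OF k, of z a] by (simp add: univ_cstar_def N.smult_class)
    show "\<theta> (x \<oplus>\<^bsub>?A\<^esub> y) = \<theta> x \<oplus>\<^bsub>?B\<^esub> \<theta> y" if "x \<in> carrier ?A" "y \<in> carrier ?A" for x y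
      by (rule t(2)[OF that])
  qed
  have c: "\<phi> (?c a) = \<psi> (?c a)" for a
  proof (induction a rule: fsa_induct)
    case (single w z)
    have "\<phi> (?c (Poly_Mapping.single (Word gs) 1)) = \<psi> (?c (Poly_Mapping.single (Word gs) 1))" for gs
    proof (induction gs)
      case Nil
      have "?c (Poly_Mapping.single (Word []) 1) = \<one>\<^bsub>?A\<^esub>"
        using N.one_class by (simp add: univ_cstar_def zero_free_word_def[symmetric])
      then show ?case using h(1)[OF \<phi>] h(1)[OF \<psi>] by simp
    next
      case (Cons g gs)
      have "Poly_Mapping.single (Word (g # gs)) 1 = gen g * Poly_Mapping.single (Word gs) (1::complex)"
        by (simp add: gen_def mult_single plus_free_word_def)
      then show ?case using Cons eq[of g] by (simp add: h(3)[OF \<phi>] h(3)[OF \<psi>] univ_gen_def)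
    qed
    from this[of "letters w"] have "\<phi> (?c (scale z (Poly_Mapping.single w 1))) = \<psi> (?c (scale z (Poly_Mapping.single w 1)))"
      by (simp add: h(4)[OF \<phi>] h(4)[OF \<psi>])
    then show ?case by (simp add: scale_single)
  next
    case (add a b)
    then show ?case by (simp add: h(2)[OF \<phi>] h(2)[OF \<psi>])
  qed
  have close: "cmod (\<phi> x s - \<psi> x s) < e" if s: "s \<in> G" and e: "0 < e" for s e
  proof -
    obtain f where f: "cauchy_seq ?N f" "x = seq_class ?N f" using x unfolding univ_cstar_def by (rule N.carrierE)
    obtain M where "cnorm ?A (x \<ominus>\<^bsub>?A\<^esub> ?c (f M)) < e/2"
      using N.dense[OF f(1), of "e/2"] e f(2) by (auto simp: univ_cstar_def)
    then obtain a where a: "cnorm ?A (x \<ominus>\<^bsub>?A\<^esub> ?c a) < e/2" by blast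
    have k: "?c a \<in> carrier ?A" by (simp add: univ_cstar_def)
    let ?d = "x \<ominus>\<^bsub>?A\<^esub> ?c a"
    have d: "?d \<in> carrier ?A" "?d \<oplus>\<^bsub>?A\<^esub> ?c a = x" using x k by (simp_all add: A.diff_add_cancel')
    have sp: "\<theta> x s = \<theta> ?d s + \<theta> (?c a) s" if "\<theta> \<in> cstar_hom ?A ?B" for \<theta>
      using h(5)[OF that d(1) k] s unfolding d(2) by (simp add: fun_cstar_def)
    have "\<phi> x s - \<psi> x s = \<phi> ?d s - \<psi> ?d s" using sp[OF \<phi>] sp[OF \<psi>] c[of a] by simp
    then have "cmod (\<phi> x s - \<psi> x s) \<le> cmod (\<phi> ?d s) + cmod (\<psi> ?d s)" by (simp add: norm_triangle_ineq4)
    then show ?thesis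
      using A.hom_fun_bound[OF \<phi> d(1) s] A.hom_fun_bound[OF \<psi> d(1) s] a by linarith
  qed
  have "\<phi> x s = \<psi> x s" if "s \<in> G" for s
    using close[OF that, of "cmod (\<phi> x s - \<psi> x s)"] by auto
  moreover have "\<phi> x \<in> extensional G" "\<psi> x \<in> extensional G"
    using \<phi> \<psi> x by (auto simp: cstar_hom_def ring_hom_def fun_cstar_def)
  ultimately show ?thesis by (metis extensionalityI)
qed


section \<open>Verification: quantum automorphism algebra and canonical surjection\<close>

lemma univ_cstar_generated:
  assumes R: "bounded_relators R" and x: "x \<in> carrier (univ_cstar R)" and e: "0 < e"
  shows "\<exists>a. cnorm (univ_cstar R)
    (x \<ominus>\<^bsub>univ_cstar R\<^esub> cstar_algebra.poly_eval (univ_cstar R) (univ_gen R) a) < e"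
proof -
  let ?N = "univ_norm R" and ?A = "univ_cstar R"
  let ?c = "\<lambda>a. seq_class ?N (\<lambda>n. a)"
  interpret N: cstar_semi ?N by (rule univ_norm_cstar_semi[OF R])
  interpret A: cstar_algebra ?A by (rule cstar_univ[OF R])
  have g: "univ_gen R g \<in> carrier ?A" for g by (simp add: univ_gen_def univ_cstar_def)
  have "A.poly_eval (univ_gen R) a = ?c a" for a
  proof (induction a rule: fsa_induct)
    case (single w z)
    have one: "\<one>\<^bsub>?A\<^esub> = ?c (Poly_Mapping.single (Word []) 1)"
      using N.one_class by (simp add: univ_cstar_def zero_free_word_def[symmetric])
    have "foldr (\<lambda>g y. univ_gen R g \<otimes>\<^bsub>?A\<^esub> y) gs \<one>\<^bsub>?A\<^esub> = ?c (Poly_Mapping.single (Word gs) 1)" for gs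
      by (induction gs)
        (simp_all add: one, simp add: univ_cstar_def univ_gen_def N.mult_class gen_def mult_single plus_free_word_def)
    then have "A.word_eval (univ_gen R) w = ?c (Poly_Mapping.single w 1)" by (simp add: A.word_eval_def)
    then show ?case
      by (simp add: A.poly_eval_single[OF g]) (simp add: univ_cstar_def N.smult_class scale_single)
  next
    case (add a b)
    then show ?case by (simp add: A.poly_eval_add[OF g]) (simp add: univ_cstar_def N.add_class)
  qed
  moreover obtain f where f: "cauchy_seq ?N f" "x = seq_class ?N f"
    using x unfolding univ_cstar_def by (rule N.carrierE)
  ultimately show ?thesis using N.dense[OF f(1) e] by (auto simp: univ_cstar_def)
qed

lemma bounded_relators_qaut: "bounded_relators (qaut_relators E)"
  unfolding bounded_relators_def
proof
  fix a :: "('a \<times> 'a) free_star_algebra"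
  have "p a \<le> (\<Sum>w\<in>Poly_Mapping.keys a. cmod (Poly_Mapping.lookup a w))" if pR: "p \<in> rel_seminorms (qaut_relators E)" for p
  proof -
    interpret cstar_semi p using pR by (simp add: rel_seminorms_def cstar_semi_def)
    have g: "p (gen x) \<le> 1" for x :: "'a \<times> 'a"
    proof -
      obtain i j where x: "x = (i, j)" by (cases x)
      have "gen x * gen x - gen x \<in> qaut_relators E" by (auto simp: qaut_relators_def x)
      then have "p (gen x * gen x - gen x) = 0" using pR by (simp add: rel_seminorms_def)
      then have "p (gen x * gen x) = p (gen x)" using dif[of "gen x * gen x" "gen x"] by simp
      then have "(p (gen x))\<^sup>2 = p (gen x)" using cs[of "gen x"] by simp
      then show ?thesis by (auto simp: power2_eq_square)
    qed
    have one: "p 1 \<le> 1" using cs[of 1] by (auto simp: power2_eq_square)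
    have w: "p (Poly_Mapping.single (Word gs) 1) \<le> 1" for gs
    proof (induction gs)
      case Nil
      show ?case using one by (simp add: zero_free_word_def[symmetric])
    next
      case (Cons x gs)
      have "Poly_Mapping.single (Word (x # gs)) 1 = gen x * Poly_Mapping.single (Word gs) (1::complex)"
        by (simp add: gen_def mult_single plus_free_word_def)
      moreover have "p (gen x) * p (Poly_Mapping.single (Word gs) 1) \<le> 1"
        using mult_mono[OF g Cons] by simp
      ultimately show ?case using sub[of "gen x" "Poly_Mapping.single (Word gs) 1"] by simp
    qed
    have s: "p (Poly_Mapping.single w c) \<le> cmod c" for w c
      using sc[of c "Poly_Mapping.single w 1"] mult_left_mono[OF w[of "letters w"], of "cmod c"]
      by (simp add: scale_single)
    have "p a \<le> (\<Sum>w\<in>Poly_Mapping.keys a. p (Poly_Mapping.single w (Poly_Mapping.lookup a w)))"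
      using sm[of "\<lambda>w. Poly_Mapping.single w (Poly_Mapping.lookup a w)" "Poly_Mapping.keys a"]
      by (simp only: single_decomp[of a, symmetric])
    also have "\<dots> \<le> (\<Sum>w\<in>Poly_Mapping.keys a. cmod (Poly_Mapping.lookup a w))" by (intro sum_mono s)
    finally show ?thesis .
  qed
  then show "bdd_above ((\<lambda>p. p a) ` rel_seminorms (qaut_relators E))" by (intro bdd_aboveI) auto
qed

lemma cstar_qaut: "cstar_algebra (qaut_algebra E)"
  unfolding qaut_algebra_def by (rule cstar_univ[OF bounded_relators_qaut])

lemma qaut_gen_magic:
  "magic_unitary (qaut_algebra E) (qaut_gen E)"
  "commutes_with_adjacency E (qaut_algebra E) (qaut_gen E)"
proof -
  let ?R = "qaut_relators E"
  let ?N = "univ_norm ?R" and ?A = "qaut_algebra E"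
  let ?c = "\<lambda>a. seq_class ?N (\<lambda>n. a)"
  interpret N: cstar_semi ?N by (rule univ_norm_cstar_semi[OF bounded_relators_qaut])
  interpret A: cstar_algebra ?A by (rule cstar_qaut)
  have A: "?A = completion ?N" by (simp add: qaut_algebra_def univ_cstar_def)
  have g: "qaut_gen E i j = ?c (gen (i, j))" for i j by (simp add: qaut_gen_def univ_gen_def)
  have k: "?c a \<in> carrier ?A" for a by (simp add: A)
  have sum: "(\<Oplus>\<^bsub>?A\<^esub>i\<in>S. ?c (h i)) = ?c (sum h S)" if "finite S" for S :: "'a set" and h
    using that by induction (simp_all add: k A.finsum_insert Pi_def, simp_all add: A N.zero_class N.add_class)
  have rel: "?c a = ?c b" if "a - b \<in> ?R" for a b
  proof -
    have "?N (a - b) = 0"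
      using univ_norm_seminorm(1)[of ?R] bounded_relators_qaut[of E] that
      by (auto simp: bounded_relators_def rel_seminorms_def)
    then show ?thesis by (simp add: N.class_eq)
  qed
  have zero: "\<zero>\<^bsub>?A\<^esub> = ?c 0" and one: "\<one>\<^bsub>?A\<^esub> = ?c 1" by (simp_all add: A N.zero_class N.one_class)
  have m: "?c a \<otimes>\<^bsub>?A\<^esub> ?c b = ?c (a * b)" for a b by (simp add: A N.mult_class)
  have s: "z \<odot>\<^bsub>?A\<^esub> ?c a = ?c (scale z a)" for z a by (simp add: A N.smult_class)
  have st: "star ?A (?c a) = ?c (adj a)" for a by (simp add: A N.star_class)
  have r1: "gen (i, j) * gen (i, j) - gen (i, j) \<in> ?R" for i j
    unfolding qaut_relators_def by blast
  have r2: "gen (i, j) * gen (i, k) - 0 \<in> ?R" if "j \<noteq> k" for i j k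
    unfolding qaut_relators_def diff_0_right using that by blast
  have r3: "gen (i, k) * gen (j, k) - 0 \<in> ?R" if "i \<noteq> j" for i j k
    unfolding qaut_relators_def diff_0_right using that by blast
  have r4: "(\<Sum>j\<in>UNIV. gen (i, j)) - 1 \<in> ?R" for i
    unfolding qaut_relators_def by blast
  have r5: "(\<Sum>i\<in>UNIV. gen (i, j)) - 1 \<in> ?R" for j
    unfolding qaut_relators_def by blast
  have r6: "(\<Sum>k\<in>UNIV. scale (of_bool (E i k)) (gen (k, j))) -
      (\<Sum>k\<in>UNIV. scale (of_bool (E k j)) (gen (i, k))) \<in> ?R" for i j
    unfolding qaut_relators_def by blast
  show "magic_unitary ?A (qaut_gen E)"
    unfolding magic_unitary_def g m st zero one sum[OF finite] adj_gen
    by (intro conjI allI impI k refl rel r1 r2 r3 r4 r5)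
  show "commutes_with_adjacency E ?A (qaut_gen E)"
    unfolding commutes_with_adjacency_def g s sum[OF finite]
    by (intro allI rel r6)
qed

theorem qaut_universal:
  assumes B: "cstar_algebra B" and u: "magic_unitary B u" "commutes_with_adjacency E B u"
  shows "\<exists>\<phi>\<in>cstar_hom (qaut_algebra E) B. \<forall>i j. \<phi> (qaut_gen E i j) = u i j"
proof -
  interpret B: cstar_algebra B by (rule B)
  define v where "v = case_prod u"
  have v: "v x \<in> carrier B" "star B (v x) = v x" for x
    using u(1) by (auto simp: v_def magic_unitary_def split: prod.split)
  have vu: "v (i, j) = u i j" for i j by (simp add: v_def)
  note ev = B.poly_eval_gen[OF v(1)] B.poly_eval_mult[OF v(1)] B.poly_eval_diff[OF v(1)]
    B.poly_eval_sum[OF v(1)] B.poly_eval_scale[OF v(1)] B.poly_eval_one[OF v(1)]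
  have u': "u i j \<in> carrier B" for i j using u(1) by (simp add: magic_unitary_def)
  have dz: "x \<ominus>\<^bsub>B\<^esub> x = \<zero>\<^bsub>B\<^esub>" if "x \<in> carrier B" for x using that by (simp add: a_minus_def B.r_neg)
  have fc: "(\<Oplus>\<^bsub>B\<^esub>k\<in>UNIV. of_bool (E k j) \<odot>\<^bsub>B\<^esub> u i k) \<in> carrier B" for i j
    by (intro B.finsum_closed) (auto simp: u' B.smult_closed)
  have "B.poly_eval v r = \<zero>\<^bsub>B\<^esub>" if "r \<in> qaut_relators E" for r
    using that u unfolding qaut_relators_def magic_unitary_def commutes_with_adjacency_def
    by (auto simp: ev vu dz u' fc)
  then have "\<exists>\<phi>\<in>cstar_hom (univ_cstar (qaut_relators E)) B. \<forall>g. \<phi> (univ_gen (qaut_relators E) g) = v g"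
    by (intro univ_cstar_universal bounded_relators_qaut B v)
  then show ?thesis by (auto simp: qaut_algebra_def qaut_gen_def v_def)
qed

lemma finite_graph_aut: "finite (graph_aut E)" "graph_aut E \<noteq> {}"
proof -
  show "finite (graph_aut E)" by simp
  have "id \<in> graph_aut E" by (simp add: graph_aut_def)
  then show "graph_aut E \<noteq> {}" by blast
qed

lemma finsum_fun_cstar:
  assumes "finite G" "G \<noteq> {}" "finite S" "\<And>i. i \<in> S \<Longrightarrow> f i \<in> extensional G"
  shows "(\<Oplus>\<^bsub>fun_cstar G\<^esub>i\<in>S. f i) = (\<lambda>s\<in>G. \<Sum>i\<in>S. f i s)"
proof -
  interpret B: cstar_algebra "fun_cstar G" by (rule cstar_fun[OF assms(1,2)])
  show ?thesis using assms(3,4)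
  proof induction
    case empty
    show ?case by (simp add: B.finsum_empty) (simp add: fun_cstar_def)
  next
    case (insert x F)
    have "f i \<in> carrier (fun_cstar G)" if "i \<in> insert x F" for i using insert that by (simp add: fun_cstar_def)
    then have "(\<Oplus>\<^bsub>fun_cstar G\<^esub>i\<in>insert x F. f i) = f x \<oplus>\<^bsub>fun_cstar G\<^esub> (\<Oplus>\<^bsub>fun_cstar G\<^esub>i\<in>F. f i)"
      using insert by (intro B.finsum_insert) auto
    then show ?case using insert by (simp add: restrict_def fun_cstar_def fun_eq_iff)
  qed
qed

lemma aut_indicator_magic:
  "magic_unitary (fun_cstar (graph_aut E)) (aut_indicator E)"
  "commutes_with_adjacency E (fun_cstar (graph_aut E)) (aut_indicator E)"
proof -
  let ?G = "graph_aut E" and ?B = "fun_cstar (graph_aut E)"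
  have sum: "(\<Oplus>\<^bsub>?B\<^esub>i\<in>UNIV. f i) = (\<lambda>s\<in>?G. \<Sum>i\<in>UNIV. f i s)" if "\<And>i. f i \<in> extensional ?G" for f :: "'a \<Rightarrow> _"
    by (rule finsum_fun_cstar[OF finite_graph_aut finite that])
  have e: "aut_indicator E i j \<in> extensional ?G" for i j by (simp add: aut_indicator_def)
  have se: "c \<odot>\<^bsub>?B\<^esub> aut_indicator E i j \<in> extensional ?G" for c i j by (simp add: fun_cstar_def)
  have b: "(\<Sum>j\<in>UNIV. of_bool (s j = i)) = (1::complex)" if "s \<in> ?G" for s and i :: 'a
  proof -
    have "bij s" using that by (simp add: graph_aut_def)
    then have "(\<Sum>j\<in>UNIV. of_bool (s j = i)) = (\<Sum>k\<in>UNIV. of_bool (k = i) :: complex)"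
      by (rule sum.reindex_bij_betw[of s UNIV UNIV "\<lambda>k. of_bool (k = i)"])
    then show ?thesis by simp
  qed
  have c: "(\<Sum>k\<in>UNIV. of_bool (E i k) * of_bool (s j = k)) = (\<Sum>k\<in>UNIV. of_bool (E k j) * (of_bool (s k = i) :: complex))"
    if s: "s \<in> ?G" for s i j
  proof -
    have bij: "bij s" and E: "\<And>i j. E (s i) (s j) = E i j" using s by (auto simp: graph_aut_def)
    have "(\<Sum>k\<in>UNIV. of_bool (E k j) * (of_bool (s k = i) :: complex))
      = (\<Sum>k\<in>UNIV. of_bool (E (s k) (s j)) * (of_bool (s k = i) :: complex))" by (simp add: E)
    also have "\<dots> = (\<Sum>k\<in>UNIV. of_bool (E k (s j)) * (of_bool (k = i) :: complex))"
      using bij by (rule sum.reindex_bij_betw[of s UNIV UNIV "\<lambda>k. of_bool (E k (s j)) * of_bool (k = i)"])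
    also have "\<dots> = of_bool (E i (s j))" by (simp add: of_bool_def if_distrib[of "\<lambda>x. _ * x"] cong: if_cong)
    finally show ?thesis by (simp add: of_bool_def if_distrib[of "\<lambda>x. _ * x"] cong: if_cong)
  qed
  have inj: "j = k" if "s \<in> ?G" "s j = s k" for s j k
    using that by (simp add: graph_aut_def bij_def inj_eq)
  show "magic_unitary ?B (aut_indicator E)"
    unfolding magic_unitary_def sum[OF e]
  proof (intro conjI allI impI)
    fix i j k
    show "aut_indicator E i j \<in> carrier ?B" by (simp add: fun_cstar_def e)
    show "star ?B (aut_indicator E i j) = aut_indicator E i j"
      by (auto simp: fun_cstar_def aut_indicator_def intro!: restrict_ext)
    show "aut_indicator E i j \<otimes>\<^bsub>?B\<^esub> aut_indicator E i j = aut_indicator E i j"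
      by (auto simp: fun_cstar_def aut_indicator_def intro!: restrict_ext)
    show "aut_indicator E i j \<otimes>\<^bsub>?B\<^esub> aut_indicator E i k = \<zero>\<^bsub>?B\<^esub>" if "j \<noteq> k"
      using inj that by (auto simp: fun_cstar_def aut_indicator_def intro!: restrict_ext)
    show "aut_indicator E i k \<otimes>\<^bsub>?B\<^esub> aut_indicator E j k = \<zero>\<^bsub>?B\<^esub>" if "i \<noteq> j"
      using that by (auto simp: fun_cstar_def aut_indicator_def intro!: restrict_ext)
    show "(\<lambda>s\<in>?G. \<Sum>j\<in>UNIV. aut_indicator E i j s) = \<one>\<^bsub>?B\<^esub>"
      by (auto simp: fun_cstar_def aut_indicator_def b
          simp del: sum_of_bool_eq intro!: restrict_ext)
    show "(\<lambda>s\<in>?G. \<Sum>i\<in>UNIV. aut_indicator E i j s) = \<one>\<^bsub>?B\<^esub>"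
      by (auto simp: fun_cstar_def aut_indicator_def intro!: restrict_ext)
  qed
  show "commutes_with_adjacency E ?B (aut_indicator E)"
    unfolding commutes_with_adjacency_def sum[OF se]
    by (simp add: aut_indicator_def fun_cstar_def c del: sum_of_bool_mult_eq sum_mult_of_bool_eq cong: restrict_cong)
qed

theorem canonical_surjection_unique_existence:
  "\<exists>!\<phi>. \<phi> \<in> cstar_hom (qaut_algebra E) (fun_cstar (graph_aut E)) \<and>
        \<phi> \<in> extensional (carrier (qaut_algebra E)) \<and>
        (\<forall>i j. \<phi> (qaut_gen E i j) = aut_indicator E i j)"
proof -
  let ?A = "qaut_algebra E" and ?B = "fun_cstar (graph_aut E)"
  interpret A: cstar_algebra ?A by (rule cstar_qaut)
  obtain \<phi> where \<phi>: "\<phi> \<in> cstar_hom ?A ?B" "\<And>i j. \<phi> (qaut_gen E i j) = aut_indicator E i j"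
    using qaut_universal[OF cstar_fun[OF finite_graph_aut] aut_indicator_magic] by blast
  let ?\<psi> = "restrict \<phi> (carrier ?A)"
  have "?\<psi> \<in> cstar_hom ?A ?B"
    using \<phi>(1) by (simp add: cstar_hom_def ring_hom_def Pi_def A.smult_closed A.star_closed)
  moreover have "?\<psi> (qaut_gen E i j) = aut_indicator E i j" for i j
    using qaut_gen_magic(1)[of E] \<phi>(2) by (simp add: magic_unitary_def)
  moreover have "\<theta> = \<theta>'"
    if "\<theta> \<in> cstar_hom ?A ?B" "\<theta> \<in> extensional (carrier ?A)" "\<And>i j. \<theta> (qaut_gen E i j) = aut_indicator E i j"
      and "\<theta>' \<in> cstar_hom ?A ?B" "\<theta>' \<in> extensional (carrier ?A)" "\<And>i j. \<theta>' (qaut_gen E i j) = aut_indicator E i j"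
    for \<theta> \<theta>'
  proof (rule extensionalityI[OF that(2,5)])
    fix x assume "x \<in> carrier ?A"
    then show "\<theta> x = \<theta>' x"
      using that univ_hom_unique[OF bounded_relators_qaut, of \<theta> E "graph_aut E" \<theta>']
      by (auto simp: qaut_algebra_def qaut_gen_def)
  qed
  ultimately show ?thesis by (intro ex1I[of _ ?\<psi>]) auto
qed


section \<open>Verification: the graph\<close>

lemma UNIV_10: "(UNIV :: 10 set) = {0, 1, 2, 3, 4, 5, 6, 7, 8, 9}"
proof -
  have "card {0, 1, 2, 3, 4, 5, 6, 7, 8, 9 :: 10} = 10" by simp
  then show ?thesis by (intro card_subset_eq[symmetric]) simp_all
qed

lemma ten_cases: "P 0 \<Longrightarrow> P 1 \<Longrightarrow> P 2 \<Longrightarrow> P 3 \<Longrightarrow> P 4 \<Longrightarrow> P 5 \<Longrightarrow> P 6 \<Longrightarrow> P 7 \<Longrightarrow> P 8 \<Longrightarrow> P 9 \<Longrightarrow> P (x::10)"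
  using UNIV_I[of x] unfolding UNIV_10 by auto

lemma cycle10_connected: "\<exists>n. (cycle10 ^^ n) i j"
proof -
  have w: "(cycle10 ^^ n) i (i + of_nat n)" for n
    by (induction n) (auto simp: relcompp_apply cycle10_def add_ac)
  have "\<exists>n. d = of_nat n" for d :: 10
    by (rule ten_cases[of _ d]) (metis of_nat_0 of_nat_1 of_nat_numeral)+
  then obtain n where "j - i = of_nat n" by blast
  then show ?thesis using w[of n] by (metis add_diff_cancel_left' add.commute diff_add_cancel)
qed

lemma C10_2_iff: "C10_2 i j \<longleftrightarrow> j - i \<in> {1, -1, 2, -2}"
proof -
  have 2: "(cycle10 ^^ 2) i j \<longleftrightarrow> (\<exists>k. cycle10 i k \<and> cycle10 k j)"
    by (auto simp: numeral_2_eq_2 relcompp_apply)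
  have "graph_dist cycle10 i j = 2 \<longleftrightarrow> (cycle10 ^^ 2) i j \<and> i \<noteq> j \<and> \<not> cycle10 i j"
  proof
    assume d: "graph_dist cycle10 i j = 2"
    have l: "(cycle10 ^^ graph_dist cycle10 i j) i j"
      unfolding graph_dist_def using LeastI_ex[OF cycle10_connected] .
    have "\<not> (cycle10 ^^ n) i j" if "n < 2" for n
      using not_less_Least[of n "\<lambda>n. (cycle10 ^^ n) i j"] that d by (simp add: graph_dist_def)
    from this[of 0] this[of "Suc 0"] show "(cycle10 ^^ 2) i j \<and> i \<noteq> j \<and> \<not> cycle10 i j"
      using l d by (simp add: eq_OO)
  next
    assume h: "(cycle10 ^^ 2) i j \<and> i \<noteq> j \<and> \<not> cycle10 i j"
    show "graph_dist cycle10 i j = 2" unfolding graph_dist_def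
    proof (rule Least_equality)
      fix n assume "(cycle10 ^^ n) i j"
      then have "n \<noteq> 0" "n \<noteq> Suc 0" using h by (auto simp: eq_OO intro!: Nat.gr0I)
      then show "2 \<le> n" by simp
    qed (use h in simp)
  qed
  moreover have "(cycle10 ^^ 2) i j \<longleftrightarrow> j - i \<in> {0, 2, -2}"
    unfolding 2 by (auto simp: cycle10_def algebra_simps)
  moreover have "cycle10 i j \<longleftrightarrow> j - i \<in> {1, -1}"
    by (auto simp: cycle10_def algebra_simps)
  moreover have "i \<noteq> j \<longleftrightarrow> j - i \<noteq> 0" by auto
  moreover have "d \<in> {1, -1} \<or> d \<in> {0, 2, -2} \<and> d \<noteq> 0 \<and> d \<notin> {1, -1} \<longleftrightarrow> d \<in> {1, -1, 2, -2}" for d :: 10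
    by auto
  ultimately show ?thesis unfolding C10_2_def by (simp only:)
qed

lemma simple_graph_C10_2: "simple_graph C10_2"
proof -
  have "irreflp C10_2" by (rule irreflpI) (simp add: C10_2_iff)
  moreover have "symp C10_2"
  proof (rule sympI)
    fix i j assume "C10_2 i j"
    then have "j - i \<in> {1, -1, 2, -2}" by (simp only: C10_2_iff)
    then have "- (j - i) \<in> {1, -1, 2, -2}" by (auto simp del: minus_diff_eq)
    then show "C10_2 j i" by (simp only: C10_2_iff minus_diff_eq)
  qed
  ultimately show ?thesis by (simp add: simple_graph_def)
qed

end

theory Submission
  imports Defs
begin

text \<open>
  Let \<open>\<chi>\<close> be a faithful character of \<open>\<int>/10\<close>. The vector \<open>x\<^sub>i = \<Sum>\<^sub>j \<chi>(j) u\<^sub>i\<^sub>j\<close> is an eigenvector of the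
  adjacency matrix for the eigenvalue of \<open>\<chi>\<close>, whose eigenspace is spanned by \<open>\<chi>\<close> and its inverse, so
  \<open>x\<^sub>i = \<chi>(i) a + \<chi>(-i) b\<close>. As each row of \<open>u\<close> consists of orthogonal projections, \<open>x\<^sub>i\<^sup>m = \<Sum>\<^sub>j \<chi>(mj) u\<^sub>i\<^sub>j\<close>;
  the Fourier coefficients of \<open>x\<^sub>i\<^sup>2\<close> at \<open>0\<close> and of \<open>x\<^sub>i\<^sup>3\<close> at \<open>\<plusminus>1\<close> therefore vanish, which gives
  \<open>ab + ba = 0\<close> and \<open>a\<^sup>2b = b\<^sup>2a = 0\<close>. Hence \<open>x\<^sub>i ab = 0\<close>, and \<open>ab = 0\<close> because \<open>x\<^sub>i\<close> is invertible. So
  \<open>a\<close> and \<open>b\<close> commute, and with them the \<open>x\<^sub>i\<close> and the \<open>u\<^sub>i\<^sub>j\<close>, which are polynomials in the \<open>x\<^sub>i\<close>.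

  For any graph, once the algebra is commutative, the products \<open>p\<^sub>\<sigma> = \<Prod>\<^sub>j u\<^bsub>\<sigma>(j),j\<^esub>\<close> add up to \<open>1\<close>, vanish
  unless \<open>\<sigma>\<close> is an automorphism, and satisfy \<open>x p\<^sub>\<sigma> = \<phi>(x)(\<sigma>) p\<^sub>\<sigma>\<close> for the canonical surjection \<open>\<phi>\<close>.
\<close>

section \<open>Fourier analysis of the magic unitary\<close>

text \<open>\<open>Rep_bit0\<close> picks the representative in 0..9, so \<open>chi\<close> is the
  character of Z/10 that sends 1 to a primitive tenth root of unity.\<close>

definition chi :: "10 \<Rightarrow> complex" where
  "chi j = cis (pi / 5 * of_int (Rep_bit0 j))"

text \<open>Reducing z mod 10 changes the angle by a multiple of 2 \<pi>. Any integer representative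
  may thus be used, which makes \<open>chi_add\<close> immediate.\<close>

lemma chi_of_int: "chi (of_int z) = cis (pi / 5 * of_int z)"
proof -
  have "cis (pi / 5 * of_int z) = cis (pi / 5 * of_int (z mod 10) + 2 * pi * of_int (z div 10))"
    by (subst div_mult_mod_eq[of z 10, symmetric]) (simp only: of_int_add of_int_mult, simp add: algebra_simps)
  also have "\<dots> = cis (pi / 5 * of_int (z mod 10))"
    by (simp flip: cis_mult)
  also have "of_int (z mod 10) = (of_int (Rep_bit0 (of_int z :: 10)) :: real)"
    using bit0.Rep_Abs_mod[where 'a = "5", of z] by (simp add: bit0.of_int_eq)
  finally show ?thesis by (simp add: chi_def)
qed

lemma chi_add: "chi (i + j) = chi i * chi j"
proof -
  obtain y z where "i = of_int y" "j = of_int z" by (meson bit0_cases)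
  moreover have "chi (of_int (y + z)) = chi (of_int y) * chi (of_int z)"
    unfolding chi_of_int cis_mult by (simp only: of_int_add distrib_left)
  ultimately show ?thesis by simp
qed

lemma chi_0 [simp]: "chi 0 = 1"
  using chi_of_int[of 0] by simp

lemma chi_1: "chi 1 = cis (pi / 5)"
  using chi_of_int[of 1] by simp

lemma chi_neq_0: "chi j \<noteq> 0"
  by (simp add: chi_def)

lemma chi_uminus: "chi (- j) = cnj (chi j)"
proof -
  have "chi (- j) * chi j = 1" by (simp flip: chi_add)
  moreover have "cnj (chi j) * chi j = 1" by (simp add: chi_def cis_cnj cis_mult)
  ultimately have "chi (- j) * chi j = cnj (chi j) * chi j" by simp
  then show ?thesis using chi_neq_0 by simp
qed

text \<open>Faithfulness: the cosine is 1 only at multiples of 2 \<pi>, so a representative in 0..9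
  has to be a multiple of 10.\<close>

lemma chi_eq_1: "chi j = 1 \<longleftrightarrow> j = 0"
proof
  assume "chi j = 1"
  obtain z where z: "j = of_int z" "0 \<le> z" "z < 10" by (cases j) auto
  have "cos (pi / 5 * of_int z) = 1"
    using \<open>chi j = 1\<close> by (metis z(1) chi_of_int cis.sel(1) one_complex.sel(1))
  then obtain n :: int where "pi / 5 * of_int z = of_int n * 2 * pi"
    by (auto simp: cos_one_2pi_int)
  then have "(of_int z :: real) = of_int (10 * n)" by simp
  then have "z = 10 * n" by linarith
  then have "z = 0" using z(2,3) by simp
  then show "j = 0" using z(1) by simp
qed simp

lemma chi_eq_iff: "chi i = chi j \<longleftrightarrow> i = j"
  using chi_eq_1[of "i - j"] chi_add[of "i - j" j] chi_neq_0[of j] by auto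

lemma sum_translate: "(\<Sum>j\<in>UNIV. f (j + d)) = (\<Sum>j\<in>UNIV. f (j :: 'b :: ab_group_add))"
  by (rule sum.reindex_bij_witness[of _ "\<lambda>j. j - d" "\<lambda>j. j + d"]) auto

text \<open>Orthogonality of characters: translating the index by 1 multiplies the sum by
  \<open>chi k\<close>, which differs from 1 unless k = 0.\<close>

lemma sum_chi: "(\<Sum>j\<in>UNIV. chi (k * j)) = (if k = 0 then 10 else 0)"
proof (cases "k = 0")
  case False
  have "(\<Sum>j\<in>UNIV. chi (k * j)) = (\<Sum>j\<in>UNIV. chi (k * (j + 1)))"
    by (rule sum_translate[symmetric])
  also have "\<dots> = chi k * (\<Sum>j\<in>UNIV. chi (k * j))"
    by (simp add: distrib_left chi_add sum_distrib_left mult.commute)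
  finally show ?thesis using False by (simp add: chi_eq_1)
qed simp

section \<open>The spectrum of the graph\<close>

text \<open>The graph is the Cayley graph of Z/10 with connection set {1, -1, 2, -2}; this is its
  eigenvalue on the k-th power of \<open>chi\<close>.\<close>

definition eigval :: "10 \<Rightarrow> complex" where
  "eigval k = (\<Sum>d\<in>{1, -1, 2, -2}. chi (d * k))"

text \<open>With c the sum of \<open>chi k\<close> and its conjugate, modulus 1 turns the sum of
  their squares into c^2 - 2.\<close>

lemma eigval_cos: "eigval k = of_real ((2 * Re (chi k))\<^sup>2 + 2 * Re (chi k) - 2)"
proof -
  have n: "chi k * cnj (chi k) = 1" by (simp add: chi_0[symmetric] del: chi_0 flip: chi_uminus chi_add)
  have "eigval k = chi k + chi (-k) + chi (k + k) + chi (-k + -k)"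
    by (simp add: eigval_def)
  also have "\<dots> = (chi k + cnj (chi k))\<^sup>2 + (chi k + cnj (chi k)) - 2 * (chi k * cnj (chi k))"
    unfolding chi_add chi_uminus by (simp add: power2_eq_square algebra_simps)
  also have "\<dots> = of_real ((2 * Re (chi k))\<^sup>2 + 2 * Re (chi k) - 2)"
    unfolding n complex_add_cnj by simp
  finally show ?thesis .
qed

text \<open>\<open>c\<^sup>2 + c - 2\<close> determines \<open>c = 2 cos (k \<pi> / 5)\<close> here, since the other solution
  \<open>-1 - 2 cos (\<pi> / 5)\<close> is less than \<open>-2\<close>.\<close>
lemma eigval_eq_iff: "eigval k = eigval 1 \<longleftrightarrow> k = 1 \<or> k = - 1"
proof
  assume e: "eigval k = eigval 1"
  define b c where "b = Re (chi k)" and "c = Re (chi 1)"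
  have "(2 * b)\<^sup>2 + 2 * b = (2 * c)\<^sup>2 + 2 * c"
    using e unfolding eigval_cos of_real_eq_iff b_def c_def by linarith
  then have "(b - c) * (2 * b + 2 * c + 1) = 0"
    by (simp add: power2_eq_square algebra_simps)
  moreover have "c > 1 / 2"
    using cos_monotone_0_pi[of "pi / 5" "pi / 3"] by (simp add: c_def chi_1 cos_60)
  moreover have "- 1 \<le> b" by (simp add: b_def chi_def)
  ultimately have "b = c" by auto
  \<comment> \<open>Equal real parts and modulus 1 make \<open>chi k\<close> a root of the quadratic
    whose roots are \<open>chi 1\<close> and \<open>chi (-1)\<close>.\<close>
  then have "chi k + cnj (chi k) = chi 1 + cnj (chi 1)"
    unfolding complex_add_cnj b_def c_def by simp
  then have "cnj (chi k) = chi 1 + cnj (chi 1) - chi k" by (simp add: eq_diff_eq add.commute)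
  then have "(chi k - chi 1) * (chi k - chi (-1)) = chi 1 * chi (-1) - chi k * chi (-k)"
    unfolding chi_uminus by (simp only:) (simp add: algebra_simps)
  also have "\<dots> = 0" by (simp flip: chi_add)
  finally have "(chi k - chi 1) * (chi k - chi (-1)) = 0" .
  then show "k = 1 \<or> k = - 1" by (simp add: chi_eq_iff)
next
  assume "k = 1 \<or> k = - 1"
  then show "eigval k = eigval 1"
    by (auto simp: eigval_cos chi_uminus)
qed

section \<open>Fourier analysis with values in a complex algebra\<close>

text \<open>A purely algebraic setting without star or norm. The sort describes unital rings and
  admits the zero ring.\<close>

locale complex_algebra = vector_space sc for sc :: "complex \<Rightarrow> 'a::{ring, monoid_mult} \<Rightarrow> 'a" (infixr \<open>*\<^sub>C\<close> 75) +
  assumes sc_left: "(c *\<^sub>C x) * y = c *\<^sub>C (x * y)"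
    and sc_right: "x * (c *\<^sub>C y) = c *\<^sub>C (x * y)"
begin

text \<open>After interchanging the sums, orthogonality of characters leaves only the term j =
  i.\<close>

lemma fourier_inversion:
  "y i = (\<Sum>k\<in>UNIV. (chi (k * i) / 10) *\<^sub>C (\<Sum>j\<in>UNIV. chi (- (k * j)) *\<^sub>C y j))"
proof -
  have "(\<Sum>k\<in>UNIV. (chi (k * i) / 10) *\<^sub>C (\<Sum>j\<in>UNIV. chi (- (k * j)) *\<^sub>C y j))
      = (\<Sum>j\<in>UNIV. \<Sum>k\<in>UNIV. (chi ((i - j) * k) / 10) *\<^sub>C y j)"
    by (subst sum.swap) (simp add: scale_sum_right algebra_simps chi_add[symmetric])
  also have "\<dots> = (\<Sum>j\<in>UNIV. if j = i then y j else 0)"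
    by (rule sum.cong) (auto simp: scale_sum_left[symmetric] sum_divide_distrib[symmetric] sum_chi)
  finally show ?thesis by simp
qed

text \<open>Translating \<open>y\<close> by d multiplies its k-th Fourier coefficient by
  \<open>chi (d * k)\<close>. Hence the adjacency operator acts on that coefficient by
  \<open>eigval k\<close>, and by l as well.\<close>

lemma fourier_eigenvector:
  assumes "\<And>i. (\<Sum>d\<in>{1, -1, 2, -2}. y (i + d)) = l *\<^sub>C y i" and "eigval k \<noteq> l"
  shows "(\<Sum>j\<in>UNIV. chi (- (k * j)) *\<^sub>C y j) = 0"
proof -
  let ?F = "\<Sum>j\<in>UNIV. chi (- (k * j)) *\<^sub>C y j"
  have shift: "(\<Sum>j\<in>UNIV. chi (- (k * j)) *\<^sub>C y (j + d)) = (\<Sum>j\<in>UNIV. chi (- (k * (j - d))) *\<^sub>C y j)" for d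
    using sum_translate[of "\<lambda>j. chi (- (k * (j - d))) *\<^sub>C y j" d] by simp
  have "l *\<^sub>C ?F = (\<Sum>j\<in>UNIV. chi (- (k * j)) *\<^sub>C (\<Sum>d\<in>{1, -1, 2, -2}. y (j + d)))"
    unfolding assms(1) by (simp add: scale_sum_right mult.commute)
  also have "\<dots> = (\<Sum>d\<in>{1, -1, 2, -2}. \<Sum>j\<in>UNIV. chi (- (k * j)) *\<^sub>C y (j + d))"
    unfolding scale_sum_right by (rule sum.swap)
  also have "\<dots> = (\<Sum>d\<in>{1, -1, 2, -2}. \<Sum>j\<in>UNIV. chi (- (k * (j - d))) *\<^sub>C y j)"
    unfolding shift ..
  also have "\<dots> = (\<Sum>d\<in>{1, -1, 2, -2}. chi (d * k) *\<^sub>C ?F)"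
    unfolding scale_sum_right scale_scale chi_add[symmetric]
    by (intro sum.cong refl arg_cong2[where f = "(*\<^sub>C)"] arg_cong[where f = chi]) (simp add: algebra_simps)
  also have "\<dots> = eigval k *\<^sub>C ?F" unfolding eigval_def scale_sum_left ..
  finally have "l = eigval k \<or> ?F = 0" by simp
  then show ?thesis using assms(2) by blast
qed

text \<open>By \<open>eigval_eq_iff\<close> only the Fourier coefficients at 1 and -1 survive; they
  are the witnesses for \<open>a\<close> and \<open>b\<close>.\<close>

lemma eigenvector_solution:
  assumes "\<And>i. (\<Sum>d\<in>{1, -1, 2, -2}. y (i + d)) = eigval 1 *\<^sub>C y i"
  obtains a b where "\<And>i. y i = chi i *\<^sub>C a + chi (- i) *\<^sub>C b"
proof -
  define F where "F k = (1 / 10) *\<^sub>C (\<Sum>j\<in>UNIV. chi (- (k * j)) *\<^sub>C y j)" for k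
  have F: "F k = 0" if "k \<noteq> 1" "k \<noteq> - 1" for k
    unfolding F_def using fourier_eigenvector[OF assms, of k] that by (simp add: eigval_eq_iff)
  have "y i = (\<Sum>k\<in>{1, -1}. chi (k * i) *\<^sub>C F k)" for i
  proof -
    have "y i = (\<Sum>k\<in>UNIV. chi (k * i) *\<^sub>C F k)"
      by (subst fourier_inversion) (simp add: F_def)
    also have "\<dots> = (\<Sum>k\<in>{1, -1}. chi (k * i) *\<^sub>C F k)"
      by (rule sum.mono_neutral_right) (auto simp: F)
    finally show ?thesis .
  qed
  then have "y i = chi i *\<^sub>C F 1 + chi (- i) *\<^sub>C F (- 1)" for i by simp
  then show ?thesis by (rule that)
qed

lemma magic_entries_commute:
  fixes u :: "10 \<Rightarrow> 10 \<Rightarrow> 'a"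
  assumes idem: "\<And>i j. u i j * u i j = u i j" and orth: "\<And>i j k. j \<noteq> k \<Longrightarrow> u i j * u i k = 0"
    and row: "\<And>i. (\<Sum>j\<in>UNIV. u i j) = 1" and col: "\<And>j. (\<Sum>i\<in>UNIV. u i j) = 1"
    and adj: "\<And>i j. (\<Sum>d\<in>{1, -1, 2, -2}. u (i + d) j) = (\<Sum>d\<in>{1, -1, 2, -2}. u i (j + d))"
  shows "u i j * u k l = u k l * u i j"
proof -
  define X where "X m i = (\<Sum>j\<in>UNIV. chi (m * j) *\<^sub>C u i j)" for m i
  \<comment> \<open>Orthogonality within row i kills the cross terms, so m \<mapsto>
    \<open>X m i\<close> turns addition in Z/10 into multiplication.\<close>
  have X_mult: "X m i * X n i = X (m + n) i" for m n i
  proof -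
    have "X m i * X n i = (\<Sum>j\<in>UNIV. \<Sum>k\<in>UNIV. (chi (m * j) * chi (n * k)) *\<^sub>C (u i j * u i k))"
      by (simp add: X_def sum_product sc_left sc_right mult.commute)
    also have "\<dots> = (\<Sum>j\<in>UNIV. \<Sum>k\<in>UNIV. if k = j then (chi (m * j) * chi (n * k)) *\<^sub>C u i j else 0)"
      by (intro sum.cong refl) (simp add: idem orth)
    finally show ?thesis by (simp add: X_def algebra_simps chi_add)
  qed
  have X_0: "X 0 i = 1" for i by (simp add: X_def row)
  have X_sum: "(\<Sum>i\<in>UNIV. X m i) = 0" if "m \<noteq> 0" for m
  proof -
    have "(\<Sum>i\<in>UNIV. X m i) = (\<Sum>j\<in>UNIV. chi (m * j) *\<^sub>C (\<Sum>i\<in>UNIV. u i j))"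
      unfolding X_def scale_sum_right by (rule sum.swap)
    then show ?thesis using that by (simp add: col scale_sum_left[symmetric] sum_chi)
  qed
  have shift: "(\<Sum>j\<in>UNIV. chi (m * j) *\<^sub>C u i (j + d)) = (\<Sum>j\<in>UNIV. chi (m * (j - d)) *\<^sub>C u i j)" for m i d
    using sum_translate[of "\<lambda>j. chi (m * (j - d)) *\<^sub>C u i j" d] by simp
  \<comment> \<open>\<open>adj\<close> moves the neighbour sum from the row index to the column
    index, where translation only multiplies by a character value.\<close>
  have X_eig: "(\<Sum>d\<in>{1, -1, 2, -2}. X m (i + d)) = eigval m *\<^sub>C X m i" for m i
  proof -
    have "(\<Sum>d\<in>{1, -1, 2, -2}. X m (i + d)) = (\<Sum>j\<in>UNIV. chi (m * j) *\<^sub>C (\<Sum>d\<in>{1, -1, 2, -2}. u i (j + d)))"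
      unfolding X_def adj[symmetric] scale_sum_right by (rule sum.swap)
    also have "\<dots> = (\<Sum>d\<in>{1, -1, 2, -2}. \<Sum>j\<in>UNIV. chi (m * j) *\<^sub>C u i (j + d))"
      unfolding scale_sum_right by (rule sum.swap)
    also have "\<dots> = (\<Sum>d\<in>{1, -1, 2, -2}. \<Sum>j\<in>UNIV. chi (m * (j - d)) *\<^sub>C u i j)"
      unfolding shift ..
    also have "\<dots> = (\<Sum>d\<in>{1, -1, 2, -2}. chi (- d * m) *\<^sub>C X m i)"
      unfolding X_def scale_sum_right scale_scale chi_add[symmetric]
      by (intro sum.cong refl arg_cong2[where f = "(*\<^sub>C)"] arg_cong[where f = chi]) (simp add: algebra_simps)
    also have "\<dots> = (\<Sum>d\<in>{1, -1, 2, -2}. chi (- d * m)) *\<^sub>C X m i" unfolding scale_sum_left ..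
    also have "(\<Sum>d\<in>{1, -1, 2, -2}. chi (- d * m)) = eigval m" by (simp add: eigval_def)
    finally show ?thesis .
  qed
  obtain a b where ab: "\<And>i. X 1 i = chi i *\<^sub>C a + chi (- i) *\<^sub>C b"
    using eigenvector_solution[of "X 1"] X_eig[of 1] by blast
  have avg: "(\<Sum>i\<in>UNIV. chi (k * i) *\<^sub>C x) = (if k = 0 then 10 *\<^sub>C x else 0)" for k x
    by (simp add: scale_sum_left[symmetric] sum_chi)
  \<comment> \<open>All exponents have the shape k * i, even \<open>chi (0 * i)\<close>, so that
    \<open>avg\<close> matches every term.\<close>
  have sq: "X 2 i = chi (2 * i) *\<^sub>C (a * a) + chi (0 * i) *\<^sub>C (a * b + b * a) + chi (-2 * i) *\<^sub>C (b * b)" for i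
  proof -
    have "X 2 i = X 1 i * X 1 i" unfolding X_mult by simp
    also have "\<dots> = (chi i * chi i) *\<^sub>C (a * a) + (chi i * chi (- i)) *\<^sub>C (a * b + b * a) + (chi (- i) * chi (- i)) *\<^sub>C (b * b)"
      by (simp add: ab sc_left sc_right algebra_simps)
    finally show ?thesis by (simp add: chi_add[symmetric])
  qed
  \<comment> \<open>Summing over i isolates the coefficient of the trivial character.\<close>
  have "(\<Sum>i\<in>UNIV. X 2 i) = 10 *\<^sub>C (a * b + b * a)"
    unfolding sq sum.distrib avg by simp
  then have anti: "a * b + b * a = 0" using X_sum[of 2] by simp
  have cu: "X 3 i = chi (3 * i) *\<^sub>C (a * a * a) + chi (1 * i) *\<^sub>C (a * a * b) + chi (-1 * i) *\<^sub>C (b * b * a) + chi (-3 * i) *\<^sub>C (b * b * b)" for i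
  proof -
    have "X 3 i = X 2 i * X 1 i" unfolding X_mult by simp
    also have "\<dots> = (chi (2 * i) * chi i) *\<^sub>C (a * a * a) + (chi (2 * i) * chi (- i)) *\<^sub>C (a * a * b)
        + (chi (-2 * i) * chi i) *\<^sub>C (b * b * a) + (chi (-2 * i) * chi (- i)) *\<^sub>C (b * b * b)"
      unfolding sq anti by (simp add: ab sc_left sc_right algebra_simps)
    finally show ?thesis by (simp add: chi_add[symmetric])
  qed
  \<comment> \<open>\<open>X 3\<close> belongs to \<open>eigval 3\<close>, so its Fourier
    coefficients at the frequencies 1 and -1 of \<open>eigval 1\<close> vanish.\<close>
  have "eigval 3 \<noteq> eigval 1" by (simp add: eigval_eq_iff)
  then have eig3: "(\<Sum>j\<in>UNIV. chi (- (k * j)) *\<^sub>C X 3 j) = 0" if "k = 1 \<or> k = -1" for k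
    using fourier_eigenvector[of "X 3" "eigval 3" k] X_eig[of 3] eigval_eq_iff[of k] that by auto
  \<comment> \<open>The four frequencies are 2, 0, -2, -4 for k = 1 and 4, 2, 0, -2 for k = -1.
    Modulo 10 exactly one of them is zero, which singles out one product of \<open>a\<close> and
    \<open>b\<close>.\<close>
  have coeff: "(\<Sum>i\<in>UNIV. chi (- (k * i)) *\<^sub>C X 3 i) =
      (\<Sum>i\<in>UNIV. chi ((3 - k) * i) *\<^sub>C (a * a * a)) + (\<Sum>i\<in>UNIV. chi ((1 - k) * i) *\<^sub>C (a * a * b))
      + (\<Sum>i\<in>UNIV. chi ((-1 - k) * i) *\<^sub>C (b * b * a)) + (\<Sum>i\<in>UNIV. chi ((-3 - k) * i) *\<^sub>C (b * b * b))" for k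
    unfolding cu sum.distrib[symmetric] scale_right_distrib scale_scale chi_add[symmetric]
    by (intro sum.cong refl arg_cong2[where f = "(+)"] arg_cong2[where f = "(*\<^sub>C)"] arg_cong[where f = chi])
      (simp_all add: left_diff_distrib)
  have aab: "a * a * b = 0"
    using eig3[of 1] unfolding coeff avg by simp
  have bba: "b * b * a = 0"
    using eig3[of "-1"] unfolding coeff avg by simp
  have ab_ba: "b * a = - (a * b)" using anti by (simp add: add_eq_0_iff)
  have "b * (a * b) = 0"
    using bba ab_ba by (metis mult.assoc mult_minus_right neg_equal_0_iff_equal)
  then have "X 1 0 * (a * b) = 0"
    using aab by (simp add: ab sc_left distrib_right mult.assoc)
  \<comment> \<open>\<open>X (-1) 0\<close> is a left inverse of \<open>X 1 0\<close>, by
    \<open>X_mult\<close> and \<open>X_0\<close>.\<close>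
  then have "X (-1) 0 * X 1 0 * (a * b) = 0" by (simp add: mult.assoc)
  then have ab0: "a * b = 0" unfolding X_mult by (simp add: X_0)
  then have ba0: "b * a = 0" using ab_ba by simp
  have X1_comm: "X 1 i * X 1 k = X 1 k * X 1 i" for i k
    by (simp add: ab sc_left sc_right distrib_left distrib_right ab0 ba0 mult.commute)
  have X_pow: "X (of_nat n) i = X 1 i ^ n" for n i
  proof (induction n)
    case (Suc n)
    then show ?case using X_mult[of 1 i "of_nat n"] by simp
  qed (simp add: X_0)
  have X_comm: "X m i * X n k = X n k * X m i" for m n i k
  proof -
    have "\<exists>r. m = of_nat r" for m :: 10
      by (cases m) (metis of_nat_nat)
    then obtain r s where "m = of_nat r" "n = of_nat s" by metis
    moreover have "X 1 k ^ s * X 1 i ^ r = X 1 i ^ r * X 1 k ^ s"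
      by (rule power_commuting_commutes[OF power_commuting_commutes[OF X1_comm, symmetric]])
    ultimately show ?thesis by (simp add: X_pow)
  qed
  \<comment> \<open>\<open>X\<close> is built with \<open>chi (m * j)\<close> but
    \<open>fourier_inversion\<close> expects the inverse character, so the row is read at negated
    indices.\<close>
  have u: "u i j = (\<Sum>m\<in>UNIV. (chi (m * (- j)) / 10) *\<^sub>C X m i)" for i j
  proof -
    have "X m i = (\<Sum>n\<in>UNIV. chi (- (m * n)) *\<^sub>C u i (- n))" for m
      unfolding X_def by (rule sum.reindex_bij_witness[of _ uminus uminus]) auto
    then show ?thesis using fourier_inversion[of "\<lambda>n. u i (- n)" "- j"] by simp
  qed
  show ?thesis
    unfolding u sum_product sc_left sc_right
    by (subst sum.swap) (simp add: X_comm mult.commute)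
qed

end

section \<open>Commutativity of the generators\<close>

interpretation qaut_C10_2: cstar_algebra "qaut_algebra C10_2"
  by (rule cstar_qaut)

text \<open>A type copy of the carrier, so that the type class lemmas on finite sums apply.\<close>
typedef qaut_C10_2 = "carrier (qaut_algebra C10_2)"
  using qaut_C10_2.zero_closed by blast

setup_lifting type_definition_qaut_C10_2

instantiation qaut_C10_2 :: "{ring, monoid_mult}"
begin

lift_definition zero_qaut_C10_2 :: qaut_C10_2 is "\<zero>\<^bsub>qaut_algebra C10_2\<^esub>" by simp
lift_definition one_qaut_C10_2 :: qaut_C10_2 is "\<one>\<^bsub>qaut_algebra C10_2\<^esub>" by simp
lift_definition plus_qaut_C10_2 :: "qaut_C10_2 \<Rightarrow> qaut_C10_2 \<Rightarrow> qaut_C10_2" is "(\<oplus>\<^bsub>qaut_algebra C10_2\<^esub>)" by simp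
lift_definition times_qaut_C10_2 :: "qaut_C10_2 \<Rightarrow> qaut_C10_2 \<Rightarrow> qaut_C10_2" is "(\<otimes>\<^bsub>qaut_algebra C10_2\<^esub>)" by simp
lift_definition uminus_qaut_C10_2 :: "qaut_C10_2 \<Rightarrow> qaut_C10_2" is "a_inv (qaut_algebra C10_2)" by simp
lift_definition minus_qaut_C10_2 :: "qaut_C10_2 \<Rightarrow> qaut_C10_2 \<Rightarrow> qaut_C10_2" is "a_minus (qaut_algebra C10_2)" by simp

instance
proof
  fix a b c :: qaut_C10_2
  show "a + b + c = a + (b + c)" by transfer (rule qaut_C10_2.a_assoc)
  show "a + b = b + a" by transfer (rule qaut_C10_2.a_comm)
  show "0 + a = a" by transfer (rule qaut_C10_2.l_zero)
  show "- a + a = 0" by transfer (rule qaut_C10_2.l_neg)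
  show "a - b = a + - b" by transfer (simp only: a_minus_def)
  show "a * b * c = a * (b * c)" by transfer (rule qaut_C10_2.m_assoc)
  show "1 * a = a" by transfer (rule qaut_C10_2.l_one)
  show "a * 1 = a" by transfer (rule qaut_C10_2.r_one)
  show "(a + b) * c = a * c + b * c" by transfer (rule qaut_C10_2.l_distr)
  show "a * (b + c) = a * b + a * c" by transfer (rule qaut_C10_2.r_distr)
qed

end

lift_definition smult_C10_2 :: "complex \<Rightarrow> qaut_C10_2 \<Rightarrow> qaut_C10_2" is "module.smult (qaut_algebra C10_2)"
  by (rule qaut_C10_2.smult_closed)

lift_definition gen_C10_2 :: "10 \<Rightarrow> 10 \<Rightarrow> qaut_C10_2" is "qaut_gen C10_2"
  using qaut_gen_magic(1)[of C10_2] by (simp add: magic_unitary_def)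

interpretation qaut_C10_2: complex_algebra smult_C10_2
proof
  fix c d :: complex and x y :: qaut_C10_2
  show "smult_C10_2 c (x + y) = smult_C10_2 c x + smult_C10_2 c y"
    by transfer (rule qaut_C10_2.smult_r_distr)
  show "smult_C10_2 (c + d) x = smult_C10_2 c x + smult_C10_2 d x"
    by transfer (rule qaut_C10_2.smult_l_distr)
  show "smult_C10_2 c (smult_C10_2 d x) = smult_C10_2 (c * d) x"
    by transfer (rule qaut_C10_2.smult_assoc[symmetric])
  show "smult_C10_2 1 x = x" by transfer (rule qaut_C10_2.smult_one)
  show "smult_C10_2 c x * y = smult_C10_2 c (x * y)"
    by transfer (rule qaut_C10_2.smult_mult_left)
  show "x * smult_C10_2 c y = smult_C10_2 c (x * y)"
    by transfer (rule qaut_C10_2.smult_mult_right)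
qed

lemma Rep_sum_C10_2:
  assumes "finite S"
  shows "Rep_qaut_C10_2 (sum f S) = (\<Oplus>\<^bsub>qaut_algebra C10_2\<^esub>i\<in>S. Rep_qaut_C10_2 (f i))"
  using assms by induction (simp_all add: zero_qaut_C10_2.rep_eq plus_qaut_C10_2.rep_eq Rep_qaut_C10_2)

text \<open>Substituting the difference d = k - i gives the neighbour sums the form used in
  \<open>magic_entries_commute\<close>.\<close>

lemma sum_C10_2_neighbours:
  fixes f :: "10 \<Rightarrow> qaut_C10_2"
  shows "(\<Sum>k\<in>UNIV. smult_C10_2 (of_bool (C10_2 i k)) (f k)) = (\<Sum>d\<in>{1, -1, 2, -2}. f (i + d))"
proof -
  define S where "S = {1, -1, 2, -2 :: 10}"
  have "(\<Sum>k\<in>UNIV. smult_C10_2 (of_bool (C10_2 i k)) (f k))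
      = (\<Sum>d\<in>UNIV. smult_C10_2 (of_bool (C10_2 i (d + i))) (f (d + i)))"
    by (rule sum_translate[symmetric])
  also have "\<dots> = (\<Sum>d\<in>UNIV. smult_C10_2 (of_bool (d \<in> S)) (f (i + d)))"
    unfolding C10_2_iff S_def[symmetric] add_diff_cancel_right' by (simp only: add.commute)
  also have "\<dots> = (\<Sum>d\<in>S. f (i + d))"
    by (rule sum.mono_neutral_cong_right) simp_all
  finally show ?thesis unfolding S_def .
qed

lemma qaut_gen_C10_2_commute:
  "qaut_gen C10_2 i j \<otimes>\<^bsub>qaut_algebra C10_2\<^esub> qaut_gen C10_2 k l =
   qaut_gen C10_2 k l \<otimes>\<^bsub>qaut_algebra C10_2\<^esub> qaut_gen C10_2 i j"
proof -
  note magic = qaut_gen_magic(1)[of C10_2, unfolded magic_unitary_def]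
  note rep = Rep_qaut_C10_2_inject[symmetric] times_qaut_C10_2.rep_eq gen_C10_2.rep_eq
    zero_qaut_C10_2.rep_eq one_qaut_C10_2.rep_eq Rep_sum_C10_2[OF finite] smult_C10_2.rep_eq
  have "gen_C10_2 i j * gen_C10_2 k l = gen_C10_2 k l * gen_C10_2 i j"
  proof (rule qaut_C10_2.magic_entries_commute)
    fix i j
    have "(\<Sum>k\<in>UNIV. smult_C10_2 (of_bool (C10_2 i k)) (gen_C10_2 k j)) =
        (\<Sum>k\<in>UNIV. smult_C10_2 (of_bool (C10_2 k j)) (gen_C10_2 i k))"
      unfolding rep using qaut_gen_magic(2)[of C10_2] unfolding commutes_with_adjacency_def by blast
    \<comment> \<open>Symmetry of the graph puts the fixed vertex j first, as
      \<open>sum_C10_2_neighbours\<close> requires.\<close>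
    also have "\<dots> = (\<Sum>k\<in>UNIV. smult_C10_2 (of_bool (C10_2 j k)) (gen_C10_2 i k))"
    proof (rule sum.cong[OF refl])
      fix k
      have "C10_2 k j \<longleftrightarrow> C10_2 j k"
        using simple_graph_C10_2 sympD[of C10_2 j k] sympD[of C10_2 k j] unfolding simple_graph_def by argo
      then show "smult_C10_2 (of_bool (C10_2 k j)) (gen_C10_2 i k) = smult_C10_2 (of_bool (C10_2 j k)) (gen_C10_2 i k)"
        by (simp only:)
    qed
    finally show "(\<Sum>d\<in>{1, -1, 2, -2}. gen_C10_2 (i + d) j) = (\<Sum>d\<in>{1, -1, 2, -2}. gen_C10_2 i (j + d))"
      unfolding sum_C10_2_neighbours .
  next
    fix i j k :: 10
    show "gen_C10_2 i j * gen_C10_2 i j = gen_C10_2 i j"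
      unfolding rep using magic by simp
    show "gen_C10_2 i j * gen_C10_2 i k = 0" if "j \<noteq> k"
      unfolding rep using magic that by simp
    show "(\<Sum>j\<in>UNIV. gen_C10_2 i j) = 1"
      unfolding rep using magic by simp
    show "(\<Sum>i\<in>UNIV. gen_C10_2 i j) = 1"
      unfolding rep using magic by simp
  qed
  then show ?thesis unfolding rep .
qed

section \<open>Commutative quantum automorphism algebras\<close>

lemma (in cstar_algebra) conv_smult_left:
  assumes c: "c \<longlonglongrightarrow> d" and p: "p \<in> carrier A"
  shows "conv (\<lambda>n. c n \<odot> p) (d \<odot> p)"
proof -
  have "c n \<odot> p \<ominus> d \<odot> p = (c n - d) \<odot> p" for n
    using smult_l_distr[OF p, of "c n" "(-1) * d"] smult_assoc[OF p, of "-1" d] p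
    by (simp add: smult_minus smult_closed a_minus_def)
  moreover have "(\<lambda>n. cmod (c n - d) * cnorm A p) \<longlonglongrightarrow> 0"
    using c by (intro tendsto_mult_left_zero tendsto_norm_zero LIM_zero)
  ultimately show ?thesis by (simp add: conv_def p smult_closed norm_smult)
qed

text \<open>Polynomials in the generators are dense, so closure under the algebra operations and
  norm limits suffices. The generators are self-adjoint, hence there is no case for
  \<open>star\<close>.\<close>

lemma qaut_induct [consumes 1, case_names one gen smult add mult limit]:
  assumes x: "x \<in> carrier (qaut_algebra E)"
    and one: "P \<one>\<^bsub>qaut_algebra E\<^esub>" and gen: "\<And>i j. P (qaut_gen E i j)"
    and smult: "\<And>c x. x \<in> carrier (qaut_algebra E) \<Longrightarrow> P x \<Longrightarrow> P (c \<odot>\<^bsub>qaut_algebra E\<^esub> x)"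
    and add: "\<And>x y. x \<in> carrier (qaut_algebra E) \<Longrightarrow> y \<in> carrier (qaut_algebra E) \<Longrightarrow> P x \<Longrightarrow> P y
      \<Longrightarrow> P (x \<oplus>\<^bsub>qaut_algebra E\<^esub> y)"
    and mult: "\<And>x y. x \<in> carrier (qaut_algebra E) \<Longrightarrow> y \<in> carrier (qaut_algebra E) \<Longrightarrow> P x \<Longrightarrow> P y
      \<Longrightarrow> P (x \<otimes>\<^bsub>qaut_algebra E\<^esub> y)"
    and limit: "\<And>f x. cstar_algebra.conv (qaut_algebra E) f x \<Longrightarrow> (\<And>n. P (f n)) \<Longrightarrow> P x"
  shows "P x"
proof -
  let ?A = "qaut_algebra E"
  interpret A: cstar_algebra ?A by (rule cstar_qaut)
  define v where "v = univ_gen (qaut_relators E)"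
  have v: "v g = qaut_gen E (fst g) (snd g)" for g by (simp add: v_def qaut_gen_def)
  have vc: "v g \<in> carrier ?A" for g
    using qaut_gen_magic(1)[of E] by (simp add: v magic_unitary_def)
  have w: "P (A.word_eval v (Word l))" for l
  proof (induction l)
    case (Cons g l)
    have "A.word_eval v (Word (g # l)) = v g \<otimes>\<^bsub>?A\<^esub> A.word_eval v (Word l)"
      by (simp add: A.word_eval_def)
    moreover have "P (v g)" by (simp add: v gen)
    ultimately show ?case using Cons vc A.word_eval_closed[of v, OF vc] by (simp add: mult)
  qed (simp add: A.word_eval_def one)
  have e: "P (A.poly_eval v a)" for a
  proof (induction a rule: fsa_induct)
    case (single u c)
    then show ?case
      using w[of "letters u"] by (simp add: A.poly_eval_single[of v, OF vc] smult A.word_eval_closed[of v, OF vc])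
  next
    case (add a b)
    then show ?case
      by (simp add: A.poly_eval_add[of v, OF vc] A.poly_eval_closed[of v, OF vc] assms(5))
  qed
  have "\<exists>a. cnorm ?A (x \<ominus>\<^bsub>?A\<^esub> A.poly_eval v a) < 1 / real (Suc n)" for n
    using univ_cstar_generated[OF bounded_relators_qaut, of x E "1 / real (Suc n)"] x
    by (simp add: qaut_algebra_def v_def)
  then obtain a where a: "\<And>n. cnorm ?A (x \<ominus>\<^bsub>?A\<^esub> A.poly_eval v (a n)) < 1 / real (Suc n)" by metis
  have pc: "A.poly_eval v (a n) \<in> carrier ?A" for n by (rule A.poly_eval_closed[of v, OF vc])
  have "(\<lambda>n. cnorm ?A (A.poly_eval v (a n) \<ominus>\<^bsub>?A\<^esub> x)) \<longlonglongrightarrow> 0"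
  proof (rule A.null_le)
    show "(\<lambda>n. 1 / real (Suc n)) \<longlonglongrightarrow> 0" by (rule LIMSEQ_Suc[OF lim_1_over_n])
    show "cnorm ?A (A.poly_eval v (a n) \<ominus>\<^bsub>?A\<^esub> x) \<le> 1 / real (Suc n)" for n
      using a[of n] A.norm_minus_commute[OF x pc] by simp
  qed (use x pc in simp)
  then have "A.conv (\<lambda>n. A.poly_eval v (a n)) x" by (simp add: A.conv_def pc x)
  then show ?thesis by (rule limit) (rule e)
qed

text \<open>The elements commuting with a fixed \<open>y\<close> form a closed subalgebra.
  \<open>step\<close> uses this twice: first with a generator as the fixed element, then with an
  arbitrary one.\<close>

lemma commutative_qautI:
  assumes gens: "\<And>i j k l. qaut_gen E i j \<otimes>\<^bsub>qaut_algebra E\<^esub> qaut_gen E k l =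
    qaut_gen E k l \<otimes>\<^bsub>qaut_algebra E\<^esub> qaut_gen E i j"
  shows "commutative_algebra (qaut_algebra E)"
proof -
  let ?A = "qaut_algebra E"
  interpret A: cstar_algebra ?A by (rule cstar_qaut)
  have g: "qaut_gen E i j \<in> carrier ?A" for i j
    using qaut_gen_magic(1)[of E] by (simp add: magic_unitary_def)
  have step: "x \<otimes>\<^bsub>?A\<^esub> y = y \<otimes>\<^bsub>?A\<^esub> x"
    if x: "x \<in> carrier ?A" and y: "y \<in> carrier ?A"
      and yg: "\<And>i j. qaut_gen E i j \<otimes>\<^bsub>?A\<^esub> y = y \<otimes>\<^bsub>?A\<^esub> qaut_gen E i j" for x y
    using x
  proof (induction rule: qaut_induct)
    case (mult x z)
    have "x \<otimes>\<^bsub>?A\<^esub> z \<otimes>\<^bsub>?A\<^esub> y = x \<otimes>\<^bsub>?A\<^esub> (y \<otimes>\<^bsub>?A\<^esub> z)"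
      using mult y by (simp only: A.m_assoc)
    also have "\<dots> = x \<otimes>\<^bsub>?A\<^esub> y \<otimes>\<^bsub>?A\<^esub> z"
      using mult.hyps y by (intro A.m_assoc[symmetric])
    also have "\<dots> = y \<otimes>\<^bsub>?A\<^esub> (x \<otimes>\<^bsub>?A\<^esub> z)"
      unfolding mult.IH(1) using mult.hyps y by (intro A.m_assoc)
    finally show ?case .
  next
    case (limit f x)
    have "A.conv (\<lambda>n. f n \<otimes>\<^bsub>?A\<^esub> y) (x \<otimes>\<^bsub>?A\<^esub> y)"
      by (rule A.conv_mult[OF limit(1) A.conv_const[OF y]])
    moreover have "A.conv (\<lambda>n. f n \<otimes>\<^bsub>?A\<^esub> y) (y \<otimes>\<^bsub>?A\<^esub> x)"
      unfolding limit(2) by (rule A.conv_mult[OF A.conv_const[OF y] limit(1)])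
    ultimately show ?case by (rule A.conv_unique)
  next
    case one
    show ?case using y by simp
  next
    case (gen i j)
    show ?case by (rule yg)
  next
    case (smult c x)
    then show ?case using y by (simp only: A.smult_mult_left A.smult_mult_right)
  next
    case (add x z)
    then show ?case using y by (simp only: A.l_distr A.r_distr)
  qed
  show ?thesis
    unfolding commutative_algebra_def
  proof (intro ballI)
    fix x y assume x: "x \<in> carrier ?A" and y: "y \<in> carrier ?A"
    have "y \<otimes>\<^bsub>?A\<^esub> qaut_gen E i j = qaut_gen E i j \<otimes>\<^bsub>?A\<^esub> y" for i j
      by (rule step[OF y g]) (rule gens)
    then show "x \<otimes>\<^bsub>?A\<^esub> y = y \<otimes>\<^bsub>?A\<^esub> x"
      by (rule step[OF x y, OF sym])
  qed
qed

section \<open>From commutativity to the canonical isomorphism\<close>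

text \<open>Multiply entry (i, l) of the commutation relation by \<open>u i j\<close> on the left
  and \<open>u k l\<close> on the right. Orthogonality in row i and in column l leaves the same
  product with coefficient \<open>E i k\<close> on one side and \<open>E j l\<close> on the
  other.\<close>

lemma magic_adjacency_orthogonal:
  assumes B: "cstar_algebra B" and u: "magic_unitary B u" "commutes_with_adjacency E B u"
    and E: "E i k \<noteq> E j l"
  shows "u i j \<otimes>\<^bsub>B\<^esub> u k l = \<zero>\<^bsub>B\<^esub>"
proof -
  interpret B: cstar_algebra B by (rule B)
  have c: "u i j \<in> carrier B" for i j using u(1) by (simp add: magic_unitary_def)
  have sc: "z \<odot>\<^bsub>B\<^esub> u i j \<in> carrier B" for z i j by (simp add: c B.smult_closed)
  have ck: "u m l \<otimes>\<^bsub>B\<^esub> u k l = (if k = m then u k l else \<zero>\<^bsub>B\<^esub>)" for m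
    using u(1) by (simp add: magic_unitary_def)
  have cj: "u i j \<otimes>\<^bsub>B\<^esub> u i m = (if j = m then u i j else \<zero>\<^bsub>B\<^esub>)" for m
    using u(1) by (auto simp: magic_unitary_def)
  have z: "z \<odot>\<^bsub>B\<^esub> (if P then x else \<zero>\<^bsub>B\<^esub>) = (if P then z \<odot>\<^bsub>B\<^esub> x else \<zero>\<^bsub>B\<^esub>)" for z x P
    by (simp add: B.smult_zero_right)
  have "of_bool (E i k) \<odot>\<^bsub>B\<^esub> (u i j \<otimes>\<^bsub>B\<^esub> u k l) =
      u i j \<otimes>\<^bsub>B\<^esub> ((\<Oplus>\<^bsub>B\<^esub>m\<in>UNIV. of_bool (E i m) \<odot>\<^bsub>B\<^esub> u m l) \<otimes>\<^bsub>B\<^esub> u k l)"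
    by (simp add: B.finsum_ldistr c sc Pi_def B.smult_mult_left ck z
        B.finsum_singleton[of k] B.smult_mult_right cong: if_cong) 
  also have "\<dots> = (u i j \<otimes>\<^bsub>B\<^esub> (\<Oplus>\<^bsub>B\<^esub>m\<in>UNIV. of_bool (E m l) \<odot>\<^bsub>B\<^esub> u i m)) \<otimes>\<^bsub>B\<^esub> u k l"
    using u(2) by (simp add: commutes_with_adjacency_def B.m_assoc c sc Pi_def)
  also have "\<dots> = of_bool (E j l) \<odot>\<^bsub>B\<^esub> (u i j \<otimes>\<^bsub>B\<^esub> u k l)"
    by (simp add: B.finsum_rdistr c sc Pi_def B.smult_mult_right cj z
        B.finsum_singleton[of j] B.smult_mult_left cong: if_cong)
  finally show ?thesis using E c
    by (cases "E i k") (auto simp: B.smult_one B.smult_zero_left)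
qed

theorem no_quantum_symmetryI:
  assumes comm: "commutative_algebra (qaut_algebra E)"
  shows "no_quantum_symmetry E"
proof -
  let ?A = "qaut_algebra E" and ?G = "graph_aut E" and ?u = "qaut_gen E"
  let ?B = "fun_cstar ?G"
  interpret A: cstar_algebra ?A by (rule cstar_qaut)
  interpret A: cring ?A
    using comm by unfold_locales (auto simp: commutative_algebra_def)
  note magic = qaut_gen_magic(1)[of E, unfolded magic_unitary_def]
  have uc: "?u i j \<in> carrier ?A" for i j using magic by simp
  define \<phi> where "\<phi> = canonical_surjection E"
  have \<phi>: "\<phi> \<in> cstar_hom ?A ?B" "\<And>i j. \<phi> (?u i j) = aut_indicator E i j"
    using theI'[OF canonical_surjection_unique_existence[of E]]
    unfolding \<phi>_def canonical_surjection_def by auto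
  have \<phi>c: "\<phi> x \<in> extensional ?G" if "x \<in> carrier ?A" for x
    using \<phi>(1) that by (auto simp: cstar_hom_def ring_hom_def fun_cstar_def)
  have \<phi>_simps: "\<phi> \<one>\<^bsub>?A\<^esub> \<sigma> = 1" "\<And>x y. x \<in> carrier ?A \<Longrightarrow> y \<in> carrier ?A \<Longrightarrow> \<phi> (x \<otimes>\<^bsub>?A\<^esub> y) \<sigma> = \<phi> x \<sigma> * \<phi> y \<sigma>"
    "\<And>x y. x \<in> carrier ?A \<Longrightarrow> y \<in> carrier ?A \<Longrightarrow> \<phi> (x \<oplus>\<^bsub>?A\<^esub> y) \<sigma> = \<phi> x \<sigma> + \<phi> y \<sigma>"
    "\<And>c x. x \<in> carrier ?A \<Longrightarrow> \<phi> (c \<odot>\<^bsub>?A\<^esub> x) \<sigma> = c * \<phi> x \<sigma>"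
    "\<And>i j. \<phi> (?u i j) \<sigma> = of_bool (\<sigma> j = i)"
    if "\<sigma> \<in> ?G" for \<sigma>
    using that \<phi> by (auto simp: cstar_hom_def ring_hom_def fun_cstar_def aut_indicator_def)
  have \<phi>_zero: "\<phi> \<zero>\<^bsub>?A\<^esub> \<sigma> = 0" if "\<sigma> \<in> ?G" for \<sigma>
    using \<phi>_simps(4)[OF that, of "\<one>\<^bsub>?A\<^esub>" 0] by (simp add: A.smult_zero_left)
  \<comment> \<open>One factor per column, for every self-map \<sigma> of the vertices. On
    automorphisms, \<open>p \<sigma>\<close> will be the preimage of the indicator of
    \<sigma>.\<close>
  define p where "p \<sigma> = (\<Otimes>\<^bsub>?A\<^esub>j\<in>UNIV. ?u (\<sigma> j) j)" for \<sigma>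
  have pc: "p \<sigma> \<in> carrier ?A" for \<sigma> by (simp add: p_def uc)
  have p_remove: "p \<sigma> = ?u (\<sigma> j) j \<otimes>\<^bsub>?A\<^esub> (\<Otimes>\<^bsub>?A\<^esub>k\<in>UNIV - {j}. ?u (\<sigma> k) k)" for \<sigma> j
    unfolding p_def using A.finprod_insert[of "UNIV - {j}" j "\<lambda>k. ?u (\<sigma> k) k"]
    by (simp add: uc)
  have p_absorb: "?u i j \<otimes>\<^bsub>?A\<^esub> p \<sigma> = of_bool (\<sigma> j = i) \<odot>\<^bsub>?A\<^esub> p \<sigma>" for i j \<sigma>
  proof -
    let ?r = "\<Otimes>\<^bsub>?A\<^esub>k\<in>UNIV - {j}. ?u (\<sigma> k) k"
    have r: "?r \<in> carrier ?A" by (simp add: uc)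
    have "?u i j \<otimes>\<^bsub>?A\<^esub> (?u (\<sigma> j) j \<otimes>\<^bsub>?A\<^esub> ?r) = (if \<sigma> j = i then ?u (\<sigma> j) j else \<zero>\<^bsub>?A\<^esub>) \<otimes>\<^bsub>?A\<^esub> ?r"
      using magic r by (auto simp: A.m_assoc[symmetric])
    then show ?thesis unfolding p_remove[of \<sigma> j] using r uc
      by (auto simp: A.smult_one A.smult_zero_left)
  qed
  have p_outside: "p \<sigma> = \<zero>\<^bsub>?A\<^esub>" if "\<sigma> \<notin> ?G" for \<sigma>
  proof -
    \<comment> \<open>If \<sigma> is not injective, two factors lie in one row; otherwise \<sigma>
      violates adjacency on some pair. Either way two factors are orthogonal, and
      \<open>p \<sigma>\<close> absorbs both of them.\<close>
    have "\<exists>j k. ?u (\<sigma> j) j \<otimes>\<^bsub>?A\<^esub> ?u (\<sigma> k) k = \<zero>\<^bsub>?A\<^esub>"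
    proof (cases "inj \<sigma>")
      case False
      then obtain j k where "j \<noteq> k" "\<sigma> j = \<sigma> k" by (auto simp: inj_def)
      then show ?thesis using magic by metis
    next
      case True
      then have "bij \<sigma>" by (simp add: bij_def finite_UNIV_inj_surj)
      then have "\<not> (\<forall>j k. E (\<sigma> j) (\<sigma> k) \<longleftrightarrow> E j k)" using that by (simp add: graph_aut_def)
      then obtain j k where "E (\<sigma> j) (\<sigma> k) \<noteq> E j k" unfolding not_all by (elim exE)
      then have "?u (\<sigma> j) j \<otimes>\<^bsub>?A\<^esub> ?u (\<sigma> k) k = \<zero>\<^bsub>?A\<^esub>"
        by (rule magic_adjacency_orthogonal[OF cstar_qaut qaut_gen_magic])
      then show ?thesis by (intro exI)
    qed
    then obtain j k where jk: "?u (\<sigma> j) j \<otimes>\<^bsub>?A\<^esub> ?u (\<sigma> k) k = \<zero>\<^bsub>?A\<^esub>" by blast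
    have "?u (\<sigma> j) j \<otimes>\<^bsub>?A\<^esub> (?u (\<sigma> k) k \<otimes>\<^bsub>?A\<^esub> p \<sigma>) = p \<sigma>"
      by (simp add: p_absorb A.smult_one pc)
    then show ?thesis using jk by (simp add: A.m_assoc[symmetric] uc pc)
  qed
  \<comment> \<open>\<open>p \<sigma>\<close> is a joint eigenvector of all multiplications, with
    evaluation at \<sigma> as eigenvalue. The limit case rests on evaluation being contractive, by
    \<open>hom_fun_bound\<close>.\<close>
  have eval: "x \<otimes>\<^bsub>?A\<^esub> p \<sigma> = \<phi> x \<sigma> \<odot>\<^bsub>?A\<^esub> p \<sigma>" if \<sigma>: "\<sigma> \<in> ?G" and x: "x \<in> carrier ?A" for x \<sigma>
    using x
  proof (induction rule: qaut_induct)
    case (mult x y)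
    then show ?case
      by (simp add: \<phi>_simps \<sigma> pc A.m_assoc A.smult_mult_right A.smult_assoc[symmetric] mult.commute)
  next
    case (limit f x)
    then have xc: "x \<in> carrier ?A" and fc: "\<And>n. f n \<in> carrier ?A" by (auto simp: A.conv_def)
    have le: "cmod (\<phi> (f n) \<sigma> - \<phi> x \<sigma>) \<le> cnorm ?A (f n \<ominus>\<^bsub>?A\<^esub> x)" for n
    proof -
      have "\<phi> (f n) \<sigma> - \<phi> x \<sigma> = \<phi> (f n \<oplus>\<^bsub>?A\<^esub> (-1) \<odot>\<^bsub>?A\<^esub> x) \<sigma>"
        by (simp add: \<phi>_simps \<sigma> xc fc A.smult_closed)
      also have "f n \<oplus>\<^bsub>?A\<^esub> (-1) \<odot>\<^bsub>?A\<^esub> x = f n \<ominus>\<^bsub>?A\<^esub> x"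
        by (simp add: A.smult_minus xc a_minus_def)
      finally show ?thesis using A.hom_fun_bound[OF \<phi>(1) _ \<sigma>, of "f n \<ominus>\<^bsub>?A\<^esub> x"] xc fc by simp
    qed
    have null: "(\<lambda>n. cnorm ?A (f n \<ominus>\<^bsub>?A\<^esub> x)) \<longlonglongrightarrow> 0"
       using limit(1) by (simp add: A.conv_def)
    have "(\<lambda>n. \<phi> (f n) \<sigma>) \<longlonglongrightarrow> \<phi> x \<sigma>"
      by (rule metric_tendsto_imp_tendsto[OF null])
        (auto simp: dist_norm intro!: always_eventually order_trans[OF le abs_ge_self])
    then have "A.conv (\<lambda>n. f n \<otimes>\<^bsub>?A\<^esub> p \<sigma>) (\<phi> x \<sigma> \<odot>\<^bsub>?A\<^esub> p \<sigma>)"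
      unfolding limit(2) by (rule A.conv_smult_left) (rule pc)
    moreover have "A.conv (\<lambda>n. f n \<otimes>\<^bsub>?A\<^esub> p \<sigma>) (x \<otimes>\<^bsub>?A\<^esub> p \<sigma>)"
      by (rule A.conv_mult[OF limit(1) A.conv_const[OF pc]])
    ultimately show ?case by (metis A.conv_unique)
  qed (simp_all add: \<phi>_simps \<sigma> pc p_absorb A.smult_one A.l_distr A.smult_l_distr A.smult_mult_left A.smult_assoc)
  \<comment> \<open>This plays the part of expanding 1 into all products: columns are peeled off one
    at a time, with \<sigma> overwritten at j by each i, and summing over i uses that column j adds
    up to 1.\<close>
  have separate: "x = y"
    if "finite S" "x \<in> carrier ?A" "y \<in> carrier ?A"
      "\<And>\<sigma>. x \<otimes>\<^bsub>?A\<^esub> (\<Otimes>\<^bsub>?A\<^esub>j\<in>S. ?u (\<sigma> j) j) = y \<otimes>\<^bsub>?A\<^esub> (\<Otimes>\<^bsub>?A\<^esub>j\<in>S. ?u (\<sigma> j) j)" for S x y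
    using that
  proof (induction S arbitrary: x y)
    case (insert j S)
    have "x \<otimes>\<^bsub>?A\<^esub> ?u i j = y \<otimes>\<^bsub>?A\<^esub> ?u i j" for i
    proof (rule insert.IH)
      fix \<sigma>
      have "(\<Otimes>\<^bsub>?A\<^esub>k\<in>S. ?u ((\<sigma>(j := i)) k) k) = (\<Otimes>\<^bsub>?A\<^esub>k\<in>S. ?u (\<sigma> k) k)"
        by (rule A.finprod_cong') (use insert.hyps in \<open>auto simp: uc\<close>)
      then have S: "(\<Otimes>\<^bsub>?A\<^esub>k\<in>insert j S. ?u ((\<sigma>(j := i)) k) k) = ?u i j \<otimes>\<^bsub>?A\<^esub> (\<Otimes>\<^bsub>?A\<^esub>k\<in>S. ?u (\<sigma> k) k)"
        using insert.hyps by (subst A.finprod_insert) (simp_all add: uc)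
      show "x \<otimes>\<^bsub>?A\<^esub> ?u i j \<otimes>\<^bsub>?A\<^esub> (\<Otimes>\<^bsub>?A\<^esub>j\<in>S. ?u (\<sigma> j) j) = y \<otimes>\<^bsub>?A\<^esub> ?u i j \<otimes>\<^bsub>?A\<^esub> (\<Otimes>\<^bsub>?A\<^esub>j\<in>S. ?u (\<sigma> j) j)"
        using insert.prems(3)[of "\<sigma>(j := i)"] insert.prems(1,2) unfolding S by (simp add: A.m_assoc uc)
    qed (use insert.prems uc in simp_all)
    then have "(\<Oplus>\<^bsub>?A\<^esub>i\<in>UNIV. x \<otimes>\<^bsub>?A\<^esub> ?u i j) = (\<Oplus>\<^bsub>?A\<^esub>i\<in>UNIV. y \<otimes>\<^bsub>?A\<^esub> ?u i j)" by simp
    then show ?case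
      using magic insert.prems by (simp add: uc flip: A.finsum_rdistr)
  qed simp
  have "inj_on \<phi> (carrier ?A)"
  proof (rule inj_onI)
    fix x y assume xy: "x \<in> carrier ?A" "y \<in> carrier ?A" "\<phi> x = \<phi> y"
    have xp: "x \<otimes>\<^bsub>?A\<^esub> p \<sigma> = y \<otimes>\<^bsub>?A\<^esub> p \<sigma>" for \<sigma>
      by (cases "\<sigma> \<in> ?G") (simp_all add: eval p_outside xy)
    show "x = y" by (rule separate[OF finite[of UNIV] xy(1,2)]) (rule xp[unfolded p_def])
  qed
  moreover have surj: "\<exists>x\<in>carrier ?A. \<phi> x = g" if g: "g \<in> extensional ?G" for g
  proof -
    \<comment> \<open>Lagrange interpolation: the images of the \<open>p \<sigma>\<close> are the
      point indicators on the automorphism group.\<close>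
    let ?x = "\<Oplus>\<^bsub>?A\<^esub>\<sigma>\<in>?G. g \<sigma> \<odot>\<^bsub>?A\<^esub> p \<sigma>"
    have xc: "?x \<in> carrier ?A" by (simp add: pc A.smult_closed)
    have prod: "\<phi> (\<Otimes>\<^bsub>?A\<^esub>j\<in>S. ?u (\<sigma> j) j) \<tau> = (\<Prod>j\<in>S. of_bool (\<tau> j = \<sigma> j))"
      if "\<tau> \<in> ?G" "finite S" for \<sigma> \<tau> S
      using that(2) by induction (simp_all add: \<phi>_simps that(1) uc)
    have \<phi>p: "\<phi> (p \<sigma>) \<tau> = of_bool (\<tau> = \<sigma>)" if "\<tau> \<in> ?G" for \<sigma> \<tau>
      unfolding p_def prod[OF that finite] by (auto simp: fun_eq_iff)
    have sum: "\<phi> (\<Oplus>\<^bsub>?A\<^esub>\<sigma>\<in>S. g \<sigma> \<odot>\<^bsub>?A\<^esub> p \<sigma>) \<tau> = (\<Sum>\<sigma>\<in>S. g \<sigma> * \<phi> (p \<sigma>) \<tau>)"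
      if "\<tau> \<in> ?G" "finite S" for \<tau> S
      using that(2) by induction (simp_all add: \<phi>_simps \<phi>_zero that(1) pc A.smult_closed)
    have "\<phi> ?x \<tau> = g \<tau>" if "\<tau> \<in> ?G" for \<tau>
      unfolding sum[OF that finite_graph_aut(1)] by (simp add: \<phi>p that finite_graph_aut)
    then have "\<phi> ?x = g" using \<phi>c[OF xc] g by (intro extensionalityI)
    then show ?thesis using xc by blast
  qed
  moreover have "\<phi> ` carrier ?A = extensional ?G"
    using \<phi>c surj by (intro equalityI subsetI) (blast, metis imageI)
  ultimately have "\<phi> \<in> cstar_iso ?A ?B"
    using \<phi>(1) by (simp add: cstar_iso_def bij_betw_def fun_cstar_def)
  then show ?thesis by (simp only: no_quantum_symmetry_def \<phi>_def)
qed


theorem theorem3p2: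
  shows "no_quantum_symmetry C10_2 \<and> commutative_algebra (qaut_algebra C10_2)"
proof -
  have "commutative_algebra (qaut_algebra C10_2)"
    by (rule commutative_qautI[OF qaut_gen_C10_2_commute])
  then show ?thesis by (simp add: no_quantum_symmetryI)
qed

end
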